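(* Let $C\subset\mathbb{R}^2$ be the Koch snowflake curve and let $E=\Omega$ be the bounded open set enclosed by $C$. Let $\mu(F)=|F\cap E|/|E|$ for Borel $F\subseteq\mathbb{R}^2$. Then: (i) there exist positive constants $a,b,c$ such that for every $N$ and every point distribution $\mathcal{P}_N=\{z_1,\dots,z_N\}\subset\mathbb{R}^2$, $$\left\{\int_a^b\int_{SO(2)}\int_{\mathbb{R}^2}|\mathcal{D}_N(x+\tau\sigma\Omega)|^2dx\,d\sigma\,d\tau\right\}^{1/2}\ge c\,N^{\frac{\log_34}{4}};$$ (ii) for every $0<a<b$ there exists $c>0$ such that for every $N$ there exists a point distribution $\mathcal{P}_N=\{z_1,\dots,z_N\}\subseteq E$ with $$\left\{\int_a^b\int_{SO(2)}\int_{\mathbb{R}^2}|\mathcal{D}_N(x+\tau\sigma\Omega)|^2dx\,d\sigma\,d\tau\right\}^{1/2}\le c\,N^{\frac{\log_34}{4}}.$$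
   Context: The snowflake curve: let $C_0$ be the boundary of an equilateral triangle of side $1$ with a horizontal side; $C_{n+1}$ is obtained from the polygon $C_n$ (made of $3\cdot4^n$ segments of length $3^{-n}$) by replacing the middle third of every segment by the other two sides of the equilateral triangle erected outward on that middle third; $C$ is the limit curve of the $C_n$. $|F|$ is Lebesgue measure; $\mathcal{D}_N(R)=\mathrm{card}(\mathcal{P}_N\cap R)-N\mu(R)$; $d\sigma$ is normalized Haar measure on $SO(2)$. *)

theory Defs
  imports "HOL-Analysis.Analysis"
begin

text \<open>Points of the plane are complex numbers.  A polygon is a list of its
  (oriented) edges; the initial triangle is traversed counterclockwise, so
  "outward" is the right-hand side of each edge.\<close>

definition koch_edges0 :: "(complex \<times> complex) list" where
  "koch_edges0 = [(0, 1), (1, cis (pi/3)), (cis (pi/3), 0)]"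

definition koch_refine_edge :: "complex \<times> complex \<Rightarrow> (complex \<times> complex) list" where
  "koch_refine_edge e =
     (let p = fst e; q = snd e; d = (q - p) / 3;
          u = p + d; w = p + 2 * d; t = u + d * cis (- pi/3)
      in [(p, u), (u, t), (t, w), (w, q)])"

fun koch_edges :: "nat \<Rightarrow> (complex \<times> complex) list" where
  "koch_edges 0 = koch_edges0"
| "koch_edges (Suc n) = concat (map koch_refine_edge (koch_edges n))"

definition koch_polygon :: "nat \<Rightarrow> complex set" where
  "koch_polygon n = (\<Union>e\<in>set (koch_edges n). closed_segment (fst e) (snd e))"

definition hausdorff_dist :: "complex set \<Rightarrow> complex set \<Rightarrow> real" where
  "hausdorff_dist A B = max (SUP a\<in>A. infdist a B) (SUP b\<in>B. infdist b A)"

definition koch_curve :: "complex set" where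
  "koch_curve = (THE C. compact C \<and> C \<noteq> {} \<and>
                   (\<lambda>n. hausdorff_dist (koch_polygon n) C) \<longlonglongrightarrow> 0)"

definition koch_domain :: "complex set" where
  "koch_domain = (THE U. U \<in> components (- koch_curve) \<and> bounded U)"

definition koch_mu :: "complex set \<Rightarrow> real" where
  "koch_mu F = measure lebesgue (F \<inter> koch_domain) / measure lebesgue koch_domain"

definition discrepancy :: "complex set \<Rightarrow> complex set \<Rightarrow> real" where
  "discrepancy P R = real (card (P \<inter> R)) - real (card P) * koch_mu R"

definition koch_copy :: "complex \<Rightarrow> real \<Rightarrow> real \<Rightarrow> complex set" where
  "koch_copy x \<tau> \<theta> = (\<lambda>y. x + complex_of_real \<tau> * cis \<theta> * y) ` koch_domain"

text \<open>The squared \<open>L^2\<close> quantity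
  \<open>\<integral>_a^b \<integral>_{SO(2)} \<integral>_{\<real>^2} |D_N(x+\<tau>\<sigma>\<Omega>)|^2 dx d\<sigma> d\<tau>\<close>,
  Haar measure on SO(2) being \<open>d\<theta>/(2\<pi>)\<close> on \<open>[0,2\<pi>)\<close>.\<close>
definition koch_L2sq :: "complex set \<Rightarrow> real \<Rightarrow> real \<Rightarrow> ennreal" where
  "koch_L2sq P a b =
     (\<integral>\<^sup>+ \<tau>. indicator {a..b} \<tau> *
        (\<integral>\<^sup>+ \<theta>. indicator {0..<2*pi} \<theta> * ennreal (1 / (2*pi)) *
           (\<integral>\<^sup>+ x. ennreal ((discrepancy P (koch_copy x \<tau> \<theta>))\<^sup>2) \<partial>lborel) \<partial>lborel) \<partial>lborel)"

end

theory Submission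
  imports Defs "HOL-Probability.Probability"
begin

text \<open>Let \<open>\<Omega>\<close> be the Koch domain, \<open>d = log 3 4\<close> and \<open>\<nu> = \<Sum>\<^sub>p \<delta>\<^sub>p - N \<mu>\<close>.

  Geometry. The cap of an edge (the triangle with base angles \<open>\<pi>/6\<close> on its outer
  side) splits into the caps of the four new edges, the triangle added to the polygon, and two
  triangles that the curve leaves out. The latter are exactly the triangles added when the same
  subdivision rule is applied to the reversed outer sides of the caps, so the exterior of the curve
  is built like the interior, starting from a hexagon. Both sides are open and connected, and the
  added triangles are dense in them; disjointness of the triangles therefore separates the two
  sides. Level \<open>n\<close> has \<open>3 \<cdot> 4 ^ n\<close> caps of size \<open>3 ^
  -n\<close>, each containing comparable portions of the interior and of the exterior.

  Lower bound. As a function of the translation, the discrepancy is the convolution of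
  \<open>\<nu>\<close> with the indicator of a copy of \<open>\<Omega>\<close>, so its Fourier
  transform is a product. The heat content of \<open>\<Omega>\<close> at scale \<open>s\<close> is
  comparable to \<open>s ^ (2-d)\<close>; comparing Gaussians of different widths turns this into a
  lower bound for the squared transform of the indicator of \<open>\<Omega>\<close> integrated over
  an annulus, that is, averaged over rotations and dilations. This reduces the claim to a lower
  bound for the squared transform of \<open>\<nu>\<close> against a Gaussian of width of order
  \<open>sqrt N\<close>, where the \<open>N\<close> diagonal terms suffice. Only inequalities
  between a function and its Gaussian-damped transform are used, so Plancherel's theorem is not
  needed.

  Upper bound.  Choose one point in each grid square of area \<open>|\<Omega>|/N\<close> inside \<open>\<Omega>\<close> and the remaining
  \<open>O(N ^ (d/2))\<close> points in the rest of \<open>\<Omega>\<close>.  On average only the squares that meet the boundary of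
  the copy contribute to the variance, and there are \<open>O(N ^ (d/2))\<close> of them.\<close>

section \<open>Lebesgue measure and Gaussian integrals on the complex plane\<close>

text \<open>Origin of the exponent: let 9^n be of order N. The heat content yields mass of order
  (4/9)^k for the squared transform on an annulus of radius 3^k, whose area is of order 9^k; at such
  a frequency the average over rotations and dilations is therefore at least of order (4/81)^k. The
  squared transform of \<open>\<nu>\<close>, weighted by a Gaussian of width sqrt N, has mass at
  least of order N^2, that is 81^n. The product 4^n is of order N^(d/2), the same number that counts
  the cells of side N^(-1/2) met by the boundary of a copy.

  No bound is obtained for the transform of the domain at a single frequency; an estimate that holds
  at every frequency appears only after averaging, because rotating and dilating a frequency sweeps
  out an annulus. The boundary is handled without tangents or arc length: the analysis sees only
  areas of neighbourhoods of the curve and pairs of small triangles on its two sides.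

  \<open>koch_domain\<close> is defined as a bounded component of the complement of a limit curve.
  Building both sides explicitly as open connected sets identifies it without the Jordan curve
  theorem.\<close>

lemma measurable_Complex [measurable (raw)]:
  assumes "f \<in> borel_measurable M" "g \<in> borel_measurable M"
  shows "(\<lambda>x. Complex (f x) (g x)) \<in> borel_measurable M"
  unfolding Complex_eq using assms by measurable

lemma borel_measurable_cis [measurable (raw)]:
  assumes "f \<in> borel_measurable M"
  shows "(\<lambda>x. cis (f x)) \<in> borel_measurable M"
  unfolding cis.code using assms by measurable

text \<open>Both measures assign to a box the product of its side lengths, and boxes determine
  Lebesgue measure. This is the bridge from planar integrals to iterated real ones.\<close>

lemma lborel_complex_pair:
  "(lborel :: complex measure) = distr (lborel \<Otimes>\<^sub>M lborel) borel (\<lambda>(x, y). Complex x y)"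
proof (rule lborel_eqI)
  fix l u :: complex
  assume lu: "\<And>b. b \<in> Basis \<Longrightarrow> l \<bullet> b \<le> u \<bullet> b"
  have lu': "Re l \<le> Re u" "Im l \<le> Im u" using lu[of 1] lu[of \<i>] by (auto simp: Basis_complex_def)
  have vim: "(\<lambda>(x, y). Complex x y) -` box l u = box (Re l) (Re u) \<times> box (Im l) (Im u)"
    by (auto simp: box_def Basis_complex_def)
  show "emeasure (distr (lborel \<Otimes>\<^sub>M lborel) borel (\<lambda>(x, y). Complex x y)) (box l u) =
      ennreal (\<Prod>b\<in>Basis. (u - l) \<bullet> b)"
    apply (subst emeasure_distr)
      apply (auto simp: space_pair_measure vim lborel.emeasure_pair_measure_Times)
    using lu' by (simp add: Basis_complex_def ennreal_mult)
qed simp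

lemma nn_integral_complex:
  fixes f :: "complex \<Rightarrow> ennreal"
  assumes [measurable]: "f \<in> borel_measurable borel"
  shows "(\<integral>\<^sup>+z. f z \<partial>lborel) = (\<integral>\<^sup>+x. \<integral>\<^sup>+y. f (Complex x y) \<partial>lborel \<partial>lborel)"
  by (subst lborel_complex_pair)
    (simp add: nn_integral_distr case_prod_unfold lborel.nn_integral_fst[symmetric])

lemma nn_integral_complex_swap:
  fixes f :: "complex \<Rightarrow> ennreal"
  assumes [measurable]: "f \<in> borel_measurable borel"
  shows "(\<integral>\<^sup>+z. f z \<partial>lborel) = (\<integral>\<^sup>+y. \<integral>\<^sup>+x. f (Complex x y) \<partial>lborel \<partial>lborel)"
  by (subst nn_integral_complex, simp, rule lborel_pair.Fubini') simp

text \<open>Multiplication by c = p + i q has Jacobian p^2 + q^2, obtained from two real affine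
  substitutions. For p nonzero, u = p x - q y at fixed y contributes 1/|p| and turns the second
  coordinate into (q/p) u + ((p^2 + q^2)/p) y; a substitution in y at fixed u contributes (p^2 +
  q^2)/|p|. For p = 0 the coordinates are only exchanged and scaled.\<close>

lemma nn_integral_complex_mult:
  fixes f :: "complex \<Rightarrow> ennreal" and c :: complex
  assumes [measurable]: "f \<in> borel_measurable borel" and c: "c \<noteq> 0"
  shows "(\<integral>\<^sup>+z. f z \<partial>lborel) = ennreal ((cmod c)\<^sup>2) * (\<integral>\<^sup>+z. f (c * z) \<partial>lborel)"
proof -
  define p q where "p = Re c" and "q = Im c"
  have pq: "c * Complex x y = Complex (p * x - q * y) (q * x + p * y)" for x y
    by (simp add: p_def q_def complex_eq_iff)
  have n: "(cmod c)\<^sup>2 = p\<^sup>2 + q\<^sup>2" by (simp add: p_def q_def cmod_power2)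
  show ?thesis
  proof (cases "p = 0")
    case True
    with c have q: "q \<noteq> 0" by (auto simp: p_def q_def complex_eq_iff)
    have "(\<integral>\<^sup>+z. f z \<partial>lborel) = (\<integral>\<^sup>+x. \<integral>\<^sup>+y. f (Complex x y) \<partial>lborel \<partial>lborel)"
      by (rule nn_integral_complex) simp
    also have "\<dots> = ennreal \<bar>-q\<bar> * (\<integral>\<^sup>+x. \<integral>\<^sup>+y. f (Complex (0 + (-q) * x) y) \<partial>lborel \<partial>lborel)"
      by (subst nn_integral_real_affine[where c="-q" and t=0]) (use q in auto)
    also have "(\<lambda>x. \<integral>\<^sup>+y. f (Complex (0 + (-q) * x) y) \<partial>lborel)
      = (\<lambda>x. ennreal \<bar>q\<bar> * (\<integral>\<^sup>+y. f (Complex (- q * x) (q * y)) \<partial>lborel))"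
      by (rule ext, subst nn_integral_real_affine[where c="q" and t=0]) (use q in auto)
    also have "(\<integral>\<^sup>+x. ennreal \<bar>q\<bar> * (\<integral>\<^sup>+y. f (Complex (- q * x) (q * y)) \<partial>lborel) \<partial>lborel)
      = ennreal \<bar>q\<bar> * (\<integral>\<^sup>+z. f (c * z) \<partial>lborel)"
      by (subst nn_integral_cmult) (auto simp: nn_integral_complex_swap[of "\<lambda>z. f (c * z)"] pq True)
    finally show ?thesis
      using n True by (simp add: mult.assoc[symmetric] ennreal_mult[symmetric] power2_eq_square)
  next
    case False
    have s0: "p\<^sup>2 + q\<^sup>2 \<noteq> 0" using False by (simp add: sum_power2_eq_zero_iff)
    have "(\<integral>\<^sup>+z. f (c * z) \<partial>lborel)
       = (\<integral>\<^sup>+y. \<integral>\<^sup>+x. f (Complex (p * x - q * y) (q * x + p * y)) \<partial>lborel \<partial>lborel)"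
      by (subst nn_integral_complex_swap) (auto simp: pq)
    also have "\<dots> = (\<integral>\<^sup>+y. ennreal \<bar>1/p\<bar> * (\<integral>\<^sup>+u. f (Complex u ((q/p) * u + (p\<^sup>2+q\<^sup>2)/p * y)) \<partial>lborel) \<partial>lborel)"
    proof (rule nn_integral_cong)
      fix y
      have "(\<integral>\<^sup>+x. f (Complex (p * x - q * y) (q * x + p * y)) \<partial>lborel) =
        ennreal \<bar>1/p\<bar> * (\<integral>\<^sup>+u. f (Complex (p * (q*y/p + 1/p * u) - q * y) (q * (q*y/p + 1/p * u) + p * y)) \<partial>lborel)"
        by (rule nn_integral_real_affine) (use False in auto)
      also have "(\<lambda>u. f (Complex (p * (q*y/p + 1/p * u) - q * y) (q * (q*y/p + 1/p * u) + p * y)))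
         = (\<lambda>u. f (Complex u ((q/p) * u + (p\<^sup>2+q\<^sup>2)/p * y)))"
        using False by (intro ext arg_cong[where f=f]) (simp add: field_simps power2_eq_square)
      finally show "(\<integral>\<^sup>+x. f (Complex (p * x - q * y) (q * x + p * y)) \<partial>lborel) = ennreal \<bar>1/p\<bar> *
         (\<integral>\<^sup>+u. f (Complex u ((q/p) * u + (p\<^sup>2+q\<^sup>2)/p * y)) \<partial>lborel)" .
    qed
    also have "\<dots> = ennreal \<bar>1/p\<bar> * (\<integral>\<^sup>+y. \<integral>\<^sup>+u. f (Complex u ((q/p) * u + (p\<^sup>2+q\<^sup>2)/p * y)) \<partial>lborel \<partial>lborel)"
      by (rule nn_integral_cmult) simp
    also have "(\<integral>\<^sup>+y. \<integral>\<^sup>+u. f (Complex u ((q/p) * u + (p\<^sup>2+q\<^sup>2)/p * y)) \<partial>lborel \<partial>lborel)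
        = (\<integral>\<^sup>+u. \<integral>\<^sup>+y. f (Complex u ((q/p) * u + (p\<^sup>2+q\<^sup>2)/p * y)) \<partial>lborel \<partial>lborel)"
      by (rule lborel_pair.Fubini') simp
    finally have 1: "(\<integral>\<^sup>+z. f (c * z) \<partial>lborel)
       = ennreal \<bar>1/p\<bar> * (\<integral>\<^sup>+u. \<integral>\<^sup>+y. f (Complex u ((q/p) * u + (p\<^sup>2+q\<^sup>2)/p * y)) \<partial>lborel \<partial>lborel)" .
    have "(\<integral>\<^sup>+z. f z \<partial>lborel) = (\<integral>\<^sup>+x. \<integral>\<^sup>+y. f (Complex x y) \<partial>lborel \<partial>lborel)"
      by (rule nn_integral_complex) simp
    also have "\<dots> = (\<integral>\<^sup>+x. ennreal \<bar>(p\<^sup>2+q\<^sup>2)/p\<bar> *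
        (\<integral>\<^sup>+y. f (Complex x ((q/p) * x + (p\<^sup>2+q\<^sup>2)/p * y)) \<partial>lborel) \<partial>lborel)"
      by (intro nn_integral_cong nn_integral_real_affine) (use False s0 in auto)
    also have "\<dots> = ennreal \<bar>(p\<^sup>2+q\<^sup>2)/p\<bar> *
        (\<integral>\<^sup>+x. \<integral>\<^sup>+y. f (Complex x ((q/p) * x + (p\<^sup>2+q\<^sup>2)/p * y)) \<partial>lborel \<partial>lborel)"
      by (rule nn_integral_cmult) simp
    finally show ?thesis
      unfolding 1 n
      by (simp add: mult.assoc[symmetric] ennreal_mult[symmetric] abs_mult abs_divide del: ennreal_plus)
  qed
qed

lemma nn_integral_lborel_translate:
  fixes f :: "'a::euclidean_space \<Rightarrow> ennreal"
  assumes [measurable]: "f \<in> borel_measurable borel"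
  shows "(\<integral>\<^sup>+z. f (c + z) \<partial>lborel) = (\<integral>\<^sup>+z. f z \<partial>lborel)"
proof -
  have "(\<integral>\<^sup>+z. f z \<partial>lborel) = (\<integral>\<^sup>+z. f z \<partial>distr lborel borel ((+) c))"
    by (subst lborel_distr_plus) simp
  also have "\<dots> = (\<integral>\<^sup>+z. f (c + z) \<partial>lborel)" by (rule nn_integral_distr) auto
  finally show ?thesis by simp
qed

text \<open>Substitute y = x tan theta at fixed x, exchange the integrals, then put x = rho cos
  theta at fixed theta: the Jacobians x / cos^2 and cos multiply to rho. On the half-angle pi/4 the
  cosine stays positive and the end points have tangents -1 and 1.\<close>

lemma nn_integral_polar_sector:
  fixes f :: "complex \<Rightarrow> ennreal"
  assumes [measurable]: "f \<in> borel_measurable borel"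
  shows "(\<integral>\<^sup>+z. f z * indicator {z. 0 < Re z \<and> \<bar>Im z\<bar> \<le> Re z} z \<partial>lborel) =
    (\<integral>\<^sup>+\<theta>. indicator {-pi/4..pi/4} \<theta> * (\<integral>\<^sup>+\<rho>. indicator {0<..} \<rho> * ennreal \<rho> * f (of_real \<rho> * cis \<theta>) \<partial>lborel) \<partial>lborel)"
proof -
  have tan4: "tan (-pi/4) = -1" "tan (pi/4) = 1" by (simp_all add: tan_45)
  have cospos: "cos \<theta> > 0" if "\<theta> \<in> {-pi/4..pi/4}" for \<theta>
  proof (rule cos_gt_zero_pi)
    show "- (pi / 2) < \<theta>" "\<theta> < pi / 2" using that pi_gt_zero unfolding atLeastAtMost_iff by linarith+
  qed
  have [measurable]: "(\<lambda>x. f (Complex (fst x) (snd x))) \<in> borel_measurable (borel \<Otimes>\<^sub>M borel)" by measurable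
  have "(\<integral>\<^sup>+z. f z * indicator {z. 0 < Re z \<and> \<bar>Im z\<bar> \<le> Re z} z \<partial>lborel) =
     (\<integral>\<^sup>+x. \<integral>\<^sup>+y. f (Complex x y) * indicator {z. 0 < Re z \<and> \<bar>Im z\<bar> \<le> Re z} (Complex x y) \<partial>lborel \<partial>lborel)"
    by (rule nn_integral_complex) measurable
  also have "\<dots> = (\<integral>\<^sup>+x. \<integral>\<^sup>+\<theta>. indicator {0<..} x * (indicator {-pi/4..pi/4} \<theta> * (ennreal (x / (cos \<theta>)\<^sup>2) * f (Complex x (x * tan \<theta>)))) \<partial>lborel \<partial>lborel)"
  proof (rule nn_integral_cong)
    fix x :: real
    show "(\<integral>\<^sup>+y. f (Complex x y) * indicator {z. 0 < Re z \<and> \<bar>Im z\<bar> \<le> Re z} (Complex x y) \<partial>lborel) =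
      (\<integral>\<^sup>+\<theta>. indicator {0<..} x * (indicator {-pi/4..pi/4} \<theta> * (ennreal (x / (cos \<theta>)\<^sup>2) * f (Complex x (x * tan \<theta>)))) \<partial>lborel)"
    proof (cases "0 < x")
      case True
      have "(\<integral>\<^sup>+y. f (Complex x y) * indicator {z. 0 < Re z \<and> \<bar>Im z\<bar> \<le> Re z} (Complex x y) \<partial>lborel)
        = (\<integral>\<^sup>+y. f (Complex x y) * indicator {x * tan (-pi/4)..x * tan (pi/4)} y \<partial>lborel)"
        using True unfolding tan4 by (intro nn_integral_cong) (auto simp: indicator_def abs_le_iff)
      also have "\<dots> = (\<integral>\<^sup>+\<theta>. f (Complex x (x * tan \<theta>)) * ennreal (x / (cos \<theta>)\<^sup>2) * indicator {-pi/4..pi/4} \<theta> \<partial>lborel)"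
      proof (rule nn_integral_substitution_aux[where f="\<lambda>y. f (Complex x y)" and g="\<lambda>\<theta>. x * tan \<theta>" and g'="\<lambda>\<theta>. x / (cos \<theta>)\<^sup>2"])
        fix \<theta> :: real assume "\<theta> \<in> {-pi/4..pi/4}"
        from cospos[OF this] show "((\<lambda>\<theta>. x * tan \<theta>) has_real_derivative x / (cos \<theta>)\<^sup>2) (at \<theta>)"
          by (auto intro!: derivative_eq_intros simp: field_simps)
      next
        show "continuous_on {-pi/4..pi/4} (\<lambda>\<theta>. x / (cos \<theta>)\<^sup>2)"
          using cospos by (intro continuous_intros) force
      qed (use True pi_gt_zero in auto)
      finally show ?thesis using True by (simp add: mult_ac)
    qed (auto simp: indicator_def)
  qed
  also have "\<dots> = (\<integral>\<^sup>+\<theta>. \<integral>\<^sup>+x. indicator {0<..} x * (indicator {-pi/4..pi/4} \<theta> * (ennreal (x / (cos \<theta>)\<^sup>2) * f (Complex x (x * tan \<theta>)))) \<partial>lborel \<partial>lborel)"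
    by (rule lborel_pair.Fubini') (unfold tan_def, measurable)
  also have "\<dots> = (\<integral>\<^sup>+\<theta>. indicator {-pi/4..pi/4} \<theta> * (\<integral>\<^sup>+\<rho>. indicator {0<..} \<rho> * ennreal \<rho> * f (of_real \<rho> * cis \<theta>) \<partial>lborel) \<partial>lborel)"
  proof (rule nn_integral_cong)
    fix \<theta> :: real
    show "(\<integral>\<^sup>+x. indicator {0<..} x * (indicator {-pi/4..pi/4} \<theta> * (ennreal (x / (cos \<theta>)\<^sup>2) * f (Complex x (x * tan \<theta>)))) \<partial>lborel)
      = indicator {-pi/4..pi/4} \<theta> * (\<integral>\<^sup>+\<rho>. indicator {0<..} \<rho> * ennreal \<rho> * f (of_real \<rho> * cis \<theta>) \<partial>lborel)"
    proof (cases "\<theta> \<in> {-pi/4..pi/4}")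
      case True
      note cp = cospos[OF this]
      have "(\<integral>\<^sup>+x. indicator {0<..} x * (indicator {-pi/4..pi/4} \<theta> * (ennreal (x / (cos \<theta>)\<^sup>2) * f (Complex x (x * tan \<theta>)))) \<partial>lborel)
        = (\<integral>\<^sup>+x. indicator {0<..} x * (ennreal (x / (cos \<theta>)\<^sup>2) * f (Complex x (x * tan \<theta>))) \<partial>lborel)"
        using True by simp
      also have "\<dots> = ennreal \<bar>cos \<theta>\<bar> * (\<integral>\<^sup>+\<rho>. indicator {0<..} (0 + cos \<theta> * \<rho>) * (ennreal ((0 + cos \<theta> * \<rho>) / (cos \<theta>)\<^sup>2) * f (Complex (0 + cos \<theta> * \<rho>) ((0 + cos \<theta> * \<rho>) * tan \<theta>))) \<partial>lborel)"
        by (rule nn_integral_real_affine) (use cp in auto)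
      also have "\<dots> = (\<integral>\<^sup>+\<rho>. ennreal \<bar>cos \<theta>\<bar> * (indicator {0<..} (0 + cos \<theta> * \<rho>) * (ennreal ((0 + cos \<theta> * \<rho>) / (cos \<theta>)\<^sup>2) * f (Complex (0 + cos \<theta> * \<rho>) ((0 + cos \<theta> * \<rho>) * tan \<theta>)))) \<partial>lborel)"
        by (rule nn_integral_cmult[symmetric]) measurable
      also have "\<dots> = (\<integral>\<^sup>+\<rho>. indicator {0<..} \<rho> * ennreal \<rho> * f (of_real \<rho> * cis \<theta>) \<partial>lborel)"
      proof (rule nn_integral_cong)
        fix \<rho> :: real
        have "Complex (0 + cos \<theta> * \<rho>) ((0 + cos \<theta> * \<rho>) * tan \<theta>) = of_real \<rho> * cis \<theta>"
          using cp by (simp add: complex_eq_iff tan_def)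
        moreover have "ennreal \<bar>cos \<theta>\<bar> * ennreal (cos \<theta> * \<rho> / (cos \<theta>)\<^sup>2) = ennreal \<rho>" if "\<rho> > 0"
          using cp that by (subst ennreal_mult[symmetric]) (auto simp: power2_eq_square)
        ultimately show "ennreal \<bar>cos \<theta>\<bar> * (indicator {0<..} (0 + cos \<theta> * \<rho>) * (ennreal ((0 + cos \<theta> * \<rho>) / (cos \<theta>)\<^sup>2) * f (Complex (0 + cos \<theta> * \<rho>) ((0 + cos \<theta> * \<rho>) * tan \<theta>)))) = indicator {0<..} \<rho> * ennreal \<rho> * f (of_real \<rho> * cis \<theta>)"
          using cp by (auto simp: indicator_def zero_less_mult_iff mult.assoc[symmetric])
      qed
      finally show ?thesis using True by simp
    qed (auto simp: indicator_def)
  qed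
  finally show ?thesis .
qed

text \<open>Four rotated sectors cover the plane up to 0. Each is bounded by the whole right-hand
  side, which costs the factor 4 but avoids adding up angular intervals; only orders of magnitude
  matter later.\<close>

lemma nn_integral_polar_le:
  fixes f :: "complex \<Rightarrow> ennreal"
  assumes [measurable]: "f \<in> borel_measurable borel"
  shows "(\<integral>\<^sup>+z. f z \<partial>lborel) \<le>
    4 * (\<integral>\<^sup>+\<theta>. indicator {0..<2*pi} \<theta> * (\<integral>\<^sup>+\<rho>. indicator {0<..} \<rho> * ennreal \<rho> * f (of_real \<rho> * cis \<theta>) \<partial>lborel) \<partial>lborel)"
    (is "_ \<le> 4 * ?R")
proof -
  define S where "S = {z. 0 < Re z \<and> \<bar>Im z\<bar> \<le> Re z}"
  define I where "I \<theta> = (\<integral>\<^sup>+\<rho>. indicator {0<..} \<rho> * ennreal \<rho> * f (of_real \<rho> * cis \<theta>) \<partial>lborel)" for \<theta>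
  have [measurable]: "S \<in> sets borel" unfolding S_def by measurable
  have [measurable]: "I \<in> borel_measurable borel" unfolding I_def by measurable
  have sector: "(\<integral>\<^sup>+z. f z * indicator S (cis (- c) * z) \<partial>lborel) \<le> ?R"
    if c: "c - pi/4 \<ge> 0" "c + pi/4 \<le> 2*pi" for c
  proof -
    have e: "cis (- c) * (cis c * z) = z" for z by (simp add: mult.assoc[symmetric] cis_mult)
    have "(\<integral>\<^sup>+z. f z * indicator S (cis (- c) * z) \<partial>lborel) = (\<integral>\<^sup>+z. f (cis c * z) * indicator S z \<partial>lborel)"
      by (subst nn_integral_complex_mult[where c="cis c"]) (auto simp: e)
    also have "\<dots> = (\<integral>\<^sup>+\<theta>. indicator {-pi/4..pi/4} \<theta> * I (c + 1 * \<theta>) \<partial>lborel)"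
      unfolding S_def by (subst nn_integral_polar_sector) (auto simp: I_def mult_ac cis_mult[symmetric])
    also have "\<dots> = (\<integral>\<^sup>+\<theta>. indicator {c-pi/4..c+pi/4} \<theta> * I \<theta> \<partial>lborel)"
      by (subst (2) nn_integral_real_affine[where c=1 and t=c])
        (auto intro!: nn_integral_cong simp: indicator_def)
    also have "\<dots> \<le> (\<integral>\<^sup>+\<theta>. indicator {0..2*pi} \<theta> * I \<theta> \<partial>lborel)"
      by (intro nn_integral_mono) (use c in \<open>auto simp: indicator_def\<close>)
    also have "\<dots> = ?R"
      unfolding I_def[symmetric]
      using AE_lborel_singleton[of "2*pi"]
      by (intro nn_integral_cong_AE) (auto simp: indicator_def)
    finally show ?thesis .
  qed
  \<comment> \<open>The sectors are centred at pi/4 + k pi/2, so that their angular intervals lie in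
    [0, 2 pi] and none wraps around.\<close>
  have cases: "z = 0 \<or> (\<exists>k\<in>{..<4::nat}. cis (- (pi/4 + real k * (pi/2))) * z \<in> S)" for z
  proof (cases "z = 0")
    case False
    define w where "w = cis (-(pi/4)) * z"
    have w0: "w \<noteq> 0" using False by (simp add: w_def cis_neq_zero)
    have cw: "cis (- (pi/4 + t)) * z = cis (-t) * w" for t
      by (simp add: w_def cis_mult mult.assoc[symmetric] add.commute)
    have c: "cis (- (real 0 * (pi/2))) = 1" "cis (- (real 1 * (pi/2))) = - \<i>"
       "cis (- (real 2 * (pi/2))) = -1" "cis (- (real 3 * (pi/2))) = \<i>"
      using cos_3over2_pi sin_3over2_pi by (auto simp: complex_eq_iff)
    have "w \<in> S \<or> - \<i> * w \<in> S \<or> -w \<in> S \<or> \<i> * w \<in> S"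
      using w0 unfolding S_def mem_Collect_eq by (auto simp: complex_eq_iff) 
    then have "cis (- (pi/4 + real 0 * (pi/2))) * z \<in> S \<or> cis (- (pi/4 + real 1 * (pi/2))) * z \<in> S
      \<or> cis (- (pi/4 + real 2 * (pi/2))) * z \<in> S \<or> cis (- (pi/4 + real 3 * (pi/2))) * z \<in> S"
      unfolding cw c by simp
    moreover have "k \<in> {..<4::nat}" if "k = 0 \<or> k = 1 \<or> k = 2 \<or> k = 3" for k using that by auto
    ultimately have "\<exists>k\<in>{..<4::nat}. cis (- (pi/4 + real k * (pi/2))) * z \<in> S" by blast
    then show ?thesis ..
  qed simp
  have "(\<integral>\<^sup>+z. f z \<partial>lborel) \<le> (\<integral>\<^sup>+z. (\<Sum>k<4::nat. f z * indicator S (cis (- (pi/4 + real k * (pi/2))) * z)) \<partial>lborel)"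
  proof (rule nn_integral_mono_AE, use AE_lborel_singleton[of "0::complex"] in eventually_elim)
    case (elim z)
    with cases[of z] obtain k where k: "k < 4" "cis (- (pi/4 + real k * (pi/2))) * z \<in> S" by auto
    have "f z = f z * indicator S (cis (- (pi/4 + real k * (pi/2))) * z)" using k by simp
    also have "\<dots> \<le> (\<Sum>k<4::nat. f z * indicator S (cis (- (pi/4 + real k * (pi/2))) * z))"
      by (rule member_le_sum) (use k in auto)
    finally show ?case .
  qed
  also have "\<dots> = (\<Sum>k<4::nat. (\<integral>\<^sup>+z. f z * indicator S (cis (- (pi/4 + real k * (pi/2))) * z) \<partial>lborel))"
    by (rule nn_integral_sum) auto
  also have "\<dots> \<le> (\<Sum>k<4::nat. ?R)"
  proof (rule sum_mono, rule sector)
    fix k :: nat assume k: "k \<in> {..<4}"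
    show "0 \<le> pi/4 + real k * (pi/2) - pi/4" by simp
    have "real k * (pi/2) \<le> 3 * (pi/2)" using k by (intro mult_right_mono) auto
    then show "pi/4 + real k * (pi/2) + pi/4 \<le> 2 * pi" by linarith
  qed
  finally show ?thesis by simp
qed

text \<open>For \<open>s = 1\<close> this is the characteristic function of the standard normal
  distribution with its normalising factor removed; the general case is the substitution of
  \<open>s * t\<close> for \<open>t\<close> at frequency \<open>x / s\<close>.\<close>

lemma gaussian_FT_real:
  fixes x s :: real
  assumes s: "s > 0"
  shows "integrable lborel (\<lambda>t::real. cis (x * t) * of_real (exp (-(s\<^sup>2 * t\<^sup>2 / 2))))"
    and "(LINT t|lborel. cis (x * t) * of_real (exp (-(s\<^sup>2 * t\<^sup>2 / 2))))
          = of_real (sqrt (2*pi) / s * exp (-(x\<^sup>2 / (2 * s\<^sup>2))))"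
proof -
  have std: "(\<lambda>t. sqrt (2*pi) * std_normal_density t) = (\<lambda>t. exp (-(t\<^sup>2/2)))"
    by (rule ext) (simp add: std_normal_density_def)
  have base_i: "integrable lborel (\<lambda>t::real. exp (-(t\<^sup>2/2)))"
    unfolding std[symmetric] by (intro integrable_mult_right integrable_normal_density) simp
  have i1: "integrable lborel (\<lambda>t::real. cis (u * t) * of_real (exp (-(t\<^sup>2/2))))" for u :: real
    by (rule Bochner_Integration.integrable_bound[OF base_i]) (auto simp: norm_mult)
  have v1: "(LINT t|lborel. cis (u * t) * of_real (exp (-(t\<^sup>2/2)))) = of_real (sqrt (2*pi) * exp (-(u\<^sup>2/2)))" for u :: real
  proof -
    have "char std_normal_distribution u = (LINT t|lborel. std_normal_density t *\<^sub>R cis (u * t))"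
      unfolding char_def by (subst integral_density) (auto simp: cis_conv_exp)
    then have "complex_of_real (exp (-(u\<^sup>2/2))) = (LINT t|lborel. std_normal_density t *\<^sub>R cis (u * t))"
      using char_std_normal_distribution by (simp add: fun_eq_iff)
    then have "complex_of_real (sqrt (2*pi)) * complex_of_real (exp (-(u\<^sup>2/2))) = (LINT t|lborel. complex_of_real (sqrt (2*pi)) * (std_normal_density t *\<^sub>R cis (u * t)))"
      by (simp only: integral_mult_right_zero)
    also have "(\<lambda>t. complex_of_real (sqrt (2*pi)) * (std_normal_density t *\<^sub>R cis (u * t))) = (\<lambda>t. cis (u * t) * of_real (exp (-(t\<^sup>2/2))))"
      unfolding fun_cong[OF std, symmetric] by (rule ext) (simp add: scaleR_conv_of_real)
    finally show ?thesis by simp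
  qed
  have eq: "cis (x / s * (0 + s * t)) * complex_of_real (exp (-((0 + s * t)\<^sup>2/2))) = cis (x * t) * of_real (exp (-(s\<^sup>2 * t\<^sup>2 / 2)))" for t
    using s by (simp add: power_mult_distrib)
  show "integrable lborel (\<lambda>t::real. cis (x * t) * of_real (exp (-(s\<^sup>2 * t\<^sup>2 / 2))))"
    using lborel_integrable_real_affine[OF i1[of "x/s"], of s 0] s unfolding eq by simp
  have "complex_of_real (sqrt (2*pi) * exp (-((x/s)\<^sup>2/2))) = \<bar>s\<bar> *\<^sub>R (LINT t|lborel. cis (x * t) * of_real (exp (-(s\<^sup>2 * t\<^sup>2 / 2))))"
    unfolding v1[symmetric] eq[symmetric]
    by (rule lborel_integral_real_affine) (use s in auto)
  then have "complex_of_real (sqrt (2*pi) * exp (-((x/s)\<^sup>2/2))) / of_real s = (LINT t|lborel. cis (x * t) * of_real (exp (-(s\<^sup>2 * t\<^sup>2 / 2))))"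
    using s by (simp add: scaleR_conv_of_real field_simps)
  then show "(LINT t|lborel. cis (x * t) * of_real (exp (-(s\<^sup>2 * t\<^sup>2 / 2))))
          = of_real (sqrt (2*pi) / s * exp (-(x\<^sup>2 / (2 * s\<^sup>2))))"
    using s by (simp add: power_divide mult.commute)
qed

text \<open>The integrand is a function of the real part times a function of the imaginary part, so
  Fubini gives the product of two one-dimensional transforms.\<close>

lemma gaussian_FT_complex:
  fixes x :: complex and s :: real
  assumes s: "s > 0"
  shows "integrable lborel (\<lambda>y::complex. cis (x \<bullet> y) * of_real (exp (-(s\<^sup>2 * (cmod y)\<^sup>2 / 2))))" (is "integrable _ ?f")
    and "(LINT y|lborel. cis (x \<bullet> y) * of_real (exp (-(s\<^sup>2 * (cmod y)\<^sup>2 / 2))))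
          = of_real (2*pi / s\<^sup>2 * exp (-((cmod x)\<^sup>2 / (2 * s\<^sup>2))))" (is "?L = ?R")
proof -
  let ?g = "\<lambda>x t::real. cis (x * t) * complex_of_real (exp (-(s\<^sup>2 * t\<^sup>2 / 2)))"
  have prod: "?f (Complex a b) = ?g (Re x) a * ?g (Im x) b" for a b
    by (simp add: inner_complex_def cmod_power2 cis_mult[symmetric] exp_add[symmetric] of_real_mult[symmetric] del: of_real_mult)
       (simp add: field_simps exp_minus exp_add of_real_mult cis_mult[symmetric])
  have m[measurable]: "?f \<in> borel_measurable borel" by measurable
  have gi: "integrable lborel (?g u)" for u using gaussian_FT_real(1)[OF s] .
  have pi: "integrable (lborel \<Otimes>\<^sub>M lborel) (\<lambda>(a, b). ?g (Re x) a * ?g (Im x) b)"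
  proof (rule lborel_pair.Fubini_integrable)
    show "integrable lborel (\<lambda>a. LINT b|lborel. norm (case (a, b) of (a, b) \<Rightarrow> ?g (Re x) a * ?g (Im x) b))"
      unfolding prod.case norm_mult[of "?g _ _"] by (intro integrable_norm[OF gi] integrable_mult_left integral_mult_right_zero | simp only: integral_mult_right_zero)+
    show "AE a in lborel. integrable lborel (\<lambda>b. case (a, b) of (a, b) \<Rightarrow> ?g (Re x) a * ?g (Im x) b)"
      unfolding prod.case by (intro AE_I2 integrable_mult_right gi)
  qed measurable
  have pf: "integrable (lborel \<Otimes>\<^sub>M lborel) (\<lambda>p. ?f ((\<lambda>(a, b). Complex a b) p))"
    using pi by (simp add: case_prod_unfold prod)
  show "integrable lborel ?f"
    by (subst lborel_complex_pair, subst integrable_distr_eq) (use pf in \<open>auto simp: case_prod_unfold\<close>)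
  have "?L = (\<integral>p. ?f ((\<lambda>(a, b). Complex a b) p) \<partial>(lborel \<Otimes>\<^sub>M lborel))"
    by (subst lborel_complex_pair, subst integral_distr) (auto simp: case_prod_unfold)
  also have "\<dots> = (LINT a|lborel. LINT b|lborel. ?g (Re x) a * ?g (Im x) b)"
    by (subst lborel_pair.integral_fst'[symmetric, OF pf]) (simp add: prod)
  also have "\<dots> = (LINT a|lborel. ?g (Re x) a) * (LINT b|lborel. ?g (Im x) b)"
    by simp
  also have "\<dots> = ?R"
  proof -
    have "sqrt (2*pi) / s * exp (-((Re x)\<^sup>2 / (2 * s\<^sup>2))) * (sqrt (2*pi) / s * exp (-((Im x)\<^sup>2 / (2 * s\<^sup>2))))
      = (sqrt (2*pi))\<^sup>2 / s\<^sup>2 * (exp (-((Re x)\<^sup>2 / (2 * s\<^sup>2))) * exp (-((Im x)\<^sup>2 / (2 * s\<^sup>2))))"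
      by (simp add: power2_eq_square)
    also have "\<dots> = 2*pi / s\<^sup>2 * exp (-((cmod x)\<^sup>2 / (2 * s\<^sup>2)))"
      unfolding exp_add[symmetric] by (simp add: cmod_power2 add_divide_distrib)
    finally show ?thesis
      unfolding gaussian_FT_real(2)[OF s] of_real_mult[symmetric] by simp
  qed
  finally show "?L = ?R" .
qed

section \<open>Edges, caps and their subdivision\<close>

text \<open>Coordinates relative to an edge, which runs from \<open>(0,0)\<close> to \<open>(1,0)\<close>.  The factor \<open>sqrt 3\<close> makes
  every change of coordinates in the construction rational, so that inclusions between triangles
  become linear arithmetic.\<close>
definition edge_x :: "complex \<times> complex \<Rightarrow> complex \<Rightarrow> real" where
  "edge_x e z = Re ((z - fst e) / (snd e - fst e))"

definition edge_h :: "complex \<times> complex \<Rightarrow> complex \<Rightarrow> real" where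
  "edge_h e z = sqrt 3 * Im ((z - fst e) / (snd e - fst e))"

text \<open>The hypotheses describe the similarity from \<open>e\<close> to \<open>e'\<close>:
  \<open>(x0, h0)\<close> are the coordinates of the new starting point, and
  \<open>Complex a (b * sqrt 3)\<close> is the quotient of the old edge vector by the new one. With
  rational data the change of coordinates is rational.\<close>

lemma edge_coords_change:
  assumes e: "snd e \<noteq> fst e"
    and p: "fst e' = fst e + (snd e - fst e) * Complex x0 (h0 / sqrt 3)"
    and k: "(snd e' - fst e') * Complex a (b * sqrt 3) = snd e - fst e"
  shows "snd e' \<noteq> fst e'"
    and "edge_x e' z = a * (edge_x e z - x0) - b * (edge_h e z - h0)"
    and "edge_h e' z = 3 * b * (edge_x e z - x0) + a * (edge_h e z - h0)"
proof -
  define D where "D = snd e - fst e"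
  define w where "w = (z - fst e) / D"
  have D: "D \<noteq> 0" using e by (simp add: D_def)
  show nz: "snd e' \<noteq> fst e'" using k e by auto
  have z: "z = fst e + D * w" using D by (simp add: w_def)
  have div: "(z - fst e') / (snd e' - fst e') = (w - Complex x0 (h0 / sqrt 3)) * Complex a (b * sqrt 3)"
  proof -
    have "(z - fst e') = (snd e' - fst e') * ((w - Complex x0 (h0 / sqrt 3)) * Complex a (b * sqrt 3))"
    proof -
      have "z - fst e' = D * (w - Complex x0 (h0 / sqrt 3))"
        unfolding z p D_def[symmetric] by (simp add: algebra_simps)
      also have "D = (snd e' - fst e') * Complex a (b * sqrt 3)" using k by (simp add: D_def)
      finally show ?thesis by (simp add: mult_ac)
    qed
    then show ?thesis using nz by (simp add: field_simps)
  qed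
  show "edge_x e' z = a * (edge_x e z - x0) - b * (edge_h e z - h0)"
    and "edge_h e' z = 3 * b * (edge_x e z - x0) + a * (edge_h e z - h0)"
    unfolding edge_x_def edge_h_def div w_def[symmetric] D_def[symmetric]
    by (simp_all add: field_simps)
qed

definition koch_sub1 :: "complex \<times> complex \<Rightarrow> complex \<times> complex" where
  "koch_sub1 e = (fst e, fst e + (snd e - fst e) / 3)"
definition koch_sub2 :: "complex \<times> complex \<Rightarrow> complex \<times> complex" where
  "koch_sub2 e = (fst e + (snd e - fst e) / 3, fst e + (snd e - fst e) / 3 + (snd e - fst e) / 3 * cis (- pi/3))"
definition koch_sub3 :: "complex \<times> complex \<Rightarrow> complex \<times> complex" where
  "koch_sub3 e = (fst e + (snd e - fst e) / 3 + (snd e - fst e) / 3 * cis (- pi/3), fst e + 2 * ((snd e - fst e) / 3))"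
definition koch_sub4 :: "complex \<times> complex \<Rightarrow> complex \<times> complex" where
  "koch_sub4 e = (fst e + 2 * ((snd e - fst e) / 3), snd e)"
definition koch_subs :: "complex \<times> complex \<Rightarrow> (complex \<times> complex) set" where
  "koch_subs e = {koch_sub1 e, koch_sub2 e, koch_sub3 e, koch_sub4 e}"

text \<open>The two sides of the cap of an edge, reversed so that the cap lies on their right: the
  triangles erected on them are the parts of the cap left out by the curve.\<close>
definition cap_side1 :: "complex \<times> complex \<Rightarrow> complex \<times> complex" where
  "cap_side1 e = (snd (koch_sub2 e), fst e)"
definition cap_side2 :: "complex \<times> complex \<Rightarrow> complex \<times> complex" where
  "cap_side2 e = (snd e, snd (koch_sub2 e))"

lemma set_koch_refine_edge: "set (koch_refine_edge e) = koch_subs e"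
  by (simp add: koch_refine_edge_def koch_subs_def koch_sub1_def koch_sub2_def koch_sub3_def
      koch_sub4_def Let_def)

lemma cis_minus_pi3: "cis (- pi/3) = Complex (1/2) (- sqrt 3 / 2)"
  and cis_pi3: "cis (pi/3) = Complex (1/2) (sqrt 3 / 2)"
  by (simp_all add: complex_eq_iff cos_60 sin_60)

lemma sqrt3_div: "1 / sqrt 3 = sqrt 3 / 3" "x / sqrt 3 = x * sqrt 3 / 3"
  by (simp_all add: field_simps)

text \<open>The facts \<open>1\<close> to \<open>6\<close> record the starting point and the
  quotient for each derived edge: 3 for the two outer thirds, 3 cis(pi/3) and 3 cis(-pi/3) for the
  new sides, and a number of modulus sqrt 3 for the cap sides. All later statements about one
  subdivision rest on these formulas.\<close>

lemma edge_coords_sub: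
  assumes e: "snd e \<noteq> fst e"
  shows "edge_x (koch_sub1 e) z = 3 * edge_x e z"
    and "edge_h (koch_sub1 e) z = 3 * edge_h e z"
    and "edge_x (koch_sub2 e) z = 3/2 * edge_x e z - 3/2 * edge_h e z - 1/2"
    and "edge_h (koch_sub2 e) z = 9/2 * edge_x e z + 3/2 * edge_h e z - 3/2"
    and "edge_x (koch_sub3 e) z = 3/2 * edge_x e z + 3/2 * edge_h e z"
    and "edge_h (koch_sub3 e) z = 3 - 9/2 * edge_x e z + 3/2 * edge_h e z"
    and "edge_x (koch_sub4 e) z = 3 * edge_x e z - 2"
    and "edge_h (koch_sub4 e) z = 3 * edge_h e z"
    and "edge_x (cap_side1 e) z = 1 - 3/2 * edge_x e z + 1/2 * edge_h e z"
    and "edge_h (cap_side1 e) z = - 3/2 * edge_x e z - 3/2 * edge_h e z"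
    and "edge_x (cap_side2 e) z = 3/2 - 3/2 * edge_x e z - 1/2 * edge_h e z"
    and "edge_h (cap_side2 e) z = 3/2 * edge_x e z - 3/2 * edge_h e z - 3/2"
    and "snd (koch_sub1 e) \<noteq> fst (koch_sub1 e)" "snd (koch_sub2 e) \<noteq> fst (koch_sub2 e)"
     "snd (koch_sub3 e) \<noteq> fst (koch_sub3 e)" "snd (koch_sub4 e) \<noteq> fst (koch_sub4 e)"
     "snd (cap_side1 e) \<noteq> fst (cap_side1 e)" "snd (cap_side2 e) \<noteq> fst (cap_side2 e)"
proof -
  note defs = koch_sub1_def koch_sub2_def koch_sub3_def koch_sub4_def cap_side1_def cap_side2_def
    cis_minus_pi3 sqrt3_div
  note ch = edge_coords_change[OF e]
  have 1: "fst (koch_sub1 e) = fst e + (snd e - fst e) * Complex 0 (0 / sqrt 3)"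
    "(snd (koch_sub1 e) - fst (koch_sub1 e)) * Complex 3 (0 * sqrt 3) = snd e - fst e"
    unfolding defs by (simp_all add: complex_eq_iff field_simps)
  have 2: "fst (koch_sub2 e) = fst e + (snd e - fst e) * Complex (1/3) (0 / sqrt 3)"
    "(snd (koch_sub2 e) - fst (koch_sub2 e)) * Complex (3/2) (3/2 * sqrt 3) = snd e - fst e"
    unfolding defs by (simp_all add: complex_eq_iff field_simps)
  have 3: "fst (koch_sub3 e) = fst e + (snd e - fst e) * Complex (1/2) (-(1/2) / sqrt 3)"
    "(snd (koch_sub3 e) - fst (koch_sub3 e)) * Complex (3/2) (-(3/2) * sqrt 3) = snd e - fst e"
    unfolding defs by (simp_all add: complex_eq_iff field_simps)
  have 4: "fst (koch_sub4 e) = fst e + (snd e - fst e) * Complex (2/3) (0 / sqrt 3)"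
    "(snd (koch_sub4 e) - fst (koch_sub4 e)) * Complex 3 (0 * sqrt 3) = snd e - fst e"
    unfolding defs by (simp_all add: complex_eq_iff field_simps)
  have 5: "fst (cap_side1 e) = fst e + (snd e - fst e) * Complex (1/2) (-(1/2) / sqrt 3)"
    "(snd (cap_side1 e) - fst (cap_side1 e)) * Complex (-(3/2)) (-(1/2) * sqrt 3) = snd e - fst e"
    unfolding defs by (simp_all add: complex_eq_iff field_simps)
  have 6: "fst (cap_side2 e) = fst e + (snd e - fst e) * Complex 1 (0 / sqrt 3)"
    "(snd (cap_side2 e) - fst (cap_side2 e)) * Complex (-(3/2)) (1/2 * sqrt 3) = snd e - fst e"
    unfolding defs by (simp_all add: complex_eq_iff field_simps)
  show "edge_x (koch_sub1 e) z = 3 * edge_x e z" unfolding ch(2)[OF 1] by (simp add: field_simps)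
  show "edge_h (koch_sub1 e) z = 3 * edge_h e z" unfolding ch(3)[OF 1] by (simp add: field_simps)
  show "edge_x (koch_sub2 e) z = 3/2 * edge_x e z - 3/2 * edge_h e z - 1/2" unfolding ch(2)[OF 2] by (simp add: field_simps)
  show "edge_h (koch_sub2 e) z = 9/2 * edge_x e z + 3/2 * edge_h e z - 3/2" unfolding ch(3)[OF 2] by (simp add: field_simps)
  show "edge_x (koch_sub3 e) z = 3/2 * edge_x e z + 3/2 * edge_h e z" unfolding ch(2)[OF 3] by (simp add: field_simps)
  show "edge_h (koch_sub3 e) z = 3 - 9/2 * edge_x e z + 3/2 * edge_h e z" unfolding ch(3)[OF 3] by (simp add: field_simps)
  show "edge_x (koch_sub4 e) z = 3 * edge_x e z - 2" unfolding ch(2)[OF 4] by (simp add: field_simps)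
  show "edge_h (koch_sub4 e) z = 3 * edge_h e z" unfolding ch(3)[OF 4] by (simp add: field_simps)
  show "edge_x (cap_side1 e) z = 1 - 3/2 * edge_x e z + 1/2 * edge_h e z" unfolding ch(2)[OF 5] by (simp add: field_simps)
  show "edge_h (cap_side1 e) z = - 3/2 * edge_x e z - 3/2 * edge_h e z" unfolding ch(3)[OF 5] by (simp add: field_simps)
  show "edge_x (cap_side2 e) z = 3/2 - 3/2 * edge_x e z - 1/2 * edge_h e z" unfolding ch(2)[OF 6] by (simp add: field_simps)
  show "edge_h (cap_side2 e) z = 3/2 * edge_x e z - 3/2 * edge_h e z - 3/2" unfolding ch(3)[OF 6] by (simp add: field_simps)
  show "snd (koch_sub1 e) \<noteq> fst (koch_sub1 e)" "snd (koch_sub2 e) \<noteq> fst (koch_sub2 e)"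
     "snd (koch_sub3 e) \<noteq> fst (koch_sub3 e)" "snd (koch_sub4 e) \<noteq> fst (koch_sub4 e)"
     "snd (cap_side1 e) \<noteq> fst (cap_side1 e)" "snd (cap_side2 e) \<noteq> fst (cap_side2 e)"
    using ch(1)[OF 1] ch(1)[OF 2] ch(1)[OF 3] ch(1)[OF 4] ch(1)[OF 5] ch(1)[OF 6] by auto
qed

lemma edge_x_initial:
  "edge_x (0, 1) z = Re z" "edge_h (0, 1) z = sqrt 3 * Im z"
  by (simp_all add: edge_x_def edge_h_def)

lemma edge_coords_initial:
  "edge_x (1, cis (pi/3)) z = 1/2 - 1/2 * edge_x (0, 1) z + 1/2 * edge_h (0, 1) z"
  "edge_h (1, cis (pi/3)) z = 3/2 - 3/2 * edge_x (0, 1) z - 1/2 * edge_h (0, 1) z"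
  "edge_x (cis (pi/3), 0) z = 1 - 1/2 * edge_x (0, 1) z - 1/2 * edge_h (0, 1) z"
  "edge_h (cis (pi/3), 0) z = 3/2 * edge_x (0, 1) z - 1/2 * edge_h (0, 1) z"
proof -
  note ch = edge_coords_change[of "(0, 1)", simplified fst_conv snd_conv]
  have 1: "(1::complex) \<noteq> 0" by simp
  have 2: "fst (1, cis (pi/3)) = 0 + (1 - 0) * Complex 1 (0 / sqrt 3)"
    "(snd (1, cis (pi/3)) - fst (1, cis (pi/3))) * Complex (-(1/2)) (-(1/2) * sqrt 3) = 1 - 0"
    by (simp_all add: cis_pi3 complex_eq_iff field_simps)
  have 3: "fst (cis (pi/3), 0) = 0 + (1 - 0) * Complex (1/2) (3/2 / sqrt 3)"
    "(snd (cis (pi/3), 0) - fst (cis (pi/3), 0)) * Complex (-(1/2)) (1/2 * sqrt 3) = 1 - 0"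
    by (simp_all add: cis_pi3 complex_eq_iff sqrt3_div field_simps)
  show "edge_x (1, cis (pi/3)) z = 1/2 - 1/2 * edge_x (0, 1) z + 1/2 * edge_h (0, 1) z"
    unfolding ch(2)[OF 1 2] by (simp add: field_simps)
  show "edge_h (1, cis (pi/3)) z = 3/2 - 3/2 * edge_x (0, 1) z - 1/2 * edge_h (0, 1) z"
    unfolding ch(3)[OF 1 2] by (simp add: field_simps)
  show "edge_x (cis (pi/3), 0) z = 1 - 1/2 * edge_x (0, 1) z - 1/2 * edge_h (0, 1) z"
    unfolding ch(2)[OF 1 3] by (simp add: field_simps)
  show "edge_h (cis (pi/3), 0) z = 3/2 * edge_x (0, 1) z - 1/2 * edge_h (0, 1) z"
    unfolding ch(3)[OF 1 3] by (simp add: field_simps)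
qed

text \<open>Subdividing the two reversed sides of a cap gives the eight reversed sides of the four
  smaller caps. Hence the outer edges form a tree under the same rule, and everything proved about
  such trees serves both sides of the curve.\<close>

lemma cap_side_subs:
  "koch_subs (cap_side1 e) \<union> koch_subs (cap_side2 e) = cap_side1 ` koch_subs e \<union> cap_side2 ` koch_subs e"
proof -
  define \<omega> where "\<omega> = cis (- pi/3)"
  \<comment> \<open>The relation omega^2 = omega - 1 makes every comparison of end points linear in
    omega.\<close>
  have w2: "\<omega> * \<omega> = \<omega> - 1" "\<And>x. \<omega> * (\<omega> * x) = \<omega> * x - x"
    unfolding \<omega>_def cis_minus_pi3 by (simp_all add: complex_eq_iff field_simps)
  note defs = koch_sub1_def koch_sub2_def koch_sub3_def koch_sub4_def cap_side1_def cap_side2_def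
     \<omega>_def[symmetric]
  have "koch_sub1 (cap_side1 e) = cap_side2 (koch_sub2 e)"
    "koch_sub2 (cap_side1 e) = cap_side1 (koch_sub2 e)"
    "koch_sub3 (cap_side1 e) = cap_side2 (koch_sub1 e)"
    "koch_sub4 (cap_side1 e) = cap_side1 (koch_sub1 e)"
    "koch_sub1 (cap_side2 e) = cap_side2 (koch_sub4 e)"
    "koch_sub2 (cap_side2 e) = cap_side1 (koch_sub4 e)"
    "koch_sub3 (cap_side2 e) = cap_side2 (koch_sub3 e)"
    "koch_sub4 (cap_side2 e) = cap_side1 (koch_sub3 e)"
    unfolding defs by (simp_all add: prod_eq_iff field_simps w2)
  then show ?thesis unfolding koch_subs_def by auto
qed

text \<open>All sets are relative to the base \<open>edge_h = 0\<close>, the outer side being \<open>edge_h < 0\<close>: the cap, its mirror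
  image \<open>edge_lcap\<close>, the triangle \<open>edge_mid\<close> added by the subdivision, and a convex open set
  \<open>edge_kite\<close> that joins \<open>edge_mid\<close> to \<open>edge_lcap\<close> across the middle third.\<close>
definition edge_cap :: "complex \<times> complex \<Rightarrow> complex set" where
  "edge_cap e = {z. edge_h e z \<le> 0 \<and> 0 \<le> edge_x e z + edge_h e z \<and> edge_x e z - edge_h e z \<le> 1}"
definition edge_cap_int :: "complex \<times> complex \<Rightarrow> complex set" where
  "edge_cap_int e = {z. edge_h e z < 0 \<and> 0 < edge_x e z + edge_h e z \<and> edge_x e z - edge_h e z < 1}"
definition edge_lcap :: "complex \<times> complex \<Rightarrow> complex set" where
  "edge_lcap e = {z. 0 < edge_h e z \<and> 0 < edge_x e z - edge_h e z \<and> edge_x e z + edge_h e z < 1}"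
definition edge_mid :: "complex \<times> complex \<Rightarrow> complex set" where
  "edge_mid e = {z. edge_h e z \<le> 0 \<and> 1 \<le> 3 * edge_x e z + edge_h e z \<and> 3 * edge_x e z - edge_h e z \<le> 2}"
definition edge_mid_int :: "complex \<times> complex \<Rightarrow> complex set" where
  "edge_mid_int e = {z. edge_h e z < 0 \<and> 1 < 3 * edge_x e z + edge_h e z \<and> 3 * edge_x e z - edge_h e z < 2}"
definition edge_kite :: "complex \<times> complex \<Rightarrow> complex set" where
  "edge_kite e = {z. 1 < 3 * edge_x e z + edge_h e z \<and> 3 * edge_x e z - edge_h e z < 2 \<and>
     0 < edge_x e z - edge_h e z \<and> edge_x e z + edge_h e z < 1}"
definition edge_seg :: "complex \<times> complex \<Rightarrow> complex set" where
  "edge_seg e = {z. edge_h e z = 0 \<and> 0 \<le> edge_x e z \<and> edge_x e z \<le> 1}"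

lemmas edge_set_defs = edge_cap_def edge_cap_int_def edge_lcap_def edge_mid_def edge_mid_int_def
  edge_kite_def edge_seg_def

text \<open>In the coordinates of \<open>e\<close> each of the seven closed triangles is cut out by
  three rational linear inequalities, so the covering is a Boolean combination of linear
  inequalities in two real unknowns.\<close>

lemma edge_cap_cover:
  assumes "snd e \<noteq> fst e"
  shows "edge_cap e \<subseteq> (\<Union>c\<in>koch_subs e. edge_cap c) \<union> edge_mid e \<union> edge_mid (cap_side1 e) \<union> edge_mid (cap_side2 e)"
proof
  fix z assume "z \<in> edge_cap e"
  then have "z \<in> edge_cap (koch_sub1 e) \<or> z \<in> edge_cap (koch_sub2 e) \<or> z \<in> edge_cap (koch_sub3 e) \<or>
     z \<in> edge_cap (koch_sub4 e) \<or> z \<in> edge_mid e \<or> z \<in> edge_mid (cap_side1 e) \<or> z \<in> edge_mid (cap_side2 e)"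
    unfolding edge_cap_def edge_mid_def mem_Collect_eq edge_coords_sub[OF assms] by argo
  then show "z \<in> (\<Union>c\<in>koch_subs e. edge_cap c) \<union> edge_mid e \<union> edge_mid (cap_side1 e) \<union> edge_mid (cap_side2 e)"
    unfolding koch_subs_def by blast
qed

text \<open>All planar facts about one subdivision, reduced to linear arithmetic. Item 3 links a new
  edge to the set already built and yields connectedness; items 7 and 8 say that what a kite misses
  lies on new edges and drive the descent to the curve; items 12 to 17 are the local disjointness
  facts that separate the two sides.\<close>

lemma edge_sub_subsets:
  assumes e: "snd e \<noteq> fst e"
  shows "c \<in> koch_subs e \<Longrightarrow> edge_cap c \<subseteq> edge_cap e"
    and "c \<in> koch_subs e \<Longrightarrow> edge_cap_int c \<subseteq> edge_cap_int e"
    and "c \<in> koch_subs e \<Longrightarrow> edge_lcap c \<subseteq> edge_lcap e \<or> edge_lcap c \<subseteq> edge_mid_int e"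
    and "edge_mid_int e \<subseteq> edge_cap_int e"
    and "edge_mid_int (cap_side1 e) \<subseteq> edge_cap_int e"
    and "edge_mid_int (cap_side2 e) \<subseteq> edge_cap_int e"
    and "edge_mid e \<subseteq> edge_kite e \<union> (\<Union>c\<in>koch_subs e. edge_seg c)"
    and "edge_seg e \<subseteq> edge_kite e \<union> (\<Union>c\<in>koch_subs e. edge_seg c)"
    and "edge_seg e \<subseteq> edge_cap e"
    and "edge_seg (cap_side1 e) \<subseteq> edge_cap e"
    and "edge_seg (cap_side2 e) \<subseteq> edge_cap e"
    and "c \<in> koch_subs e \<Longrightarrow> edge_mid_int e \<inter> edge_cap_int c = {}"
    and "c \<in> koch_subs e \<Longrightarrow> edge_mid_int (cap_side1 e) \<inter> edge_cap_int c = {}"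
    and "c \<in> koch_subs e \<Longrightarrow> edge_mid_int (cap_side2 e) \<inter> edge_cap_int c = {}"
    and "edge_mid_int e \<inter> edge_mid_int (cap_side1 e) = {}"
    and "edge_mid_int e \<inter> edge_mid_int (cap_side2 e) = {}"
    and "c \<in> koch_subs e \<Longrightarrow> c' \<in> koch_subs e \<Longrightarrow> c \<noteq> c' \<Longrightarrow> edge_cap_int c \<inter> edge_cap_int c' = {}"
proof -
  note s = edge_coords_sub[OF e]
  show "c \<in> koch_subs e \<Longrightarrow> edge_cap c \<subseteq> edge_cap e"
    unfolding koch_subs_def edge_set_defs by (auto simp: s)
  show "c \<in> koch_subs e \<Longrightarrow> edge_cap_int c \<subseteq> edge_cap_int e"
    unfolding koch_subs_def edge_set_defs by (auto simp: s)
  show "c \<in> koch_subs e \<Longrightarrow> edge_lcap c \<subseteq> edge_lcap e \<or> edge_lcap c \<subseteq> edge_mid_int e"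
    unfolding koch_subs_def edge_set_defs by (auto simp: s)
  show "edge_mid_int e \<subseteq> edge_cap_int e" unfolding edge_set_defs by auto
  show "edge_mid_int (cap_side1 e) \<subseteq> edge_cap_int e" "edge_mid_int (cap_side2 e) \<subseteq> edge_cap_int e"
    unfolding edge_set_defs by (auto simp: s)
  show "edge_mid e \<subseteq> edge_kite e \<union> (\<Union>c\<in>koch_subs e. edge_seg c)"
  proof
    fix z assume "z \<in> edge_mid e"
    then have "z \<in> edge_kite e \<or> z \<in> edge_seg (koch_sub2 e) \<or> z \<in> edge_seg (koch_sub3 e)"
      unfolding edge_set_defs mem_Collect_eq s by argo
    then show "z \<in> edge_kite e \<union> (\<Union>c\<in>koch_subs e. edge_seg c)" unfolding koch_subs_def by blast
  qed
  show "edge_seg e \<subseteq> edge_kite e \<union> (\<Union>c\<in>koch_subs e. edge_seg c)"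
  proof
    fix z assume "z \<in> edge_seg e"
    then have "z \<in> edge_kite e \<or> z \<in> edge_seg (koch_sub1 e) \<or> z \<in> edge_seg (koch_sub4 e)"
      unfolding edge_set_defs mem_Collect_eq s by auto
    then show "z \<in> edge_kite e \<union> (\<Union>c\<in>koch_subs e. edge_seg c)" unfolding koch_subs_def by blast
  qed
  show "edge_seg e \<subseteq> edge_cap e" "edge_seg (cap_side1 e) \<subseteq> edge_cap e" "edge_seg (cap_side2 e) \<subseteq> edge_cap e"
    unfolding edge_set_defs by (auto simp: s)
  show "c \<in> koch_subs e \<Longrightarrow> edge_mid_int e \<inter> edge_cap_int c = {}"
    unfolding koch_subs_def edge_set_defs by (auto simp: s)
  show "c \<in> koch_subs e \<Longrightarrow> edge_mid_int (cap_side1 e) \<inter> edge_cap_int c = {}"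
    unfolding koch_subs_def edge_set_defs by (auto simp: s)
  show "c \<in> koch_subs e \<Longrightarrow> edge_mid_int (cap_side2 e) \<inter> edge_cap_int c = {}"
    unfolding koch_subs_def edge_set_defs by (auto simp: s)
  show "edge_mid_int e \<inter> edge_mid_int (cap_side1 e) = {}" "edge_mid_int e \<inter> edge_mid_int (cap_side2 e) = {}"
    unfolding edge_set_defs by (auto simp: s)
  show "c \<in> koch_subs e \<Longrightarrow> c' \<in> koch_subs e \<Longrightarrow> c \<noteq> c' \<Longrightarrow> edge_cap_int c \<inter> edge_cap_int c' = {}"
    unfolding koch_subs_def edge_set_defs by (auto simp: s)
qed

section \<open>Topology, convexity and size of the sets attached to an edge\<close>

lemma continuous_on_edge_coords [continuous_intros]:
  "continuous_on S (edge_x e)" "continuous_on S (edge_h e)"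
  unfolding edge_x_def[abs_def] edge_h_def[abs_def] divide_inverse by (intro continuous_intros)+

lemma open_edge_sets: "open (edge_cap_int e)" "open (edge_lcap e)" "open (edge_mid_int e)" "open (edge_kite e)"
  unfolding edge_set_defs by (intro open_Collect_conj open_Collect_less continuous_intros)+

lemma closed_edge_cap: "closed (edge_cap e)"
  unfolding edge_set_defs by (intro closed_Collect_conj closed_Collect_le continuous_intros)

lemma edge_coords_convex_comb:
  assumes "u + v = 1"
  shows "edge_x e (u *\<^sub>R z + v *\<^sub>R w) = u * edge_x e z + v * edge_x e w"
    "edge_h e (u *\<^sub>R z + v *\<^sub>R w) = u * edge_h e z + v * edge_h e w"
proof -
  have "fst e = u *\<^sub>R fst e + v *\<^sub>R fst e" using assms by (metis scaleR_left.add scaleR_one)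
  then have "(u *\<^sub>R z + v *\<^sub>R w) - fst e = u *\<^sub>R (z - fst e) + v *\<^sub>R (w - fst e)"
    by (metis (no_types, lifting) add_diff_add scaleR_right_diff_distrib)
  then have "((u *\<^sub>R z + v *\<^sub>R w) - fst e) / (snd e - fst e) = u *\<^sub>R ((z - fst e) / (snd e - fst e)) + v *\<^sub>R ((w - fst e) / (snd e - fst e))"
    by (simp add: add_divide_distrib scaleR_conv_of_real)
  then show "edge_x e (u *\<^sub>R z + v *\<^sub>R w) = u * edge_x e z + v * edge_x e w"
    "edge_h e (u *\<^sub>R z + v *\<^sub>R w) = u * edge_h e z + v * edge_h e w"
    by (simp_all add: edge_x_def edge_h_def algebra_simps)
qed

lemma convex_edge_halfplane:
  "convex {z. c < a * edge_x e z + b * edge_h e z}" "convex {z. c \<le> a * edge_x e z + b * edge_h e z}"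
proof -
  define L where "L z = a * edge_x e z + b * edge_h e z" for z
  have L: "L (u *\<^sub>R z + v *\<^sub>R w) = u * L z + v * L w" if "u + v = 1" for u v z w
    unfolding L_def edge_coords_convex_comb[OF that] by (simp add: algebra_simps)
  show "convex {z. c < a * edge_x e z + b * edge_h e z}"
    unfolding L_def[symmetric]
  proof (rule convexI, unfold mem_Collect_eq)
    fix z w u v assume *: "c < L z" "c < L w" "(0::real) \<le> u" "0 \<le> v" "u + v = 1"
    have "L z \<in> {c<..}" "L w \<in> {c<..}" using * by auto
    then have "u *\<^sub>R L z + v *\<^sub>R L w \<in> {c<..}" using * by (intro convexD[OF convex_real_interval(3)]) auto
    then show "c < L (u *\<^sub>R z + v *\<^sub>R w)" using L[OF *(5)] by simp
  qed
  show "convex {z. c \<le> a * edge_x e z + b * edge_h e z}"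
    unfolding L_def[symmetric]
  proof (rule convexI, unfold mem_Collect_eq)
    fix z w u v assume *: "c \<le> L z" "c \<le> L w" "(0::real) \<le> u" "0 \<le> v" "u + v = 1"
    have "L z \<in> {c..}" "L w \<in> {c..}" using * by auto
    then have "u *\<^sub>R L z + v *\<^sub>R L w \<in> {c..}" using * by (intro convexD[OF convex_real_interval(1)]) auto
    then show "c \<le> L (u *\<^sub>R z + v *\<^sub>R w)" using L[OF *(5)] by simp
  qed
qed

lemma convex_edge_lcap: "convex (edge_lcap e)"
proof -
  have "edge_lcap e = {z. 0 < 0 * edge_x e z + 1 * edge_h e z} \<inter> {z. 0 < 1 * edge_x e z + (-1) * edge_h e z}
     \<inter> {z. -1 < (-1) * edge_x e z + (-1) * edge_h e z}"
    unfolding edge_lcap_def by auto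
  then show ?thesis by (simp only: convex_Int convex_edge_halfplane)
qed

lemma convex_edge_kite: "convex (edge_kite e)"
proof -
  have "edge_kite e = {z. 1 < 3 * edge_x e z + 1 * edge_h e z} \<inter> {z. -2 < (-3) * edge_x e z + 1 * edge_h e z}
     \<inter> {z. 0 < 1 * edge_x e z + (-1) * edge_h e z} \<inter> {z. -1 < (-1) * edge_x e z + (-1) * edge_h e z}"
    unfolding edge_kite_def by auto
  then show ?thesis by (simp only: convex_Int convex_edge_halfplane)
qed

lemma edge_point:
  assumes "snd e \<noteq> fst e"
  shows "edge_x e (fst e + (snd e - fst e) * Complex x (h / sqrt 3)) = x"
    "edge_h e (fst e + (snd e - fst e) * Complex x (h / sqrt 3)) = h"
  using assms by (simp_all add: edge_x_def edge_h_def)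

lemma edge_kite_cases: "edge_kite e \<subseteq> edge_mid_int e \<union> edge_lcap e \<union> {z \<in> edge_kite e. edge_h e z = 0}"
  unfolding edge_set_defs by auto

lemma edge_mid_int_subset_kite: "edge_mid_int e \<subseteq> edge_kite e"
  unfolding edge_set_defs by auto

lemma edge_seg_eq:
  assumes "snd e \<noteq> fst e"
  shows "edge_seg e = closed_segment (fst e) (snd e)"
proof (rule set_eqI)
  fix z
  define D where "D = snd e - fst e"
  have D: "D \<noteq> 0" using assms by (simp add: D_def)
  have "z \<in> closed_segment (fst e) (snd e) \<longleftrightarrow> (\<exists>u. 0 \<le> u \<and> u \<le> 1 \<and> (z - fst e) / D = of_real u)"
    using D by (auto simp: closed_segment_def D_def scaleR_conv_of_real field_simps)
  also have "\<dots> \<longleftrightarrow> z \<in> edge_seg e"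
    by (auto simp: edge_seg_def edge_x_def edge_h_def D_def complex_eq_iff)
  finally show "z \<in> edge_seg e \<longleftrightarrow> z \<in> closed_segment (fst e) (snd e)" ..
qed

lemma edge_endpoints_seg:
  assumes "snd e \<noteq> fst e"
  shows "fst e \<in> edge_seg e" "snd e \<in> edge_seg e"
  using assms by (simp_all add: edge_seg_eq)

text \<open>In a cap -1/2 <= h <= 0 and 0 <= x <= 1 + h, so the squared relative distance is at most
  (1 + h)^2 + h^2/3 = 1 + 2 h (1 + 2 h / 3) <= 1. Caps of level n thus shrink to points like
  3^-n.\<close>

lemma edge_cap_dist:
  assumes "snd e \<noteq> fst e" "z \<in> edge_cap e"
  shows "dist z (fst e) \<le> cmod (snd e - fst e)"
proof -
  define w where "w = (z - fst e) / (snd e - fst e)"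
  define h where "h = edge_h e z"
  have x: "0 \<le> Re w + h" "Re w - h \<le> 1" "h \<le> 0"
    using assms(2) by (auto simp: edge_cap_def edge_x_def w_def h_def)
  then have h: "-1/2 \<le> h" "0 \<le> Re w" "Re w \<le> 1 + h" by auto
  have "(Im w)\<^sup>2 = h\<^sup>2 / 3" by (simp add: h_def edge_h_def w_def power_mult_distrib)
  then have "(cmod w)\<^sup>2 = (Re w)\<^sup>2 + h\<^sup>2 / 3" by (simp add: cmod_power2)
  also have "\<dots> \<le> (1 + h)\<^sup>2 + h\<^sup>2 / 3" using h by (intro add_right_mono power_mono) auto
  also have "\<dots> = 1 + 2 * h * (1 + 2/3 * h)" by (simp add: power2_eq_square algebra_simps)
  also have "\<dots> \<le> 1"
  proof -
    have "h * (1 + 2/3 * h) \<le> 0" by (rule mult_nonpos_nonneg) (use x h in auto)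
    then show ?thesis by simp
  qed
  finally have "cmod w \<le> 1" by (simp add: power_le_one_iff abs_square_le_1)
  then show ?thesis using assms(1) by (simp add: w_def norm_divide dist_norm field_simps)
qed

text \<open>One side of the curve: all descendants of a set of edges, with an open connected set \<open>R\<close> on the
  inner side of the initial edges.\<close>
locale koch_tree =
  fixes G :: "nat \<Rightarrow> (complex \<times> complex) set" and R :: "complex set"
  assumes G_Suc: "G (Suc n) = (\<Union>e\<in>G n. koch_subs e)"
    and G_0: "e \<in> G 0 \<Longrightarrow> snd e \<noteq> fst e"
    and lcap_0: "e \<in> G 0 \<Longrightarrow> edge_lcap e \<subseteq> R"
    and open_R: "open R" and connected_R: "connected R" and R_nonempty: "R \<noteq> {}"
begin

text \<open>Two versions of one side. In \<open>core\<close> the added triangles stay open, so that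
  disjointness is combinatorial; in \<open>region\<close> the kites cross the bases and glue the
  triangles into a connected set. They differ only by points on bases.\<close>

definition core :: "complex set" where "core = R \<union> (\<Union>n. \<Union>e\<in>G n. edge_mid_int e)"
definition region :: "complex set" where "region = R \<union> (\<Union>n. \<Union>e\<in>G n. edge_kite e)"

lemma nondeg: "e \<in> G n \<Longrightarrow> snd e \<noteq> fst e"
proof (induction n arbitrary: e)
  case 0 then show ?case by (rule G_0)
next
  case (Suc n)
  then show ?case using edge_coords_sub(13-16) unfolding G_Suc koch_subs_def by blast
qed

lemma core_subset_region: "core \<subseteq> region"
  unfolding core_def region_def using edge_mid_int_subset_kite by blast

text \<open>The mirror cap of a new edge falls either into that of its parent or into the triangle
  just added, so induction on the level applies.\<close>

lemma lcap_core: "e \<in> G n \<Longrightarrow> edge_lcap e \<subseteq> core"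
proof (induction n arbitrary: e)
  case 0 then show ?case using lcap_0 unfolding core_def by blast
next
  case (Suc n)
  then obtain d where d: "d \<in> G n" "e \<in> koch_subs d" unfolding G_Suc by blast
  have "edge_mid_int d \<subseteq> core" using d(1) unfolding core_def by blast
  then show ?case using edge_sub_subsets(3)[OF nondeg[OF d(1)] d(2)] Suc.IH[OF d(1)] by blast
qed

lemma open_region: "open region"
  unfolding region_def by (intro open_Un open_R open_UN ballI open_edge_sets)

lemma open_core: "open core"
  unfolding core_def by (intro open_Un open_R open_UN ballI open_edge_sets)

text \<open>A point of \<open>region\<close> outside \<open>core\<close> lies on the base of some
  kite; a short move to the outer side of that edge enters the open added triangle. This transfers
  disjointness from cores to regions.\<close>

lemma core_dense:
  assumes "open U" "U \<inter> region \<noteq> {}"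
  shows "U \<inter> core \<noteq> {}"
proof -
  obtain z where z: "z \<in> U" "z \<in> region" using assms by blast
  show ?thesis
  proof (cases "z \<in> core")
    case False
    then obtain n e where e: "e \<in> G n" "z \<in> edge_kite e"
      using z(2) unfolding region_def core_def by blast
    then have h0: "edge_h e z = 0"
      using edge_kite_cases[of e] lcap_core[OF e(1)] False unfolding core_def by blast
    have "open (U \<inter> edge_kite e)" using assms open_edge_sets by blast
    then obtain r where r: "r > 0" "ball z r \<subseteq> U \<inter> edge_kite e"
      using e z open_contains_ball[of "U \<inter> edge_kite e"] by blast
    define D where "D = snd e - fst e"
    have D: "D \<noteq> 0" using nondeg[OF e(1)] by (simp add: D_def)
    define t where "t = r / (2 * cmod D)"
    define z' where "z' = z - D * Complex 0 t"
    have t: "t > 0" using r D by (simp add: t_def)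
    have "cmod (Complex 0 t) = t" using t by (simp add: cmod_def)
    then have "dist z z' = cmod D * t" by (simp add: z'_def dist_norm norm_mult)
    also have "\<dots> < r" using r D by (simp add: t_def)
    finally have z': "z' \<in> U" "z' \<in> edge_kite e" using r by auto
    have zz: "(z' - fst e) / D = (z - fst e) / D - Complex 0 t" using D by (simp add: z'_def field_simps)
    have "edge_h e z' = edge_h e z - sqrt 3 * t"
      unfolding edge_h_def D_def[symmetric] zz by (simp add: algebra_simps)
    then have "edge_h e z' < 0" using h0 t by simp
    then have "z' \<in> edge_mid_int e" using z'(2) by (simp add: edge_set_defs)
    then show ?thesis using z'(1) e(1) unfolding core_def by blast
  qed (use z in blast)
qed

lemma lcap_kite_connected:
  assumes "snd e \<noteq> fst e"
  shows "connected (edge_lcap e \<union> edge_kite e)"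
proof -
  have "fst e + (snd e - fst e) * Complex (1/2) ((1/4) / sqrt 3) \<in> edge_lcap e \<inter> edge_kite e"
    using edge_point[OF assms, of "1/2" "1/4"] by (simp add: edge_set_defs)
  then show ?thesis
    by (intro connected_Un convex_connected convex_edge_lcap convex_edge_kite) blast
qed

lemma edge_lcap_nonempty:
  assumes "snd e \<noteq> fst e"
  shows "edge_lcap e \<noteq> {}"
proof -
  have "fst e + (snd e - fst e) * Complex (1/2) ((1/4) / sqrt 3) \<in> edge_lcap e"
    using edge_point[OF assms, of "1/2" "1/4"] by (simp add: edge_set_defs)
  then show ?thesis by blast
qed

text \<open>\<open>K\<close> is the component of a point of \<open>R\<close>. Each set
  \<open>edge_lcap e \<union> edge_kite e\<close> is connected, and its \<open>edge_lcap\<close>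
  part lies in the corresponding set of the parent; so going down the tree every such set is
  absorbed by \<open>K\<close>.\<close>

lemma connected_region: "connected region"
proof -
  obtain z0 where z0: "z0 \<in> R" using R_nonempty by blast
  define K where "K = connected_component_set region z0"
  have absorb: "A \<subseteq> K" if A: "connected A" "A \<subseteq> region" "A \<inter> K \<noteq> {}" for A
  proof -
    obtain w where w: "w \<in> A" "w \<in> K" using A(3) by blast
    have "A \<subseteq> connected_component_set region w"
      by (rule connected_component_maximal) (use A w in auto)
    also have "\<dots> = K" using w(2) unfolding K_def by (metis connected_component_eq)
    finally show ?thesis .
  qed
  have RK: "R \<subseteq> K"
    unfolding K_def by (rule connected_component_maximal) (use z0 connected_R region_def in auto)
  have *: "edge_lcap e \<union> edge_kite e \<subseteq> K" if "e \<in> G n" for e n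
    using that
  proof (induction n arbitrary: e)
    case 0
    show ?case
    proof (rule absorb)
      show "connected (edge_lcap e \<union> edge_kite e)" using lcap_kite_connected nondeg[OF 0] by blast
      show "edge_lcap e \<union> edge_kite e \<subseteq> region"
        using lcap_core[OF 0] core_subset_region 0 unfolding region_def by blast
      show "(edge_lcap e \<union> edge_kite e) \<inter> K \<noteq> {}"
        using edge_lcap_nonempty[OF nondeg[OF 0]] lcap_0[OF 0] RK by blast
    qed
  next
    case (Suc n)
    then obtain d where d: "d \<in> G n" "e \<in> koch_subs d" unfolding G_Suc by blast
    show ?case
    proof (rule absorb)
      show "connected (edge_lcap e \<union> edge_kite e)" using lcap_kite_connected nondeg[OF Suc.prems] by blast
      show "edge_lcap e \<union> edge_kite e \<subseteq> region"
        using lcap_core[OF Suc.prems] core_subset_region Suc.prems unfolding region_def by blast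
      have "edge_lcap e \<subseteq> edge_lcap d \<union> edge_kite d"
        using edge_sub_subsets(3)[OF nondeg[OF d(1)] d(2)] edge_mid_int_subset_kite[of d] by blast
      then show "(edge_lcap e \<union> edge_kite e) \<inter> K \<noteq> {}"
        using edge_lcap_nonempty[OF nondeg[OF Suc.prems]] Suc.IH[OF d(1)] by blast
    qed
  qed
  have "region = K"
  proof
    show "region \<subseteq> K" using RK * unfolding region_def by blast
    show "K \<subseteq> region" unfolding K_def by (rule connected_component_subset)
  qed
  then show ?thesis unfolding K_def by (metis connected_connected_component)
qed

text \<open>Outside the kite a point of an edge lies on one of the new edges. A point that avoids
  the region is therefore carried along edges of all later levels, which will place it on the
  curve.\<close>

lemma seg_descend:
  assumes "e \<in> G n" "z \<in> edge_seg e" "z \<notin> region"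
  shows "\<exists>c\<in>G (n + k). z \<in> edge_seg c"
proof (induction k)
  case 0 then show ?case using assms by auto
next
  case (Suc k)
  then obtain c where c: "c \<in> G (n + k)" "z \<in> edge_seg c" by blast
  have "z \<notin> edge_kite c" using assms(3) c(1) unfolding region_def by blast
  then have "\<exists>d\<in>koch_subs c. z \<in> edge_seg d" using edge_sub_subsets(8)[OF nondeg[OF c(1)]] c(2) by blast
  then show ?case using c(1) by (auto simp: G_Suc)
qed

lemma region_nonempty: "region \<noteq> {}" using R_nonempty by (auto simp: region_def)

end

section \<open>The two sides of the curve\<close>

definition koch_in :: "nat \<Rightarrow> (complex \<times> complex) set" where
  "koch_in n = set (koch_edges n)"
definition koch_out :: "nat \<Rightarrow> (complex \<times> complex) set" where
  "koch_out n = cap_side1 ` koch_in n \<union> cap_side2 ` koch_in n"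
definition koch_triangle :: "complex set" where
  "koch_triangle = {z. \<forall>e\<in>koch_in 0. 0 < edge_h e z}"
text \<open>This is the union of the initial triangle and its three caps, written as an intersection
  of half planes so that it is evidently closed and convex; its complement is the root of the outer
  tree.\<close>

definition koch_hexagon :: "complex set" where
  "koch_hexagon = {z. \<forall>f\<in>koch_out 0. edge_h f z \<le> 0}"
definition koch_caps :: "nat \<Rightarrow> complex set" where
  "koch_caps n = (\<Union>e\<in>koch_in n. edge_cap e)"
definition koch_limit :: "complex set" where
  "koch_limit = (\<Inter>n. koch_caps n)"

lemma koch_in_0: "koch_in 0 = {(0, 1), (1, cis (pi/3)), (cis (pi/3), 0)}"
  by (simp add: koch_in_def koch_edges0_def)

lemma koch_in_Suc: "koch_in (Suc n) = (\<Union>e\<in>koch_in n. koch_subs e)"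
  by (simp add: koch_in_def set_koch_refine_edge)

lemma koch_out_Suc: "koch_out (Suc n) = (\<Union>f\<in>koch_out n. koch_subs f)"
proof -
  have "koch_out (Suc n) = (\<Union>e\<in>koch_in n. cap_side1 ` koch_subs e \<union> cap_side2 ` koch_subs e)"
    unfolding koch_out_def koch_in_Suc by blast
  also have "\<dots> = (\<Union>e\<in>koch_in n. koch_subs (cap_side1 e) \<union> koch_subs (cap_side2 e))"
    by (simp only: cap_side_subs)
  also have "\<dots> = (\<Union>f\<in>koch_out n. koch_subs f)" unfolding koch_out_def by blast
  finally show ?thesis .
qed

lemma koch_in_0_nondeg: "snd (0, 1::complex) \<noteq> fst (0, 1::complex)"
  "snd (1, cis (pi/3)) \<noteq> fst (1, cis (pi/3))" "snd (cis (pi/3), 0) \<noteq> fst (cis (pi/3), 0)"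
  by (auto simp: cis_pi3 complex_eq_iff)

lemmas koch_0_coords = edge_coords_sub(9-12)[OF koch_in_0_nondeg(1)]
  edge_coords_sub(9-12)[OF koch_in_0_nondeg(2)] edge_coords_sub(9-12)[OF koch_in_0_nondeg(3)]

lemma koch_level0_defs:
  "z \<in> koch_triangle \<longleftrightarrow> 0 < edge_h (0,1) z \<and> edge_h (0,1) z + 3 * edge_x (0,1) z < 3 \<and> edge_h (0,1) z < 3 * edge_x (0,1) z"
  "z \<in> koch_hexagon \<longleftrightarrow> 0 \<le> edge_x (0,1) z + edge_h (0,1) z \<and> edge_x (0,1) z - edge_h (0,1) z \<le> 1
    \<and> edge_x (0,1) z \<le> 1 \<and> edge_x (0,1) z + edge_h (0,1) z \<le> 2 \<and> edge_h (0,1) z \<le> edge_x (0,1) z + 1 \<and> 0 \<le> edge_x (0,1) z"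
proof -
  have "z \<in> koch_triangle \<longleftrightarrow> 0 < edge_h (0,1) z \<and> 0 < edge_h (1, cis (pi/3)) z \<and> 0 < edge_h (cis (pi/3), 0) z"
    by (simp add: koch_triangle_def koch_in_0)
  then show "z \<in> koch_triangle \<longleftrightarrow> 0 < edge_h (0,1) z \<and> edge_h (0,1) z + 3 * edge_x (0,1) z < 3 \<and> edge_h (0,1) z < 3 * edge_x (0,1) z"
    unfolding edge_coords_initial by argo
  have "z \<in> koch_hexagon \<longleftrightarrow> edge_h (cap_side1 (0,1)) z \<le> 0 \<and> edge_h (cap_side2 (0,1)) z \<le> 0 \<and>
     edge_h (cap_side1 (1, cis (pi/3))) z \<le> 0 \<and> edge_h (cap_side2 (1, cis (pi/3))) z \<le> 0 \<and>
     edge_h (cap_side1 (cis (pi/3), 0)) z \<le> 0 \<and> edge_h (cap_side2 (cis (pi/3), 0)) z \<le> 0"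
    by (auto simp add: koch_hexagon_def koch_in_0 koch_out_def)
  then show "z \<in> koch_hexagon \<longleftrightarrow> 0 \<le> edge_x (0,1) z + edge_h (0,1) z \<and> edge_x (0,1) z - edge_h (0,1) z \<le> 1
    \<and> edge_x (0,1) z \<le> 1 \<and> edge_x (0,1) z + edge_h (0,1) z \<le> 2 \<and> edge_h (0,1) z \<le> edge_x (0,1) z + 1 \<and> 0 \<le> edge_x (0,1) z"
    unfolding koch_0_coords edge_coords_initial by argo
qed

lemma convex_koch_triangle: "convex koch_triangle"
proof -
  have eq: "koch_triangle = (\<Inter>e\<in>koch_in 0. {z. 0 < 0 * edge_x e z + 1 * edge_h e z})"
    unfolding koch_triangle_def by auto
  show ?thesis by (subst eq) (intro convex_INT convex_edge_halfplane)
qed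

lemma open_koch_triangle: "open koch_triangle"
proof -
  have eq: "koch_triangle = (\<Inter>e\<in>koch_in 0. {z. 0 < edge_h e z})"
    unfolding koch_triangle_def by auto
  show ?thesis
    by (subst eq) (intro open_INT ballI open_Collect_less continuous_intros, simp add: koch_in_0)
qed

lemma convex_koch_hexagon: "convex koch_hexagon"
proof -
  have eq: "koch_hexagon = (\<Inter>e\<in>koch_out 0. {z. 0 \<le> 0 * edge_x e z + (-1) * edge_h e z})"
    unfolding koch_hexagon_def by auto
  show ?thesis by (subst eq) (intro convex_INT convex_edge_halfplane)
qed

lemma closed_koch_hexagon: "closed koch_hexagon"
proof -
  have eq: "koch_hexagon = (\<Inter>e\<in>koch_out 0. {z. edge_h e z \<le> 0})"
    unfolding koch_hexagon_def by auto
  show ?thesis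
    by (subst eq) (intro closed_INT ballI closed_Collect_le continuous_intros)
qed

lemma bounded_koch_hexagon: "bounded koch_hexagon"
proof (rule boundedI)
  fix z assume "z \<in> koch_hexagon"
  then have x: "\<bar>Re z\<bar> \<le> 2" and h: "\<bar>sqrt 3 * Im z\<bar> \<le> 3"
    unfolding koch_level0_defs edge_x_initial by auto
  have "\<bar>Im z\<bar> \<le> \<bar>sqrt 3 * Im z\<bar>" by (simp add: abs_mult mult_le_cancel_right1)
  then show "cmod z \<le> 5" using cmod_le[of z] x h by linarith
qed

lemma koch_triangle_point: "\<exists>z. z \<in> koch_triangle"
proof
  show "Complex (1/2) ((1/2) / sqrt 3) \<in> koch_triangle"
    unfolding koch_level0_defs edge_x_initial by simp
qed

interpretation inner: koch_tree koch_in koch_triangle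
proof
  show "koch_in (Suc n) = (\<Union>e\<in>koch_in n. koch_subs e)" for n by (rule koch_in_Suc)
  show "e \<in> koch_in 0 \<Longrightarrow> snd e \<noteq> fst e" for e unfolding koch_in_0 using koch_in_0_nondeg by blast
  show "e \<in> koch_in 0 \<Longrightarrow> edge_lcap e \<subseteq> koch_triangle" for e
    unfolding koch_in_0 edge_lcap_def by (auto simp: koch_level0_defs edge_coords_initial)
  show "connected koch_triangle" by (rule convex_connected[OF convex_koch_triangle])
  show "koch_triangle \<noteq> {}" using koch_triangle_point by blast
qed (rule open_koch_triangle)

interpretation outer: koch_tree koch_out "- koch_hexagon"
proof
  show "koch_out (Suc n) = (\<Union>e\<in>koch_out n. koch_subs e)" for n by (rule koch_out_Suc)
  show "e \<in> koch_out 0 \<Longrightarrow> snd e \<noteq> fst e" for e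
    using edge_coords_sub(17,18) inner.nondeg unfolding koch_out_def by blast
  show "e \<in> koch_out 0 \<Longrightarrow> edge_lcap e \<subseteq> - koch_hexagon" for e
    unfolding koch_hexagon_def edge_lcap_def by force
  show "connected (- koch_hexagon)"
    by (rule connected_complement_bounded_convex) (simp_all add: bounded_koch_hexagon convex_koch_hexagon)
  show "- koch_hexagon \<noteq> {}" using cobounded_imp_unbounded[of "- koch_hexagon"] bounded_koch_hexagon by auto
qed (use closed_koch_hexagon in auto)

lemma koch_in_finite: "finite (koch_in n)" by (simp add: koch_in_def)

lemma koch_in_nonempty: "koch_in n \<noteq> {}"
proof (induction n)
  case (Suc n) then show ?case by (auto simp: koch_in_Suc koch_subs_def)
qed (simp add: koch_in_0)

lemma koch_in_length: "e \<in> koch_in n \<Longrightarrow> cmod (snd e - fst e) = (1/3)^n"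
proof (induction n arbitrary: e)
  case 0
  have "cmod (cis (pi/3) - 1) = 1" unfolding cis_pi3
    by (simp add: cmod_def power2_eq_square)
  then show ?case using 0 unfolding koch_in_0 by auto
next
  case (Suc n)
  then obtain d where d: "d \<in> koch_in n" "e \<in> koch_subs d" unfolding koch_in_Suc by blast
  have "cmod (snd e - fst e) = cmod (snd d - fst d) / 3"
  proof -
    have 3: "snd (koch_sub3 d) - fst (koch_sub3 d) = (snd d - fst d) / 3 * (1 - cis (-pi/3))"
      by (simp add: koch_sub3_def) (simp add: field_simps)
    have 4: "snd (koch_sub4 d) - fst (koch_sub4 d) = (snd d - fst d) / 3"
      by (simp add: koch_sub4_def field_simps)
    have n: "cmod (1 - cis (-pi/3)) = 1" unfolding cis_minus_pi3
      by (simp add: cmod_def power2_eq_square)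
    have "cmod (snd (koch_sub1 d) - fst (koch_sub1 d)) = cmod (snd d - fst d) / 3"
      "cmod (snd (koch_sub2 d) - fst (koch_sub2 d)) = cmod (snd d - fst d) / 3"
      by (simp_all add: koch_sub1_def koch_sub2_def norm_mult norm_divide)
    moreover have "cmod (snd (koch_sub3 d) - fst (koch_sub3 d)) = cmod (snd d - fst d) / 3"
      "cmod (snd (koch_sub4 d) - fst (koch_sub4 d)) = cmod (snd d - fst d) / 3"
      unfolding 3 4 by (simp_all only: norm_mult norm_divide n) simp_all
    ultimately show ?thesis using d(2) unfolding koch_subs_def by blast
  qed
  then show ?case using Suc.IH[OF d(1)] by simp
qed

lemma koch_caps_Suc: "koch_caps (Suc n) \<subseteq> koch_caps n"
  unfolding koch_caps_def koch_in_Suc using edge_sub_subsets(1)[OF inner.nondeg] by blast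

lemma koch_caps_mono: "m \<le> n \<Longrightarrow> koch_caps n \<subseteq> koch_caps m"
  by (rule lift_Suc_antimono_le[of koch_caps]) (rule koch_caps_Suc)

lemma koch_limitI:
  assumes "\<And>k. z \<in> koch_caps (n + k)"
  shows "z \<in> koch_limit"
  unfolding koch_limit_def
proof
  fix m show "z \<in> koch_caps m"
    using assms[of m] koch_caps_mono[of m "n + m"] by auto
qed

lemma koch_in_seg: "e \<in> koch_in n \<Longrightarrow> edge_seg e \<subseteq> inner.region \<union> koch_limit"
proof (intro subsetI)
  fix z assume e: "e \<in> koch_in n" "z \<in> edge_seg e"
  show "z \<in> inner.region \<union> koch_limit"
  proof (cases "z \<in> inner.region")
    case False
    have "z \<in> koch_caps (n + k)" for k
      using inner.seg_descend[OF e False, of k] edge_sub_subsets(9) inner.nondeg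
      unfolding koch_caps_def by blast
    then show ?thesis using koch_limitI by blast
  qed simp
qed

text \<open>Edges of \<open>koch_out\<close> are sides of caps of the same level, so the descent in
  the outer tree also stays in \<open>koch_caps\<close> and ends on the same limit set as the inner
  one.\<close>

lemma koch_out_seg: "e \<in> koch_out n \<Longrightarrow> edge_seg e \<subseteq> outer.region \<union> koch_limit"
proof (intro subsetI)
  fix z assume e: "e \<in> koch_out n" "z \<in> edge_seg e"
  show "z \<in> outer.region \<union> koch_limit"
  proof (cases "z \<in> outer.region")
    case False
    have "z \<in> koch_caps (n + k)" for k
      using outer.seg_descend[OF e False, of k] edge_sub_subsets(10,11) inner.nondeg
      unfolding koch_caps_def koch_out_def by blast
    then show ?thesis using koch_limitI by blast
  qed simp
qed

text \<open>A point outside both regions is in a cap of every level. Inside a cap the alternatives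
  to a smaller cap are three closed triangles, one inner and two outer; each consists of kite
  points, which belong to a region, and points of new edges, which belong to a region or to the
  limit.\<close>

lemma koch_cover: "inner.region \<union> outer.region \<union> koch_limit = UNIV"
proof (rule ccontr)
  assume "\<not> ?thesis"
  then obtain z where z: "z \<notin> inner.region" "z \<notin> outer.region" "z \<notin> koch_limit" by blast
  have "z \<in> koch_caps n" for n
  proof (induction n)
    case 0
    have hex: "z \<in> koch_hexagon" using z(2) unfolding outer.region_def by blast
    have nt: "z \<notin> koch_triangle" using z(1) unfolding inner.region_def by blast
    have "edge_h (0,1) z \<le> 0 \<or> 3 \<le> edge_h (0,1) z + 3 * edge_x (0,1) z \<or> 3 * edge_x (0,1) z \<le> edge_h (0,1) z"
      using nt unfolding koch_level0_defs by linarith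
    moreover have "z \<in> edge_cap (0,1)" if "edge_h (0,1) z \<le> 0"
      using hex that unfolding koch_level0_defs edge_cap_def by simp
    moreover have "z \<in> edge_cap (1, cis (pi/3))" if "3 \<le> edge_h (0,1) z + 3 * edge_x (0,1) z"
      using hex that unfolding koch_level0_defs edge_cap_def mem_Collect_eq edge_coords_initial by (elim conjE, intro conjI; linarith)
    moreover have "z \<in> edge_cap (cis (pi/3), 0)" if "3 * edge_x (0,1) z \<le> edge_h (0,1) z"
      using hex that unfolding koch_level0_defs edge_cap_def mem_Collect_eq edge_coords_initial by (elim conjE, intro conjI; linarith)
    ultimately have "z \<in> edge_cap (0,1) \<or> z \<in> edge_cap (1, cis (pi/3)) \<or> z \<in> edge_cap (cis (pi/3), 0)"
      by blast
    then show ?case unfolding koch_caps_def koch_in_0 by blast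
  next
    case (Suc n)
    then obtain e where e: "e \<in> koch_in n" "z \<in> edge_cap e" unfolding koch_caps_def by blast
    have m: "z \<notin> edge_mid e"
    proof
      assume "z \<in> edge_mid e"
      then consider "z \<in> edge_kite e" | c where "c \<in> koch_subs e" "z \<in> edge_seg c"
        using edge_sub_subsets(7)[OF inner.nondeg[OF e(1)]] by blast
      then show False
      proof cases
        case 1 then show False using z(1) e(1) unfolding inner.region_def by blast
      next
        case 2
        then show False using koch_in_seg[of c "Suc n"] z e(1) unfolding koch_in_Suc by blast
      qed
    qed
    have "z \<notin> edge_mid f" if f: "f \<in> koch_out n" for f
    proof
      assume "z \<in> edge_mid f"
      then consider "z \<in> edge_kite f" | c where "c \<in> koch_subs f" "z \<in> edge_seg c"
        using edge_sub_subsets(7)[OF outer.nondeg[OF f]] by blast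
      then show False
      proof cases
        case 1 then show False using z(2) f unfolding outer.region_def by blast
      next
        case 2
        then show False using koch_out_seg[of c "Suc n"] z f unfolding koch_out_Suc by blast
      qed
    qed
    then have "z \<notin> edge_mid (cap_side1 e)" "z \<notin> edge_mid (cap_side2 e)"
      using e(1) unfolding koch_out_def by blast+
    then show ?case
      using edge_cap_cover[OF inner.nondeg[OF e(1)]] e m unfolding koch_caps_def koch_in_Suc by blast
  qed
  then show False using z(3) unfolding koch_limit_def by blast
qed

section \<open>Disjointness of the inner and the outer side\<close>

lemma koch_cap_int_ancestor:
  "e \<in> koch_in (n + k) \<Longrightarrow> z \<in> edge_cap_int e \<Longrightarrow> \<exists>d\<in>koch_in n. z \<in> edge_cap_int d"
proof (induction k arbitrary: e)
  case (Suc k)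
  then obtain d where d: "d \<in> koch_in (n + k)" "e \<in> koch_subs d" by (auto simp: koch_in_Suc)
  then show ?case using Suc.IH[OF d(1)] Suc.prems(2) edge_sub_subsets(2)[OF inner.nondeg[OF d(1)] d(2)] by blast
qed auto

lemma koch_cap_int_disjoint:
  "e \<in> koch_in n \<Longrightarrow> e' \<in> koch_in n \<Longrightarrow> e \<noteq> e' \<Longrightarrow> edge_cap_int e \<inter> edge_cap_int e' = {}"
proof (induction n arbitrary: e e')
  case 0
  then show ?case unfolding koch_in_0 edge_cap_int_def by (auto simp: edge_coords_initial)
next
  case (Suc n)
  obtain d where d: "d \<in> koch_in n" "e \<in> koch_subs d" using Suc.prems by (auto simp: koch_in_Suc)
  obtain d' where d': "d' \<in> koch_in n" "e' \<in> koch_subs d'" using Suc.prems by (auto simp: koch_in_Suc)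
  show ?case
  proof (cases "d = d'")
    case True
    then show ?thesis using edge_sub_subsets(17)[OF inner.nondeg[OF d(1)] d(2)] d'(2) Suc.prems(3) by blast
  next
    case False
    then show ?thesis
      using Suc.IH[OF d(1) d'(1)] edge_sub_subsets(2)[OF inner.nondeg[OF d(1)] d(2)]
        edge_sub_subsets(2)[OF inner.nondeg[OF d'(1)] d'(2)] by blast
  qed
qed

lemma koch_cap_int_level0:
  assumes "e \<in> koch_in n"
  shows "edge_cap_int e \<subseteq> koch_hexagon - koch_triangle"
proof
  fix z assume "z \<in> edge_cap_int e"
  then obtain d where d: "d \<in> koch_in 0" "z \<in> edge_cap_int d"
    using koch_cap_int_ancestor[of e 0 n z] assms by auto
  then show "z \<in> koch_hexagon - koch_triangle"
    unfolding koch_in_0 edge_cap_int_def by (auto simp: edge_coords_initial koch_level0_defs)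
qed

text \<open>The deeper cap has an ancestor of level \<open>Suc n\<close> around \<open>z\<close>,
  and the parent of that ancestor can only be \<open>e\<close> since open caps of equal level are
  disjoint.\<close>

lemma koch_cap_int_parent:
  assumes "e \<in> koch_in n" "z \<in> edge_cap_int e" "g \<in> koch_in m" "z \<in> edge_cap_int g" "n < m"
  shows "\<exists>d\<in>koch_subs e. z \<in> edge_cap_int d"
proof -
  obtain k where "m = Suc n + k" using assms(5) less_iff_Suc_add by auto
  then obtain d where d: "d \<in> koch_in (Suc n)" "z \<in> edge_cap_int d"
    using koch_cap_int_ancestor[of g "Suc n" k z] assms by blast
  then obtain e' where e': "e' \<in> koch_in n" "d \<in> koch_subs e'" by (auto simp: koch_in_Suc)
  then have "z \<in> edge_cap_int e'" using edge_sub_subsets(2)[OF inner.nondeg[OF e'(1)] e'(2)] d by blast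
  then have "e' = e" using koch_cap_int_disjoint[OF e'(1) assms(1)] assms(2) by blast
  then show ?thesis using d e' by blast
qed

text \<open>The initial triangle and the outside of the hexagon avoid all open caps, so both points
  of view reduce to an inner triangle over \<open>e\<close> and an outer one over \<open>g\<close>.
  If one belongs to an earlier level, it avoids the child cap containing the point; if the levels
  agree, \<open>e = g\<close> and the two triangles are disjoint.\<close>

lemma koch_cores_disjoint: "inner.core \<inter> outer.core = {}"
proof (rule ccontr)
  assume "\<not> ?thesis"
  then obtain z where z: "z \<in> inner.core" "z \<in> outer.core" by blast
  have tri: "koch_triangle \<subseteq> koch_hexagon" by (auto simp: koch_level0_defs)
  have inn: "z \<in> koch_triangle \<or> (\<exists>n. \<exists>e\<in>koch_in n. z \<in> edge_mid_int e)"
    using z(1) unfolding inner.core_def by blast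
  have out: "z \<notin> koch_hexagon \<or> (\<exists>m. \<exists>g\<in>koch_in m. z \<in> edge_mid_int (cap_side1 g) \<or> z \<in> edge_mid_int (cap_side2 g))"
    using z(2) unfolding outer.core_def koch_out_def by blast
  have mc: "z \<in> edge_cap_int e" if "e \<in> koch_in n" "z \<in> edge_mid_int e" for e n
    using that edge_sub_subsets(4)[OF inner.nondeg[OF that(1)]] by blast
  have gc: "z \<in> edge_cap_int g" if "g \<in> koch_in m" "z \<in> edge_mid_int (cap_side1 g) \<or> z \<in> edge_mid_int (cap_side2 g)" for g m
    using that edge_sub_subsets(5,6)[OF inner.nondeg[OF that(1)]] by blast
  obtain n e m g where e: "e \<in> koch_in n" "z \<in> edge_mid_int e"
    and g: "g \<in> koch_in m" "z \<in> edge_mid_int (cap_side1 g) \<or> z \<in> edge_mid_int (cap_side2 g)"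
    using inn out tri koch_cap_int_level0 mc gc by blast
  note ec = mc[OF e] and gc' = gc[OF g]
  consider "n < m" | "m < n" | "n = m" by linarith
  then show False
  proof cases
    case 1
    then show False
      using koch_cap_int_parent[OF e(1) ec g(1) gc'] edge_sub_subsets(12)[OF inner.nondeg[OF e(1)]] e(2) by blast
  next
    case 2
    then show False
      using koch_cap_int_parent[OF g(1) gc' e(1) ec] edge_sub_subsets(13,14)[OF inner.nondeg[OF g(1)]] g(2) by blast
  next
    case 3
    then have "e = g" using koch_cap_int_disjoint[of e n g] e(1) g(1) ec gc' by blast
    then show False using edge_sub_subsets(15,16)[OF inner.nondeg[OF e(1)]] e(2) g(2) by blast
  qed
qed

lemma koch_regions_disjoint: "inner.region \<inter> outer.region = {}"
proof (rule ccontr)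
  assume *: "\<not> ?thesis"
  then have "outer.region \<inter> inner.core \<noteq> {}"
    using inner.core_dense[OF outer.open_region] by blast
  then have "inner.core \<inter> outer.core \<noteq> {}"
    using outer.core_dense[OF inner.open_core] by blast
  then show False using koch_cores_disjoint by blast
qed

lemma edge_mid_int_nonempty:
  assumes "snd e \<noteq> fst e"
  shows "edge_mid_int e \<noteq> {}"
proof -
  have "fst e + (snd e - fst e) * Complex (1/2) (-(1/4) / sqrt 3) \<in> edge_mid_int e"
    using edge_point[OF assms, of "1/2" "-(1/4)"] by (simp add: edge_set_defs)
  then show ?thesis by blast
qed

lemma edge_cap_int_subset: "edge_cap_int e \<subseteq> edge_cap e"
  unfolding edge_set_defs by auto

lemma koch_limit_ball:
  assumes z: "z \<in> koch_limit" and r: "r > 0"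
  shows "\<exists>n. \<exists>e\<in>koch_in n. edge_cap e \<subseteq> ball z r"
proof -
  obtain n where n: "(1/3::real)^n < r/2" using real_arch_pow_inv[of "r/2" "1/3"] r by auto
  obtain e where e: "e \<in> koch_in n" "z \<in> edge_cap e" using z unfolding koch_limit_def koch_caps_def by blast
  have "edge_cap e \<subseteq> ball z r"
  proof
    fix w assume w: "w \<in> edge_cap e"
    have "dist z w \<le> dist z (fst e) + dist w (fst e)" by (rule dist_triangle2)
    also have "\<dots> \<le> (1/3)^n + (1/3)^n"
      using edge_cap_dist[OF inner.nondeg[OF e(1)]] e(2) w koch_in_length[OF e(1)] by (metis add_mono)
    finally show "w \<in> ball z r" using n by simp
  qed
  then show ?thesis using e by blast
qed

text \<open>Every neighbourhood of a limit point contains a whole small cap, hence an inner and an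
  outer triangle. An open region containing the point would therefore meet the other region.\<close>

lemma koch_limit_disjoint: "koch_limit \<inter> inner.region = {}" "koch_limit \<inter> outer.region = {}"
proof -
  have "False" if z: "z \<in> koch_limit" "z \<in> inner.region" for z
  proof -
    obtain r where r: "r > 0" "ball z r \<subseteq> inner.region"
      using inner.open_region z(2) open_contains_ball by blast
    obtain n e where e: "e \<in> koch_in n" "edge_cap e \<subseteq> ball z r" using koch_limit_ball[OF z(1) r(1)] by blast
    note nd = inner.nondeg[OF e(1)]
    have "edge_mid_int (cap_side1 e) \<subseteq> inner.region"
      using e(2) r(2) edge_sub_subsets(5)[OF nd] edge_cap_int_subset[of e] by blast
    moreover have "edge_mid_int (cap_side1 e) \<subseteq> outer.region"
      using e(1) outer.core_subset_region unfolding outer.core_def koch_out_def by blast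
    ultimately show False
      using koch_regions_disjoint edge_mid_int_nonempty[OF edge_coords_sub(17)[OF nd]] by blast
  qed
  then show "koch_limit \<inter> inner.region = {}" by blast
  have "False" if z: "z \<in> koch_limit" "z \<in> outer.region" for z
  proof -
    obtain r where r: "r > 0" "ball z r \<subseteq> outer.region"
      using outer.open_region z(2) open_contains_ball by blast
    obtain n e where e: "e \<in> koch_in n" "edge_cap e \<subseteq> ball z r" using koch_limit_ball[OF z(1) r(1)] by blast
    note nd = inner.nondeg[OF e(1)]
    have "edge_mid_int e \<subseteq> outer.region"
      using e(2) r(2) edge_sub_subsets(4)[OF nd] edge_cap_int_subset[of e] by blast
    moreover have "edge_mid_int e \<subseteq> inner.region"
      using e(1) inner.core_subset_region unfolding inner.core_def by blast
    ultimately show False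
      using koch_regions_disjoint edge_mid_int_nonempty[OF nd] by blast
  qed
  then show "koch_limit \<inter> outer.region = {}" by blast
qed

lemma koch_limit_compl: "- koch_limit = inner.region \<union> outer.region"
  using koch_cover koch_limit_disjoint by blast

section \<open>The curve, its domain and area estimates\<close>

lemma koch_polygon_eq: "koch_polygon n = (\<Union>e\<in>koch_in n. edge_seg e)"
  unfolding koch_polygon_def koch_in_def[symmetric] using edge_seg_eq[OF inner.nondeg] by auto

lemma compact_koch_polygon: "compact (koch_polygon n)"
  unfolding koch_polygon_def by (intro compact_UN) auto

lemma closed_koch_caps: "closed (koch_caps n)"
  unfolding koch_caps_def by (intro closed_UN koch_in_finite ballI closed_edge_cap)

lemma koch_limit_norm: "z \<in> koch_limit \<Longrightarrow> cmod z \<le> 2"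
proof -
  assume "z \<in> koch_limit"
  then obtain e where e: "e \<in> koch_in 0" "z \<in> edge_cap e" unfolding koch_limit_def koch_caps_def by blast
  have "dist z (fst e) \<le> 1" using edge_cap_dist[OF inner.nondeg[OF e(1)] e(2)] koch_in_length[OF e(1)] by simp
  moreover have "cmod (fst e) \<le> 1" using e(1) unfolding koch_in_0 by auto
  ultimately show ?thesis using norm_triangle_ineq[of "z - fst e" "fst e"] by (simp add: dist_norm)
qed

lemma compact_koch_limit: "compact koch_limit"
proof -
  have "closed koch_limit" unfolding koch_limit_def by (intro closed_INT ballI closed_koch_caps)
  moreover have "bounded koch_limit" using koch_limit_norm by (auto intro!: boundedI)
  ultimately show ?thesis by (simp add: compact_eq_bounded_closed)
qed

text \<open>\<open>koch_sub1\<close> keeps the starting point, so a vertex remains a vertex at all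
  later levels.\<close>

lemma koch_in_vertex: "e \<in> koch_in n \<Longrightarrow> fst e \<in> koch_limit"
proof (rule koch_limitI[of _ n])
  fix k assume e: "e \<in> koch_in n"
  have "\<exists>c\<in>koch_in (n + k). fst c = fst e"
  proof (induction k)
    case (Suc k)
    then obtain c where c: "c \<in> koch_in (n + k)" "fst c = fst e" by blast
    then have "koch_sub1 c \<in> koch_in (n + Suc k)" by (auto simp: koch_in_Suc koch_subs_def)
    then show ?case using c(2) by (auto intro!: bexI[of _ "koch_sub1 c"] simp: koch_sub1_def)
  qed (use e in auto)
  then obtain c where c: "c \<in> koch_in (n + k)" "fst c = fst e" by blast
  then have "fst e \<in> edge_cap c"
    using edge_endpoints_seg(1) edge_sub_subsets(9) inner.nondeg by (metis subsetD)
  then show "fst e \<in> koch_caps (n + k)" using c unfolding koch_caps_def by blast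
qed

lemma koch_limit_nonempty: "koch_limit \<noteq> {}"
  using koch_in_vertex[of "(0,1)" 0] by (auto simp: koch_in_0)

section \<open>Identification of the limit curve and of its bounded component\<close>

lemma hausdorff_dist_bound:
  assumes "compact A" "compact B" "A \<noteq> {}" "B \<noteq> {}"
  shows "a \<in> A \<Longrightarrow> infdist a B \<le> hausdorff_dist A B" "b \<in> B \<Longrightarrow> infdist b A \<le> hausdorff_dist A B"
proof -
  have bdd: "bdd_above ((\<lambda>a. infdist a B) ` A)" if "compact A" for A B :: "complex set"
    by (intro bounded_imp_bdd_above compact_imp_bounded compact_continuous_image continuous_intros that)
  show "a \<in> A \<Longrightarrow> infdist a B \<le> hausdorff_dist A B"
    unfolding hausdorff_dist_def by (intro max.coboundedI1 cSUP_upper bdd assms)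
  show "b \<in> B \<Longrightarrow> infdist b A \<le> hausdorff_dist A B"
    unfolding hausdorff_dist_def by (intro max.coboundedI2 cSUP_upper bdd assms)
qed

text \<open>Uniqueness of compact Hausdorff limits, required by the description operator in
  \<open>koch_curve\<close>. The estimate goes from \<open>C\<close> to \<open>D\<close> through a
  nearest point of \<open>P n\<close>.\<close>

lemma hausdorff_limit_subset:
  assumes "compact C" "compact D" "C \<noteq> {}" "D \<noteq> {}"
    and P: "\<And>n. compact (P n)" "\<And>n. P n \<noteq> {}"
    and lim: "(\<lambda>n. hausdorff_dist (P n) C) \<longlonglongrightarrow> 0" "(\<lambda>n. hausdorff_dist (P n) D) \<longlonglongrightarrow> 0"
  shows "C \<subseteq> D"
proof
  fix x assume x: "x \<in> C"
  have "infdist x D \<le> hausdorff_dist (P n) C + hausdorff_dist (P n) D" for n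
  proof -
    obtain y where y: "y \<in> P n" "infdist x (P n) = dist x y"
      using infdist_attains_inf[of "P n" x] P compact_imp_closed by blast
    have "infdist x D \<le> infdist y D + dist x y" by (rule infdist_triangle)
    also have "infdist y D \<le> hausdorff_dist (P n) D"
      by (rule hausdorff_dist_bound) (use assms y in auto)
    also have "dist x y \<le> hausdorff_dist (P n) C"
      unfolding y(2)[symmetric] by (rule hausdorff_dist_bound) (use assms x in auto)
    finally show ?thesis by simp
  qed
  then have "infdist x D \<le> 0 + 0"
    by (intro LIMSEQ_le_const[OF tendsto_add[OF lim]]) auto
  then have "infdist x D = 0" using infdist_nonneg[of x D] by simp
  then show "x \<in> D" using in_closed_iff_infdist_zero[OF compact_imp_closed[OF assms(2)] assms(4)] by simp
qed

lemma koch_polygon_nonempty: "koch_polygon n \<noteq> {}"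
  using koch_in_nonempty[of n] edge_endpoints_seg(1)[OF inner.nondeg] unfolding koch_polygon_eq by blast

text \<open>The vertex \<open>fst e\<close> lies on the polygon and on the limit set, and every
  point of the cap of \<open>e\<close> is within 3^-n of it; so one vertex serves both
  suprema.\<close>

lemma koch_hausdorff_limit: "(\<lambda>n. hausdorff_dist (koch_polygon n) koch_limit) \<longlonglongrightarrow> 0"
proof (rule tendsto_sandwich[of "\<lambda>_. 0" _ _ "\<lambda>n. (1/3)^n"])
  have "0 \<le> hausdorff_dist (koch_polygon n) koch_limit" for n
  proof -
    obtain a where "a \<in> koch_polygon n" using koch_polygon_nonempty by blast
    then have "infdist a koch_limit \<le> hausdorff_dist (koch_polygon n) koch_limit"
      by (intro hausdorff_dist_bound(1) compact_koch_polygon compact_koch_limit koch_polygon_nonempty koch_limit_nonempty)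
    then show ?thesis using infdist_nonneg[of a koch_limit] by linarith
  qed
  then show "\<forall>\<^sub>F n in sequentially. 0 \<le> hausdorff_dist (koch_polygon n) koch_limit" by simp
  have "hausdorff_dist (koch_polygon n) koch_limit \<le> (1/3)^n" for n
    unfolding hausdorff_dist_def
  proof (intro max.boundedI cSUP_least koch_polygon_nonempty koch_limit_nonempty)
    fix a assume "a \<in> koch_polygon n"
    then obtain e where e: "e \<in> koch_in n" "a \<in> edge_seg e" unfolding koch_polygon_eq by blast
    have "infdist a koch_limit \<le> dist a (fst e)" by (rule infdist_le[OF koch_in_vertex[OF e(1)]])
    also have "\<dots> \<le> (1/3)^n"
      using edge_cap_dist[OF inner.nondeg[OF e(1)], of a] edge_sub_subsets(9)[OF inner.nondeg[OF e(1)]] e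
        koch_in_length[OF e(1)] by auto
    finally show "infdist a koch_limit \<le> (1/3)^n" .
  next
    fix b assume "b \<in> koch_limit"
    then obtain e where e: "e \<in> koch_in n" "b \<in> edge_cap e" unfolding koch_limit_def koch_caps_def by blast
    have "infdist b (koch_polygon n) \<le> dist b (fst e)"
      by (rule infdist_le) (use edge_endpoints_seg(1)[OF inner.nondeg[OF e(1)]] e(1) koch_polygon_eq in blast)
    also have "\<dots> \<le> (1/3)^n"
      using edge_cap_dist[OF inner.nondeg[OF e(1)] e(2)] koch_in_length[OF e(1)] by auto
    finally show "infdist b (koch_polygon n) \<le> (1/3)^n" .
  qed
  then show "\<forall>\<^sub>F n in sequentially. hausdorff_dist (koch_polygon n) koch_limit \<le> (1/3)^n" by simp
  show "(\<lambda>n. (1/3::real)^n) \<longlonglongrightarrow> 0" by (rule LIMSEQ_realpow_zero) auto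
qed simp

lemma koch_curve_eq: "koch_curve = koch_limit"
  unfolding koch_curve_def
proof (rule the_equality)
  show "compact koch_limit \<and> koch_limit \<noteq> {} \<and> (\<lambda>n. hausdorff_dist (koch_polygon n) koch_limit) \<longlonglongrightarrow> 0"
    using compact_koch_limit koch_limit_nonempty koch_hausdorff_limit by blast
next
  fix C assume "compact C \<and> C \<noteq> {} \<and> (\<lambda>n. hausdorff_dist (koch_polygon n) C) \<longlonglongrightarrow> 0"
  then show "C = koch_limit"
    using hausdorff_limit_subset[where P=koch_polygon, OF _ _ _ _ compact_koch_polygon koch_polygon_nonempty]
      compact_koch_limit koch_limit_nonempty koch_hausdorff_limit by (intro equalityI) blast+
qed

lemma inner_region_subset: "inner.region \<subseteq> koch_hexagon"
  using koch_regions_disjoint unfolding outer.region_def by blast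

text \<open>Two disjoint nonempty connected open sets whose union is the complement of the curve
  must be its components. The outer one is unbounded because it contains the complement of the
  hexagon.\<close>

lemma koch_domain_eq: "koch_domain = inner.region"
  unfolding koch_domain_def
proof (rule the_equality)
  have max: "C \<in> components (- koch_curve)"
    if "C = inner.region \<or> C = outer.region" for C
  proof -
    have *: "A \<in> components (- koch_curve)" if A: "open A" "open B" "connected A" "A \<noteq> {}" "A \<inter> B = {}" "- koch_curve = A \<union> B" for A B
      unfolding in_components_maximal
    proof (intro conjI allI impI)
      fix d assume d: "d \<noteq> {} \<and> A \<subseteq> d \<and> d \<subseteq> - koch_curve \<and> connected d"
      then have "A \<inter> d = {} \<or> B \<inter> d = {}"
        using connectedD[of d A B] A by auto
      then show "d = A" using d A by blast
    qed (use A in auto)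
    have "inner.region \<in> components (- koch_curve)"
      by (rule *[OF inner.open_region outer.open_region inner.connected_region inner.region_nonempty koch_regions_disjoint])
        (simp add: koch_curve_eq koch_limit_compl)
    moreover have "outer.region \<in> components (- koch_curve)"
      by (rule *[OF outer.open_region inner.open_region outer.connected_region outer.region_nonempty])
        (use koch_regions_disjoint in \<open>auto simp: koch_curve_eq koch_limit_compl\<close>)
    ultimately show ?thesis using that by blast
  qed
  show "inner.region \<in> components (- koch_curve) \<and> bounded inner.region"
    using max bounded_subset[OF bounded_koch_hexagon inner_region_subset] by blast
  have unb: "\<not> bounded outer.region"
  proof
    assume "bounded outer.region"
    then have "bounded (- koch_hexagon)" by (rule bounded_subset) (auto simp: outer.region_def)
    then show False using cobounded_imp_unbounded[of "- koch_hexagon"] bounded_koch_hexagon by simp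
  qed
  fix U assume U: "U \<in> components (- koch_curve) \<and> bounded U"
  then have "U \<noteq> {}" "U \<subseteq> inner.region \<union> outer.region"
    using in_components_nonempty in_components_subset koch_limit_compl koch_curve_eq by blast+
  then have "U \<inter> inner.region \<noteq> {} \<or> U \<inter> outer.region \<noteq> {}" by blast
  then have "U = inner.region \<or> U = outer.region"
    using components_eq[of U "- koch_curve"] max U by blast
  then show "U = inner.region" using unb U by blast
qed

lemma open_koch_domain [simp]: "open koch_domain"
  and bounded_koch_domain [simp]: "bounded koch_domain"
  and koch_domain_nonempty: "koch_domain \<noteq> {}"
  unfolding koch_domain_eq using inner.open_region bounded_subset[OF bounded_koch_hexagon inner_region_subset]
    inner.region_nonempty by blast+

text \<open>A segment is connected and cannot be split between the two open regions. This turns any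
  pair of points on different sides into membership in a neighbourhood of the curve, whose area is
  controlled.\<close>

lemma segment_meets_koch_curve:
  assumes "x \<in> koch_domain" "y \<notin> koch_domain"
  shows "\<exists>c\<in>koch_curve. c \<in> closed_segment x y"
proof (rule ccontr)
  assume "\<not> ?thesis"
  then have sub: "closed_segment x y \<subseteq> inner.region \<union> outer.region"
    using koch_limit_compl koch_curve_eq by blast
  then have "inner.region \<inter> closed_segment x y = {} \<or> outer.region \<inter> closed_segment x y = {}"
    using connectedD[OF connected_segment(1) inner.open_region outer.open_region, of x y] koch_regions_disjoint by auto
  moreover have "y \<in> outer.region" using sub assms(2) unfolding koch_domain_eq by auto
  ultimately show False using assms unfolding koch_domain_eq by auto
qed

text \<open>Four new edges per edge are distinct by their coordinates. Different parents share no
  child because the open cap of a child is nonempty and would lie in two disjoint open caps.\<close>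

lemma card_koch_in: "card (koch_in n) = 3 * 4 ^ n"
proof (induction n)
  case 0
  have "cis (pi/3) \<noteq> 0" "cis (pi/3) \<noteq> 1" by (auto simp: cis_pi3 complex_eq_iff)
  then show ?case by (simp add: koch_in_0)
next
  case (Suc n)
  have c4: "card (koch_subs e) = 4" if e: "e \<in> koch_in n" for e
  proof -
    note nd = inner.nondeg[OF e]
    note c = edge_coords_sub[OF nd]
    obtain z where z: "edge_x e z = 0" "edge_h e z = 0" using edge_point[OF nd, of 0 0] by blast
    obtain w where w: "edge_x e w = 1" "edge_h e w = 0" using edge_point[OF nd, of 1 0] by blast
    \<comment> \<open>Coordinates of the two end points of \<open>e\<close> relative to the new
      edges are enough to tell these edges apart.\<close>
    have x: "edge_x (koch_sub1 e) z = 0" "edge_x (koch_sub2 e) z = -1/2" "edge_x (koch_sub3 e) z = 0"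
      "edge_x (koch_sub4 e) z = -2" "edge_x (koch_sub1 e) w = 3" "edge_x (koch_sub3 e) w = 3/2"
      unfolding c z w by simp_all
    have "koch_sub1 e \<noteq> koch_sub2 e" "koch_sub1 e \<noteq> koch_sub3 e" "koch_sub1 e \<noteq> koch_sub4 e"
      "koch_sub2 e \<noteq> koch_sub3 e" "koch_sub2 e \<noteq> koch_sub4 e" "koch_sub3 e \<noteq> koch_sub4 e"
    proof -
      show "koch_sub1 e \<noteq> koch_sub2 e" using x(1,2) by auto
      show "koch_sub1 e \<noteq> koch_sub3 e" using x(5,6) by auto
      show "koch_sub1 e \<noteq> koch_sub4 e" using x(1,4) by auto
      show "koch_sub2 e \<noteq> koch_sub3 e" using x(2,3) by auto
      show "koch_sub2 e \<noteq> koch_sub4 e" using x(2,4) by auto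
      show "koch_sub3 e \<noteq> koch_sub4 e" using x(3,4) by auto
    qed
    then show ?thesis unfolding koch_subs_def by simp
  qed
  have "card (koch_in (Suc n)) = (\<Sum>e\<in>koch_in n. card (koch_subs e))"
    unfolding koch_in_Suc
  proof (rule card_UN_disjoint[OF koch_in_finite])
    show "\<forall>e\<in>koch_in n. finite (koch_subs e)" by (simp add: koch_subs_def)
    have "False" if a: "e \<in> koch_in n" "e' \<in> koch_in n" "e \<noteq> e'" "c \<in> koch_subs e" "c \<in> koch_subs e'" for e e' c
    proof -
      have "c \<in> koch_in (Suc n)" using a unfolding koch_in_Suc by blast
      then have "edge_cap_int c \<noteq> {}"
        using edge_mid_int_nonempty edge_sub_subsets(4) inner.nondeg by blast
      then show False
        using koch_cap_int_disjoint[OF a(1-3)] edge_sub_subsets(2)[OF inner.nondeg[OF a(1)] a(4)]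
          edge_sub_subsets(2)[OF inner.nondeg[OF a(2)] a(5)] by blast
    qed
    then show "\<forall>e\<in>koch_in n. \<forall>e'\<in>koch_in n. e \<noteq> e' \<longrightarrow> koch_subs e \<inter> koch_subs e' = {}" by blast
  qed
  also have "\<dots> = 3 * 4 ^ Suc n" using c4 Suc by simp
  finally show ?case .
qed

text \<open>The codimension 2 - d of the curve: neighbourhoods of radius r have area of order r to
  this power. At powers of 3 its values are the rational numbers (4/9)^n.\<close>

definition koch_codim :: real where "koch_codim = 2 - log 3 4"

lemma powr_koch_codim: "3 powr koch_codim = 9/4" "((1/3) ^ n) powr koch_codim = (4/9) ^ n"
proof -
  show 1: "3 powr koch_codim = 9/4" by (simp add: koch_codim_def powr_diff)
  have "((1/3::real) ^ n) powr koch_codim = inverse (3 powr koch_codim) ^ n"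
    by (induction n) (simp_all add: powr_mult powr_divide inverse_eq_divide)
  then show "((1/3) ^ n) powr koch_codim = (4/9) ^ n" by (simp add: 1)
qed

lemma koch_codim_bounds: "0 < koch_codim" "koch_codim < 1"
proof -
  have "log 3 4 < log 3 (9::real)" by simp
  also have "log 3 (9::real) = 2" using log_pow_cancel[of 3 2] by simp
  finally show "0 < koch_codim" by (simp add: koch_codim_def)
  have "1 < log 3 (4::real)" by (subst less_log_iff) auto
  then show "koch_codim < 1" by (simp add: koch_codim_def)
qed

section \<open>Area of neighbourhoods of the curve\<close>

definition koch_nbhd :: "real \<Rightarrow> complex set" where
  "koch_nbhd r = (\<Union>c\<in>koch_curve. ball c r)"

lemma open_koch_nbhd [simp]: "open (koch_nbhd r)" unfolding koch_nbhd_def by auto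
lemma koch_nbhd_borel [measurable]: "koch_nbhd r \<in> sets borel" by simp
lemma koch_domain_borel [measurable]: "koch_domain \<in> sets borel" by simp

lemma emeasure_complex_ball: "r \<ge> 0 \<Longrightarrow> emeasure lborel (ball (c::complex) r) = ennreal (pi * r\<^sup>2)"
  by (simp add: emeasure_ball unit_ball_vol_2)

lemma triadic_scale:
  assumes "0 < r" "r \<le> (1::real)"
  obtains n where "(1/3) ^ Suc n < r" "r \<le> (1/3) ^ n"
proof -
  define n where "n = (LEAST n. (1/3::real) ^ Suc n < r)"
  have ex: "\<exists>n. (1/3::real) ^ Suc n < r"
  proof -
    obtain m where "(1/3::real) ^ m < r" using real_arch_pow_inv[of r "1/3"] assms by auto
    then have "(1/3::real) ^ Suc m < r" using assms by simp
    then show ?thesis ..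
  qed
  have 1: "(1/3) ^ Suc n < r" unfolding n_def by (rule LeastI_ex[OF ex])
  have "r \<le> (1/3) ^ n"
  proof (cases n)
    case (Suc m)
    then have "\<not> (1/3) ^ Suc m < r" using not_less_Least[of m "\<lambda>n. (1/3::real) ^ Suc n < r"] unfolding n_def by simp
    then show ?thesis using Suc by simp
  qed (use assms in simp)
  with 1 show ?thesis by (rule that)
qed

text \<open>With 3^-(n+1) < r <= 3^-n, the 3 * 4^n balls of radius 2 * 3^-n around the vertices
  cover the neighbourhood and have total area 12 pi (4/9)^n. Since 3^-n < 3 r, this is at most 12 pi
  * 9/4 = 27 pi times the power of r.\<close>

lemma koch_nbhd_area_le1:
  assumes "0 < r" "r \<le> 1"
  shows "emeasure lborel (koch_nbhd r) \<le> ennreal (27 * pi * r powr koch_codim)"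
proof -
  obtain n where n: "(1/3) ^ Suc n < r" "r \<le> (1/3) ^ n" using triadic_scale[OF assms] .
  have "koch_nbhd r \<subseteq> (\<Union>e\<in>koch_in n. ball (fst e) (2 * (1/3) ^ n))"
  proof
    fix z assume "z \<in> koch_nbhd r"
    then obtain c where c: "c \<in> koch_limit" "dist c z < r" unfolding koch_nbhd_def koch_curve_eq by auto
    then obtain e where e: "e \<in> koch_in n" "c \<in> edge_cap e" unfolding koch_limit_def koch_caps_def by blast
    have "dist c (fst e) \<le> (1/3)^n" using edge_cap_dist[OF inner.nondeg[OF e(1)] e(2)] koch_in_length[OF e(1)] by simp
    then have "dist (fst e) z < 2 * (1/3)^n" using c n dist_triangle[of "fst e" z c] by (simp add: dist_commute)
    then show "z \<in> (\<Union>e\<in>koch_in n. ball (fst e) (2 * (1/3) ^ n))" using e by auto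
  qed
  then have "emeasure lborel (koch_nbhd r) \<le> emeasure lborel (\<Union>e\<in>koch_in n. ball (fst e) (2 * (1/3) ^ n))"
    by (intro emeasure_mono) (auto intro!: borel_open)
  also have "\<dots> \<le> (\<Sum>e\<in>koch_in n. emeasure lborel (ball (fst e) (2 * (1/3) ^ n)))"
    by (rule emeasure_subadditive_finite) (auto simp: koch_in_finite)
  also have "\<dots> = ennreal (12 * pi * (4/9) ^ n)"
  proof -
    have "real (3 * 4 ^ n) * (pi * (2 * (1/3) ^ n)\<^sup>2) = 12 * pi * (4 ^ n * ((1/3) ^ n)\<^sup>2)"
      by (simp add: power_mult_distrib)
    also have "4 ^ n * ((1/3) ^ n)\<^sup>2 = (4/9::real) ^ n"
      by (simp add: power2_eq_square flip: power_mult_distrib)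
    finally show ?thesis
      by (simp add: emeasure_complex_ball card_koch_in ennreal_of_nat_eq_real_of_nat flip: ennreal_mult)
  qed
  also have "(4/9) ^ n \<le> (3 * r) powr koch_codim"
    unfolding powr_koch_codim(2)[symmetric] using n koch_codim_bounds by (intro powr_mono2) auto
  also have "\<dots> = 9/4 * r powr koch_codim"
    using assms by (simp add: powr_mult powr_koch_codim)
  finally show ?thesis by (simp add: ennreal_leI mult_left_mono mult.assoc)
qed

text \<open>For few points or strongly shrunken copies the relevant radii exceed 1. There the
  neighbourhood is simply enclosed in a fixed ball, while the power of r is at least 1.\<close>

lemma koch_nbhd_area:
  obtains K where "K > 0" "\<And>r. 0 < r \<Longrightarrow> r \<le> \<rho> \<Longrightarrow> emeasure lborel (koch_nbhd r) \<le> ennreal (K * r powr koch_codim)"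
proof
  define q where "q = max 1 \<rho>"
  show "27 * pi + pi * (4 * q)\<^sup>2 > 0" using pi_gt_zero by (intro add_pos_nonneg) auto
  fix r assume r: "0 < r" "r \<le> \<rho>"
  show "emeasure lborel (koch_nbhd r) \<le> ennreal ((27 * pi + pi * (4 * q)\<^sup>2) * r powr koch_codim)"
  proof (cases "r \<le> 1")
    case True
    have "27 * pi * r powr koch_codim \<le> (27 * pi + pi * (4 * q)\<^sup>2) * r powr koch_codim"
      by (intro mult_right_mono) auto
    show ?thesis by (rule order_trans[OF koch_nbhd_area_le1[OF r(1) True] ennreal_leI]) fact
  next
    case False
    have "koch_nbhd r \<subseteq> ball 0 (4 * q)"
    proof
      fix z assume "z \<in> koch_nbhd r"
      then obtain c where c: "c \<in> koch_limit" "dist c z < r" unfolding koch_nbhd_def koch_curve_eq by auto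
      have "cmod z \<le> cmod c + dist c z" using norm_triangle_ineq[of c "z - c"] by (simp add: dist_norm norm_minus_commute)
      then show "z \<in> ball 0 (4 * q)" using c koch_limit_norm[of c] r False by (simp add: q_def)
    qed
    then have "emeasure lborel (koch_nbhd r) \<le> emeasure lborel (ball 0 (4 * q) :: complex set)"
      by (intro emeasure_mono) auto
    also have "\<dots> = ennreal (pi * (4 * q)\<^sup>2 * 1)" by (subst emeasure_complex_ball) (auto simp: q_def)
    also have "\<dots> \<le> ennreal ((27 * pi + pi * (4 * q)\<^sup>2) * r powr koch_codim)"
      using False koch_codim_bounds by (intro ennreal_leI mult_mono ge_one_powr_ge_zero) auto
    finally show ?thesis .
  qed
qed

section \<open>Areas of the inner and outer triangles of a given level\<close>

lemma emeasure_edge_mid_int: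
  assumes "snd e \<noteq> fst e"
  shows "emeasure lborel (edge_mid_int e) = ennreal ((cmod (snd e - fst e))\<^sup>2) * emeasure lborel (edge_mid_int (0, 1))"
proof -
  define D where "D = snd e - fst e"
  have D: "D \<noteq> 0" using assms by (simp add: D_def)
  have m[measurable]: "edge_mid_int e \<in> sets borel" "edge_mid_int (0,1) \<in> sets borel" using open_edge_sets(3) by auto
  have i: "indicator (edge_mid_int e) (fst e + D * w) = (indicator (edge_mid_int (0,1)) w :: ennreal)" for w
    using D unfolding indicator_def edge_mid_int_def edge_x_def edge_h_def D_def by simp
  have "emeasure lborel (edge_mid_int e) = (\<integral>\<^sup>+z. indicator (edge_mid_int e) z \<partial>lborel)" by simp
  also have "\<dots> = (\<integral>\<^sup>+z. indicator (edge_mid_int e) (fst e + z) \<partial>lborel)"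
    by (rule nn_integral_lborel_translate[symmetric]) simp
  also have "\<dots> = ennreal ((cmod D)\<^sup>2) * (\<integral>\<^sup>+w. indicator (edge_mid_int e) (fst e + D * w) \<partial>lborel)"
    by (rule nn_integral_complex_mult[OF _ D]) simp
  also have "(\<integral>\<^sup>+w. indicator (edge_mid_int e) (fst e + D * w) \<partial>lborel) = emeasure lborel (edge_mid_int (0,1))"
    unfolding i by simp
  finally show ?thesis by (simp add: D_def)
qed

lemma cap_side1_length: "cmod (snd (cap_side1 e) - fst (cap_side1 e)) = cmod (snd e - fst e) / sqrt 3"
proof -
  have eq: "snd (cap_side1 e) - fst (cap_side1 e) = (snd e - fst e) * Complex (-1/2) (sqrt 3 / 6)"
    unfolding cap_side1_def koch_sub2_def cis_minus_pi3 by (simp add: complex_eq_iff field_simps)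
  have "(cmod (Complex (-1/2) (sqrt 3 / 6)))\<^sup>2 = (1 / sqrt 3)\<^sup>2" by (simp add: cmod_power2 power_divide)
  then have "cmod (Complex (-1/2) (sqrt 3 / 6)) = 1 / sqrt 3" by (simp add: power2_eq_iff_nonneg)
  then show ?thesis unfolding eq by (simp add: norm_mult)
qed

text \<open>The data for the lower bound on heat content: every edge carries one triangle inside and
  one outside the domain, of areas comparable to 9^-n and at distance at most 2 * 3^-n, and the
  inner ones are disjoint.\<close>

lemma koch_in_mid:
  assumes "e \<in> koch_in n"
  shows "edge_mid_int e \<subseteq> koch_domain" "edge_mid_int (cap_side1 e) \<inter> koch_domain = {}"
    "x \<in> edge_mid_int e \<Longrightarrow> y \<in> edge_mid_int (cap_side1 e) \<Longrightarrow> dist x y \<le> 2 * (1/3)^n"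
    "emeasure lborel (edge_mid_int e) = ennreal ((1/9)^n) * emeasure lborel (edge_mid_int (0, 1))"
    "emeasure lborel (edge_mid_int (cap_side1 e)) = ennreal ((1/9)^n / 3) * emeasure lborel (edge_mid_int (0, 1))"
    "e' \<in> koch_in n \<Longrightarrow> e \<noteq> e' \<Longrightarrow> edge_mid_int e \<inter> edge_mid_int e' = {}"
proof -
  note nd = inner.nondeg[OF assms]
  show "edge_mid_int e \<subseteq> koch_domain"
    using assms inner.core_subset_region unfolding koch_domain_eq inner.core_def by blast
  have "edge_mid_int (cap_side1 e) \<subseteq> outer.region"
    using assms outer.core_subset_region unfolding outer.core_def koch_out_def by blast
  then show "edge_mid_int (cap_side1 e) \<inter> koch_domain = {}"
    using koch_regions_disjoint unfolding koch_domain_eq by blast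
  show "dist x y \<le> 2 * (1/3)^n" if "x \<in> edge_mid_int e" "y \<in> edge_mid_int (cap_side1 e)"
  proof -
    have "x \<in> edge_cap e" "y \<in> edge_cap e"
      using that edge_sub_subsets(4,5)[OF nd] edge_cap_int_subset by blast+
    then have "dist x (fst e) \<le> (1/3)^n" "dist y (fst e) \<le> (1/3)^n"
      using edge_cap_dist[OF nd] koch_in_length[OF assms] by auto
    then show ?thesis using dist_triangle2[of x y "fst e"] by simp
  qed
  have sq: "((1/3::real)^n)\<^sup>2 = (1/9)^n" by (simp add: power2_eq_square flip: power_mult_distrib)
  show "emeasure lborel (edge_mid_int e) = ennreal ((1/9)^n) * emeasure lborel (edge_mid_int (0, 1))"
    by (subst emeasure_edge_mid_int[OF nd]) (simp add: koch_in_length[OF assms] sq)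
  show "emeasure lborel (edge_mid_int (cap_side1 e)) = ennreal ((1/9)^n / 3) * emeasure lborel (edge_mid_int (0, 1))"
    by (subst emeasure_edge_mid_int[OF edge_coords_sub(17)[OF nd]])
      (simp add: cap_side1_length koch_in_length[OF assms] power_divide[of _ "sqrt 3"] sq)
  show "edge_mid_int e \<inter> edge_mid_int e' = {}" if "e' \<in> koch_in n" "e \<noteq> e'"
    using koch_cap_int_disjoint[OF assms that] edge_sub_subsets(4)[OF nd]
      edge_sub_subsets(4)[OF inner.nondeg[OF that(1)]] by blast
qed

lemma emeasure_open_pos:
  assumes "open (A::complex set)" "A \<noteq> {}"
  shows "emeasure lborel A > 0"
proof -
  obtain x r where r: "r > 0" "ball x r \<subseteq> A" using assms open_contains_ball by blast
  have "0 < ennreal (pi * r\<^sup>2)" using r by simp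
  also have "\<dots> = emeasure lborel (ball x r)" using r by (simp add: emeasure_complex_ball)
  also have "\<dots> \<le> emeasure lborel A" by (rule emeasure_mono) (use r assms in auto)
  finally show ?thesis .
qed

lemma emeasure_koch_domain: "0 < emeasure lborel koch_domain" "emeasure lborel koch_domain < \<infinity>"
  using emeasure_open_pos[OF open_koch_domain koch_domain_nonempty]
    emeasure_bounded_finite[OF bounded_koch_domain] by simp_all

section \<open>Fourier transforms tested against Gaussians\<close>

text \<open>The parameter is the reciprocal of the standard deviation: larger \<open>s\<close> means
  a narrower function, and the transform of \<open>gauss s\<close> is a multiple of
  \<open>gauss (1/s)\<close>.\<close>

definition gauss :: "real \<Rightarrow> complex \<Rightarrow> real" where
  "gauss s y = exp (-(s\<^sup>2 * (cmod y)\<^sup>2 / 2))"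

lemma gauss_measurable [measurable]: "gauss s \<in> borel_measurable borel"
  unfolding gauss_def by measurable

lemma gauss_pos [simp]: "0 < gauss s y" and gauss_nonneg [simp]: "0 \<le> gauss s y"
  and gauss_le_1: "gauss s y \<le> 1"
  by (simp_all add: gauss_def)

lemma gauss_antimono: "0 \<le> s \<Longrightarrow> s \<le> t \<Longrightarrow> gauss t y \<le> gauss s y"
  unfolding gauss_def by (auto intro!: mult_right_mono power_mono)

lemma gauss_FT:
  assumes "s > 0"
  shows "integrable lborel (\<lambda>y. cis (x \<bullet> y) * of_real (gauss s y))"
    and "(LINT y|lborel. cis (x \<bullet> y) * of_real (gauss s y)) = of_real (2*pi / s\<^sup>2 * gauss (1/s) x)"
  using gaussian_FT_complex[OF assms, of x] by (simp_all add: gauss_def power_divide)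

lemma gauss_integrable [intro]:
  assumes "s > 0"
  shows "integrable lborel (gauss s)"
proof -
  have "integrable lborel (\<lambda>y. complex_of_real (gauss s y))" using gauss_FT(1)[OF assms, of 0] by simp
  then show ?thesis by (simp add: complex_of_real_integrable_eq)
qed

lemma gauss_integral:
  assumes "s > 0"
  shows "(LINT y|lborel. gauss s y) = 2*pi / s\<^sup>2"
proof -
  have "complex_of_real (LINT y|lborel. gauss s y) = of_real (2*pi / s\<^sup>2)"
    using gauss_FT(2)[OF assms, of 0] by (simp add: gauss_def)
  then show ?thesis by (simp only: of_real_eq_iff)
qed

lemma gauss_nn_integral:
  assumes "s > 0"
  shows "(\<integral>\<^sup>+y. ennreal (gauss s y) \<partial>lborel) = ennreal (2*pi / s\<^sup>2)"
  using nn_integral_eq_integral[OF gauss_integrable[OF assms]] gauss_integral[OF assms] by simp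

lemma gauss_nn_integral_shift:
  assumes "s > 0"
  shows "(\<integral>\<^sup>+y. ennreal (gauss s (y - x)) \<partial>lborel) = ennreal (2*pi / s\<^sup>2)"
  using nn_integral_lborel_translate[of "\<lambda>y. ennreal (gauss s y)" "-x"] gauss_nn_integral[OF assms] by simp

text \<open>A bounded kernel is dominated by the product of the two integrable factors. The kernel
  will be an exponential in the Gaussian identities and a translated shape in the convolution
  formula.\<close>

lemma Fubini_bounded_kernel:
  fixes f :: "complex \<Rightarrow> real" and k :: "complex \<Rightarrow> complex" and E :: "complex \<Rightarrow> complex \<Rightarrow> complex"
  assumes f: "integrable lborel f" and k: "integrable lborel k"
    and E[measurable]: "(\<lambda>(x, y). E x y) \<in> borel_measurable (borel \<Otimes>\<^sub>M borel)" and E1: "\<And>x y. cmod (E x y) \<le> 1"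
  shows "(LINT y|lborel. k y * (LINT x|lborel. f x *\<^sub>R E x y)) = (LINT x|lborel. f x *\<^sub>R (LINT y|lborel. k y * E x y))"
proof -
  note [measurable] = borel_measurable_integrable[OF f] borel_measurable_integrable[OF k]
  have i: "integrable (lborel \<Otimes>\<^sub>M lborel) (\<lambda>(x, y). f x *\<^sub>R (k y * E x y))"
  proof (rule lborel_pair.Fubini_integrable)
    have bd: "norm (f x *\<^sub>R (k y * E x y)) \<le> \<bar>f x\<bar> * cmod (k y)" for x y
      using E1[of x y] by (simp add: norm_mult mult_left_le mult_left_mono)
    have ki: "integrable lborel (\<lambda>y. f x *\<^sub>R (k y * E x y))" for x
      by (rule Bochner_Integration.integrable_bound[OF integrable_mult_right[OF integrable_norm[OF k], of "\<bar>f x\<bar>"]])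
        (use bd in auto)
    show "AE x in lborel. integrable lborel (\<lambda>y. case (x, y) of (x, y) \<Rightarrow> f x *\<^sub>R (k y * E x y))"
      using ki by simp
    show "integrable lborel (\<lambda>x. LINT y|lborel. norm (case (x, y) of (x, y) \<Rightarrow> f x *\<^sub>R (k y * E x y)))"
    proof (rule Bochner_Integration.integrable_bound[OF integrable_mult_left[OF integrable_norm[OF f], of "LINT y|lborel. cmod (k y)"]])
      show "AE x in lborel. norm (LINT y|lborel. norm (case (x, y) of (x, y) \<Rightarrow> f x *\<^sub>R (k y * E x y)))
          \<le> norm (norm (f x) * (LINT y|lborel. cmod (k y)))"
      proof (rule AE_I2)
        fix x
        have "(LINT y|lborel. norm (f x *\<^sub>R (k y * E x y))) \<le> (LINT y|lborel. \<bar>f x\<bar> * cmod (k y))"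
          by (rule integral_mono[OF integrable_norm[OF ki] integrable_mult_right[OF integrable_norm[OF k]]]) (rule bd)
        also have "\<dots> = \<bar>f x\<bar> * (LINT y|lborel. cmod (k y))" by simp
        finally show "norm (LINT y|lborel. norm (case (x, y) of (x, y) \<Rightarrow> f x *\<^sub>R (k y * E x y)))
          \<le> norm (norm (f x) * (LINT y|lborel. cmod (k y)))"
          by (simp only: prod.case) (auto simp: abs_mult intro!: integral_nonneg_AE)
      qed
    qed measurable
  qed measurable
  have "(LINT y|lborel. k y * (LINT x|lborel. f x *\<^sub>R E x y)) = (LINT y|lborel. LINT x|lborel. f x *\<^sub>R (k y * E x y))"
    by (simp only: integral_mult_right_zero[symmetric] mult_scaleR_right)
  also have "\<dots> = (LINT x|lborel. LINT y|lborel. f x *\<^sub>R (k y * E x y))"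
    using lborel_pair.Fubini_integral[OF i] by simp
  also have "\<dots> = (LINT x|lborel. f x *\<^sub>R (LINT y|lborel. k y * E x y))" by simp
  finally show ?thesis .
qed

text \<open>Positive sign and no normalising factor, as for characteristic functions; this is the
  source of the constants 2 pi / s^2 and 4 pi^2 below.\<close>

definition FT :: "(complex \<Rightarrow> real) \<Rightarrow> complex \<Rightarrow> complex" where
  "FT f y = (LINT x|lborel. f x *\<^sub>R cis (x \<bullet> y))"

lemma FT_measurable [measurable]:
  assumes [measurable]: "f \<in> borel_measurable borel"
  shows "FT f \<in> borel_measurable borel"
  unfolding FT_def by measurable

lemma FT_integrable:
  assumes f: "integrable lborel f"
  shows "integrable lborel (\<lambda>x. f x *\<^sub>R cis (x \<bullet> y))"
proof -
  note [measurable] = borel_measurable_integrable[OF f]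
  show ?thesis by (rule Bochner_Integration.integrable_bound[OF f]) auto
qed

lemma FT_bound:
  assumes f: "integrable lborel f"
  shows "cmod (FT f y) \<le> (LINT x|lborel. \<bar>f x\<bar>)"
proof -
  have "cmod (FT f y) \<le> (LINT x|lborel. norm (f x *\<^sub>R cis (x \<bullet> y)))"
    unfolding FT_def by (rule integral_norm_bound)
  then show ?thesis by simp
qed

lemma integrable_FT_gauss:
  assumes f: "integrable lborel f" and s: "s > 0"
  shows "integrable lborel (\<lambda>y. (cmod (FT f y))\<^sup>2 * gauss s y)"
proof -
  note [measurable] = borel_measurable_integrable[OF f]
  let ?I = "LINT x|lborel. \<bar>f x\<bar>"
  show ?thesis
  proof (rule Bochner_Integration.integrable_bound[OF integrable_mult_right[OF gauss_integrable[OF s], of "?I\<^sup>2"]])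
    show "AE y in lborel. norm ((cmod (FT f y))\<^sup>2 * gauss s y) \<le> norm (?I\<^sup>2 * gauss s y)"
      by (auto simp: abs_mult intro!: mult_right_mono power_mono FT_bound[OF f])
  qed measurable
qed

text \<open>Inversion with a convergence factor: after Fubini the inner integral is the transform of
  \<open>gauss s\<close>, so the damped inverse transform is a multiple of the smoothing of
  \<open>f\<close> at scale \<open>s\<close>.\<close>

lemma FT_gauss_inversion:
  assumes f: "integrable lborel f" and s: "s > 0"
  shows "(LINT z|lborel. (cis (-(y \<bullet> z)) * of_real (gauss s z)) * FT f z)
    = of_real (2*pi/s\<^sup>2 * (LINT x|lborel. f x * gauss (1/s) (x - y)))"
proof -
  have k: "integrable lborel (\<lambda>z. cis (-(y \<bullet> z)) * complex_of_real (gauss s z))"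
    using gauss_FT(1)[OF s, of "-y"] by simp
  have "(LINT z|lborel. (cis (-(y \<bullet> z)) * of_real (gauss s z)) * FT f z)
    = (LINT x|lborel. f x *\<^sub>R (LINT z|lborel. (cis (-(y \<bullet> z)) * of_real (gauss s z)) * cis (x \<bullet> z)))"
    unfolding FT_def by (rule Fubini_bounded_kernel[OF f k]) auto
  also have "\<dots> = (LINT x|lborel. f x *\<^sub>R (LINT z|lborel. cis ((x - y) \<bullet> z) * of_real (gauss s z)))"
  proof -
    have "(cis (-(y \<bullet> z)) * complex_of_real (gauss s z)) * cis (x \<bullet> z) = cis ((x - y) \<bullet> z) * of_real (gauss s z)" for x z
    proof -
      have "cis (-(y \<bullet> z)) * cis (x \<bullet> z) = cis ((x - y) \<bullet> z)" by (simp add: inner_diff_left cis_mult)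
      then show ?thesis by (metis mult.assoc mult.commute)
    qed
    then show ?thesis by (simp only:)
  qed
  also have "\<dots> = (LINT x|lborel. complex_of_real (2*pi/s\<^sup>2 * (f x * gauss (1/s) (x - y))))"
    unfolding gauss_FT(2)[OF s] by (simp add: scaleR_conv_of_real mult_ac)
  also have "\<dots> = of_real (2*pi/s\<^sup>2 * (LINT x|lborel. f x * gauss (1/s) (x - y)))"
    by (simp only: integral_complex_of_real integral_mult_right_zero)
  finally show ?thesis .
qed

text \<open>Write the squared modulus as the transform times its conjugate, expand only the
  conjugate as an integral, and apply the damped inversion formula under that integral.\<close>

lemma Plancherel_gauss:
  assumes f: "integrable lborel f" and s: "s > 0"
  shows "(LINT y|lborel. (cmod (FT f y))\<^sup>2 * gauss s y)
    = 2*pi / s\<^sup>2 * (LINT y|lborel. f y * (LINT x|lborel. f x * gauss (1/s) (x - y)))"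
proof -
  note [measurable] = borel_measurable_integrable[OF f]
  define I where "I = (LINT x|lborel. \<bar>f x\<bar>)"
  note step1 = FT_gauss_inversion[OF f s]
  have k2: "integrable lborel (\<lambda>z. of_real (gauss s z) * FT f z)"
  proof (rule Bochner_Integration.integrable_bound[OF integrable_mult_right[OF gauss_integrable[OF s], of I]])
    show "AE y in lborel. norm (complex_of_real (gauss s y) * FT f y) \<le> norm (I * gauss s y)"
      using FT_bound[OF f] by (auto simp: norm_mult abs_mult I_def[symmetric] mult.commute intro!: mult_right_mono order_trans[OF _ abs_ge_self])
  qed measurable
  have cnjFT: "cnj (FT f z) = (LINT y|lborel. f y *\<^sub>R cis (-(y \<bullet> z)))" for z
    unfolding FT_def by (subst Bochner_Integration.integral_cnj[symmetric]) (simp add: cis_cnj)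
  have "complex_of_real (LINT y|lborel. (cmod (FT f y))\<^sup>2 * gauss s y)
     = (LINT y|lborel. complex_of_real ((cmod (FT f y))\<^sup>2 * gauss s y))" by (rule integral_complex_of_real[symmetric])
  also have "\<dots> = (LINT z|lborel. (of_real (gauss s z) * FT f z) * (LINT y|lborel. f y *\<^sub>R cis (-(y \<bullet> z))))"
    unfolding cnjFT[symmetric] of_real_mult complex_norm_square by (simp only: mult_ac)
  also have "\<dots> = (LINT y|lborel. f y *\<^sub>R (LINT z|lborel. (of_real (gauss s z) * FT f z) * cis (-(y \<bullet> z))))"
    by (rule Fubini_bounded_kernel[OF f k2]) auto
  also have "\<dots> = (LINT y|lborel. f y *\<^sub>R of_real (2*pi/s\<^sup>2 * (LINT x|lborel. f x * gauss (1/s) (x - y))))"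
    unfolding step1[symmetric] by (simp add: mult_ac)
  also have "\<dots> = (LINT y|lborel. complex_of_real (2*pi/s\<^sup>2 * (f y * (LINT x|lborel. f x * gauss (1/s) (x - y)))))"
    by (simp add: scaleR_conv_of_real mult_ac)
  also have "\<dots> = of_real (2*pi/s\<^sup>2 * (LINT y|lborel. f y * (LINT x|lborel. f x * gauss (1/s) (x - y))))"
    by (simp only: integral_complex_of_real integral_mult_right_zero)
  finally show ?thesis by (simp only: of_real_eq_iff)
qed

section \<open>Heat content of the domain\<close>

abbreviation koch_area :: real where "koch_area \<equiv> measure lborel koch_domain"

lemma koch_area_pos: "koch_area > 0"
  using emeasure_koch_domain by (simp add: measure_def enn2real_positive_iff)

lemma emeasure_koch_domain_eq: "emeasure lborel koch_domain = ennreal koch_area"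
  using emeasure_koch_domain by (simp add: emeasure_eq_ennreal_measure)

text \<open>The amount that leaks from the domain to its complement under a Gaussian of width
  \<open>s\<close>. The kernel is not normalised and has mass 2 pi s^2, so it is
  \<open>heat s\<close> divided by s^2 that has order \<open>s powr koch_codim\<close>.\<close>

definition heat :: "real \<Rightarrow> ennreal" where
  "heat s = (\<integral>\<^sup>+y. indicator koch_domain y * (\<integral>\<^sup>+x. indicator (- koch_domain) x * ennreal (gauss (1/s) (x - y)) \<partial>lborel) \<partial>lborel)"

text \<open>If y is inside and y + u outside, the segment between them meets the curve, so y is in
  the neighbourhood of radius 2 |u|; the factor 2 makes the distance strict. The bound 27 pi
  2^\<open>koch_codim\<close> <= 54 pi covers 2 |u| <= 1; for larger u the whole area is absorbed by
  the term with \<open>koch_area\<close>.\<close>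

lemma koch_domain_shift_area:
  obtains K where "K > 0"
    "\<And>u. (\<integral>\<^sup>+y. indicator koch_domain y * indicator (- koch_domain) (u + y) \<partial>lborel) \<le> ennreal (K * (cmod u) powr koch_codim)"
proof
  show "54 * pi + 2 * koch_area > 0" using koch_area_pos pi_gt_zero by (intro add_pos_pos) auto
  fix u :: complex
  have 2: "2 powr koch_codim \<le> (2::real)" using powr_mono[of koch_codim 1 2] koch_codim_bounds by simp
  show "(\<integral>\<^sup>+y. indicator koch_domain y * indicator (- koch_domain) (u + y) \<partial>lborel) \<le> ennreal ((54 * pi + 2 * koch_area) * (cmod u) powr koch_codim)"
  proof (cases "u = 0")
    case True
    then have "(\<integral>\<^sup>+y. indicator koch_domain y * indicator (- koch_domain) (u + y) \<partial>lborel) = (\<integral>\<^sup>+(y::complex). (0::ennreal) \<partial>lborel)"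
      by (intro nn_integral_cong) (auto simp: indicator_def)
    then show ?thesis by simp
  next
    case False
    show ?thesis
    proof (cases "2 * cmod u \<le> 1")
      case True
      have "(\<integral>\<^sup>+y. indicator koch_domain y * indicator (- koch_domain) (u + y) \<partial>lborel) \<le> (\<integral>\<^sup>+y. indicator (koch_nbhd (2 * cmod u)) y \<partial>lborel)"
      proof (rule nn_integral_mono)
        fix y
        have "y \<in> koch_nbhd (2 * cmod u)" if y: "y \<in> koch_domain" "u + y \<notin> koch_domain"
        proof -
          obtain c where c: "c \<in> koch_curve" "c \<in> closed_segment y (u + y)" using segment_meets_koch_curve[OF y] by blast
          have "dist c y \<le> cmod u" using dist_in_closed_segment[OF c(2)] by (simp add: dist_norm)
          also have "cmod u < 2 * cmod u" using False by simp
          finally show ?thesis using c(1) unfolding koch_nbhd_def by auto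
        qed
        then show "indicator koch_domain y * indicator (- koch_domain) (u + y) \<le> (indicator (koch_nbhd (2 * cmod u)) y :: ennreal)"
          by (auto simp: indicator_def)
      qed
      also have "\<dots> = emeasure lborel (koch_nbhd (2 * cmod u))" by simp
      also have "\<dots> \<le> ennreal (27 * pi * (2 * cmod u) powr koch_codim)"
        by (rule koch_nbhd_area_le1) (use True False in auto)
      also have "\<dots> \<le> ennreal ((54 * pi + 2 * koch_area) * (cmod u) powr koch_codim)"
      proof (rule ennreal_leI)
        have "27 * pi * (2 * cmod u) powr koch_codim = 27 * pi * 2 powr koch_codim * (cmod u) powr koch_codim"
          by (simp add: powr_mult)
        also have "\<dots> \<le> (54 * pi + 2 * koch_area) * (cmod u) powr koch_codim"
        proof (rule mult_right_mono)
          have "27 * pi * 2 powr koch_codim \<le> 27 * pi * 2" by (rule mult_left_mono[OF 2]) simp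
          then show "27 * pi * 2 powr koch_codim \<le> 54 * pi + 2 * koch_area" using koch_area_pos by linarith
        qed simp
        finally show "27 * pi * (2 * cmod u) powr koch_codim \<le> (54 * pi + 2 * koch_area) * (cmod u) powr koch_codim" .
      qed
      finally show ?thesis .
    next
      case big: False
      have "(\<integral>\<^sup>+y. indicator koch_domain y * indicator (- koch_domain) (u + y) \<partial>lborel) \<le> (\<integral>\<^sup>+y. indicator koch_domain y \<partial>lborel)"
        by (intro nn_integral_mono) (auto simp: indicator_def)
      also have "\<dots> = ennreal koch_area" by (simp add: emeasure_koch_domain_eq)
      also have "\<dots> \<le> ennreal ((54 * pi + 2 * koch_area) * (cmod u) powr koch_codim)"
      proof (rule ennreal_leI)
        have "1 \<le> (2 * cmod u) powr koch_codim" using big koch_codim_bounds by (intro ge_one_powr_ge_zero) auto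
        also have "\<dots> = 2 powr koch_codim * (cmod u) powr koch_codim" by (simp add: powr_mult)
        also have "\<dots> \<le> 2 * (cmod u) powr koch_codim" by (rule mult_right_mono[OF 2]) simp
        finally have "koch_area * 1 \<le> koch_area * (2 * (cmod u) powr koch_codim)"
          using koch_area_pos by (intro mult_left_mono) auto
        also have "\<dots> = (2 * koch_area) * (cmod u) powr koch_codim" by simp
        also have "\<dots> \<le> (54 * pi + 2 * koch_area) * (cmod u) powr koch_codim"
          by (rule mult_right_mono) auto
        finally show "koch_area \<le> (54 * pi + 2 * koch_area) * (cmod u) powr koch_codim" by simp
      qed
      finally show ?thesis .
    qed
  qed
qed

text \<open>With u = x - y as variable, Tonelli turns the heat content into a Gaussian average over
  u of the area lost under a shift by u. The rest is a moment estimate.\<close>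

lemma heat_upper:
  obtains C where "C > 0" "\<And>s. s > 0 \<Longrightarrow> heat s \<le> ennreal (C * s\<^sup>2 * s powr koch_codim)"
proof -
  obtain K where K: "K > 0" "\<And>u. (\<integral>\<^sup>+y. indicator koch_domain y * indicator (- koch_domain) (u + y) \<partial>lborel) \<le> ennreal (K * (cmod u) powr koch_codim)"
    using koch_domain_shift_area by blast
  have "heat s \<le> ennreal (20 * pi * K * s\<^sup>2 * s powr koch_codim)" if s: "s > 0" for s
  proof -
    have "heat s = (\<integral>\<^sup>+y. \<integral>\<^sup>+u. indicator koch_domain y * (indicator (- koch_domain) (u + y) * ennreal (gauss (1/s) u)) \<partial>lborel \<partial>lborel)"
      unfolding heat_def
    proof (rule nn_integral_cong)
      fix y
      have "(\<integral>\<^sup>+x. indicator (- koch_domain) x * ennreal (gauss (1/s) (x - y)) \<partial>lborel)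
         = (\<integral>\<^sup>+u. indicator (- koch_domain) (y + u) * ennreal (gauss (1/s) (y + u - y)) \<partial>lborel)"
        by (rule nn_integral_lborel_translate[symmetric]) measurable
      then show "indicator koch_domain y * (\<integral>\<^sup>+x. indicator (- koch_domain) x * ennreal (gauss (1/s) (x - y)) \<partial>lborel)
         = (\<integral>\<^sup>+u. indicator koch_domain y * (indicator (- koch_domain) (u + y) * ennreal (gauss (1/s) u)) \<partial>lborel)"
        by (subst nn_integral_cmult) (auto simp: add.commute)
    qed
    also have "\<dots> = (\<integral>\<^sup>+u. \<integral>\<^sup>+y. indicator koch_domain y * (indicator (- koch_domain) (u + y) * ennreal (gauss (1/s) u)) \<partial>lborel \<partial>lborel)"
      by (rule lborel_pair.Fubini') measurable
    also have "\<dots> = (\<integral>\<^sup>+u. ennreal (gauss (1/s) u) * (\<integral>\<^sup>+y. indicator koch_domain y * indicator (- koch_domain) (u + y) \<partial>lborel) \<partial>lborel)"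
      by (intro nn_integral_cong, subst nn_integral_cmult[symmetric]) (auto simp: mult_ac)
    also have "\<dots> \<le> (\<integral>\<^sup>+u. ennreal (5 * K * s powr koch_codim) * ennreal (gauss (1/(sqrt 2 * s)) u) \<partial>lborel)"
    proof (rule nn_integral_mono)
      fix u :: complex
      define t where "t = cmod u / s"
      have t0: "t \<ge> 0" using s by (simp add: t_def)
      have "(cmod u) powr koch_codim = s powr koch_codim * t powr koch_codim"
        using s by (simp add: t_def flip: powr_mult)
      also have "t powr koch_codim \<le> 1 + t\<^sup>2"
      proof (cases "t \<le> 1")
        case True
        then have "t powr koch_codim \<le> 1" using t0 koch_codim_bounds by (intro powr_le1) auto
        then show ?thesis using zero_le_power2[of t] by linarith
      next
        case False
        then have "t powr koch_codim \<le> t powr 2" using koch_codim_bounds by (intro powr_mono) auto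
        also have "t powr 2 = t\<^sup>2" using t0 by simp
        finally show ?thesis by simp
      qed
      finally have 1: "(cmod u) powr koch_codim \<le> s powr koch_codim * (1 + t\<^sup>2)" by (simp add: mult_left_mono)
      have g1: "gauss (1/s) u = exp (-(t\<^sup>2/4)) * exp (-(t\<^sup>2/4))"
        unfolding gauss_def exp_add[symmetric] by (simp add: t_def power_divide)
      have g2: "gauss (1/(sqrt 2 * s)) u = exp (-(t\<^sup>2/4))"
        unfolding gauss_def by (simp add: t_def power_divide power_mult_distrib)
      \<comment> \<open>Half of the Gaussian exponent absorbs the growth 1 + t^2 at the cost of the
        constant 5; the remaining half is a Gaussian of width sqrt 2 * s and mass 4 pi s^2, whence
        20 pi K.\<close>
      have "5 * (1 + t\<^sup>2/4) = 5 + 5/4 * t\<^sup>2" by simp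
      then have "1 + t\<^sup>2 \<le> 5 * (1 + t\<^sup>2/4)" using zero_le_power2[of t] by linarith
      also have "\<dots> \<le> 5 * exp (t\<^sup>2/4)" by (rule mult_left_mono[OF exp_ge_add_one_self]) simp
      finally have "(1 + t\<^sup>2) * exp (-(t\<^sup>2/4)) \<le> 5" by (simp add: exp_minus field_simps)
      then have "(1 + t\<^sup>2) * gauss (1/s) u \<le> 5 * gauss (1/(sqrt 2 * s)) u"
        unfolding g1 g2 mult.assoc[symmetric] by (rule mult_right_mono) simp
      then have "(K * s powr koch_codim) * ((1 + t\<^sup>2) * gauss (1/s) u) \<le> (K * s powr koch_codim) * (5 * gauss (1/(sqrt 2 * s)) u)"
        using K by (intro mult_left_mono) auto
      moreover have "gauss (1/s) u * (K * (cmod u) powr koch_codim) \<le> gauss (1/s) u * (K * (s powr koch_codim * (1 + t\<^sup>2)))"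
        using 1 K by (intro mult_left_mono) auto
      ultimately have "gauss (1/s) u * (K * (cmod u) powr koch_codim) \<le> 5 * K * s powr koch_codim * gauss (1/(sqrt 2 * s)) u"
        by (simp add: mult_ac)
      then have "ennreal (gauss (1/s) u) * ennreal (K * (cmod u) powr koch_codim) \<le> ennreal (5 * K * s powr koch_codim) * ennreal (gauss (1/(sqrt 2 * s)) u)"
        using K by (simp add: ennreal_mult[symmetric] ennreal_leI)
      then show "ennreal (gauss (1/s) u) * (\<integral>\<^sup>+y. indicator koch_domain y * indicator (- koch_domain) (u + y) \<partial>lborel)
         \<le> ennreal (5 * K * s powr koch_codim) * ennreal (gauss (1/(sqrt 2 * s)) u)"
        using mult_left_mono[OF K(2)[of u]] order_trans by (meson zero_le)
    qed
    also have "\<dots> = ennreal (5 * K * s powr koch_codim) * ennreal (2 * pi / (1/(sqrt 2 * s))\<^sup>2)"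
      by (subst nn_integral_cmult, simp, subst gauss_nn_integral) (use s in auto)
    also have "\<dots> = ennreal (20 * pi * K * s\<^sup>2 * s powr koch_codim)"
      using s K by (subst ennreal_mult[symmetric]) (auto simp: power_divide power_mult_distrib mult_ac)
    finally show ?thesis .
  qed
  moreover have "20 * pi * K > 0" using K by simp
  ultimately show ?thesis by (rule that[rotated])
qed

text \<open>Count only transfers between the two triangles of the same edge. Their points are at
  most 2 s apart, where the kernel is at least exp(-2), and 3 * 4^n products of areas m 9^-n and m
  9^-n / 3 add up to m^2 (4/81)^n.\<close>

lemma heat_lower:
  obtains c where "c > 0" "\<And>n. ennreal (c * (4/81)^n) \<le> heat ((1/3)^n)"
proof -
  have op: "open (edge_mid_int e)" for e by (rule open_edge_sets)
  have [measurable]: "edge_mid_int e \<in> sets borel" for e using op by (rule borel_open)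
  define m where "m = measure lborel (edge_mid_int (0, 1))"
  have bm: "emeasure lborel (edge_mid_int (0,1)) = ennreal m"
  proof -
    have "(0, 1) \<in> koch_in 0" by (simp add: koch_in_0)
    then have "bounded (edge_mid_int (0,1))"
      by (intro bounded_subset[OF bounded_koch_domain koch_in_mid(1)])
    then show ?thesis using emeasure_bounded_finite[of "edge_mid_int (0,1)"] by (simp add: m_def emeasure_eq_ennreal_measure)
  qed
  have m: "m > 0"
    using emeasure_open_pos[OF op edge_mid_int_nonempty, of "(0,1)"] by (simp add: bm)
  define E where "E = exp (-(2::real))"
  have E: "E > 0" by (simp add: E_def)
  have "ennreal (E * m\<^sup>2 * (4/81)^n) \<le> heat ((1/3)^n)" for n
  proof -
    define s where "s = (1/3::real)^n"
    have s: "s > 0" by (simp add: s_def)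
    have inner: "ennreal (E * ((1/9)^n / 3 * m)) \<le> (\<integral>\<^sup>+x. indicator (- koch_domain) x * ennreal (gauss (1/s) (x - y)) \<partial>lborel)"
      if e: "e \<in> koch_in n" and y: "y \<in> edge_mid_int e" for e y
    proof -
      have "ennreal (E * ((1/9)^n / 3 * m)) = (\<integral>\<^sup>+x. ennreal E * indicator (edge_mid_int (cap_side1 e)) x \<partial>lborel)"
        using E m by (subst nn_integral_cmult_indicator) (auto simp: koch_in_mid(5)[OF e] bm ennreal_mult[symmetric])
      also have "\<dots> \<le> (\<integral>\<^sup>+x. indicator (- koch_domain) x * ennreal (gauss (1/s) (x - y)) \<partial>lborel)"
      proof (rule nn_integral_mono)
        fix x
        have "ennreal E \<le> ennreal (gauss (1/s) (x - y))" "x \<notin> koch_domain" if x: "x \<in> edge_mid_int (cap_side1 e)"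
        proof -
          have "cmod (x - y) \<le> 2 * s" using koch_in_mid(3)[OF e y x] by (simp add: s_def dist_norm norm_minus_commute)
          then have "(cmod (x - y))\<^sup>2 \<le> (2 * s)\<^sup>2" by (intro power_mono) auto
          then show "ennreal E \<le> ennreal (gauss (1/s) (x - y))"
            using s by (intro ennreal_leI) (simp add: E_def gauss_def power_divide field_simps power_mult_distrib)
          show "x \<notin> koch_domain" using koch_in_mid(2)[OF e] x by blast
        qed
        then show "ennreal E * indicator (edge_mid_int (cap_side1 e)) x \<le> indicator (- koch_domain) x * ennreal (gauss (1/s) (x - y))"
          by (auto simp: indicator_def)
      qed
      finally show ?thesis .
    qed
    have "ennreal (E * m\<^sup>2 * (4/81)^n) = (\<Sum>e\<in>koch_in n. ennreal (E * ((1/9)^n / 3 * m)) * ennreal ((1/9)^n * m))"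
    proof -
      have "E * m\<^sup>2 * (4/81)^n = real (3 * 4^n) * ((E * ((1/9)^n / 3 * m)) * ((1/9)^n * m))"
        by (simp add: power2_eq_square power_divide) (simp flip: power_mult_distrib)
      then show ?thesis
        using E m by (simp add: card_koch_in ennreal_of_nat_eq_real_of_nat ennreal_mult[symmetric] del: of_nat_mult)
    qed
    also have "\<dots> = (\<Sum>e\<in>koch_in n. \<integral>\<^sup>+y. ennreal (E * ((1/9)^n / 3 * m)) * indicator (edge_mid_int e) y \<partial>lborel)"
      using m by (intro sum.cong refl, subst nn_integral_cmult_indicator) (auto simp: koch_in_mid(4) bm ennreal_mult[symmetric])
    also have "\<dots> = (\<integral>\<^sup>+y. (\<Sum>e\<in>koch_in n. ennreal (E * ((1/9)^n / 3 * m)) * indicator (edge_mid_int e) y) \<partial>lborel)"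
      by (rule nn_integral_sum[symmetric]) auto
    also have "\<dots> \<le> heat s"
      unfolding heat_def
    proof (rule nn_integral_mono)
      fix y
      show "(\<Sum>e\<in>koch_in n. ennreal (E * ((1/9)^n / 3 * m)) * indicator (edge_mid_int e) y)
        \<le> indicator koch_domain y * (\<integral>\<^sup>+x. indicator (- koch_domain) x * ennreal (gauss (1/s) (x - y)) \<partial>lborel)"
      proof (cases "\<exists>e\<in>koch_in n. y \<in> edge_mid_int e")
        case True
        then obtain e where e: "e \<in> koch_in n" "y \<in> edge_mid_int e" by blast
        have "(\<Sum>e\<in>koch_in n. ennreal (E * ((1/9)^n / 3 * m)) * indicator (edge_mid_int e) y)
          = (\<Sum>e'\<in>{e}. ennreal (E * ((1/9)^n / 3 * m)) * indicator (edge_mid_int e') y)"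
        proof (rule sum.mono_neutral_right[OF koch_in_finite])
          show "\<forall>i\<in>koch_in n - {e}. ennreal (E * ((1/9)^n / 3 * m)) * indicator (edge_mid_int i) y = 0"
            using koch_in_mid(6)[OF e(1)] e(2) by (auto simp: indicator_def)
        qed (use e in auto)
        also have "\<dots> \<le> indicator koch_domain y * (\<integral>\<^sup>+x. indicator (- koch_domain) x * ennreal (gauss (1/s) (x - y)) \<partial>lborel)"
          using inner[OF e] koch_in_mid(1)[OF e(1)] e(2) by (auto simp: indicator_def)
        finally show ?thesis .
      next
        case False
        then have "(\<Sum>e\<in>koch_in n. ennreal (E * ((1/9)^n / 3 * m)) * indicator (edge_mid_int e) y) = 0"
          by (intro sum.neutral) auto
        then show ?thesis by simp
      qed
    qed
    finally show ?thesis by (simp add: s_def)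
  qed
  moreover have "E * m\<^sup>2 > 0" using E m by simp
  ultimately show ?thesis by (rule that[rotated])
qed

section \<open>Mean square decay of the Fourier transform\<close>

abbreviation koch_FT :: "complex \<Rightarrow> complex" where
  "koch_FT \<equiv> FT (indicator koch_domain)"

lemma koch_indicator_integrable: "integrable lborel (indicator koch_domain :: complex \<Rightarrow> real)"
  using emeasure_koch_domain by (intro integrable_real_indicator) auto

lemma koch_indicator_integral: "(LINT y|lborel. indicator koch_domain y :: real) = koch_area"
  by simp

text \<open>In the Gaussian Plancherel identity, the smoothed indicator on the domain equals the
  full kernel mass 2 pi s^2 minus what leaks out. In a difference for two widths the area term
  cancels and only heat contents remain.\<close>

lemma koch_FT_heat:
  assumes s: "s > 0"
  shows "(LINT y|lborel. (cmod (koch_FT y))\<^sup>2 * gauss s y) = 4 * pi\<^sup>2 * koch_area - 2*pi / s\<^sup>2 * enn2real (heat s)"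
proof -
  have s1: "1/s > 0" using s by simp
  define a where "a y = (LINT x|lborel. indicator koch_domain x * gauss (1/s) (x - y))" for y
  define b where "b y = (LINT x|lborel. indicator (- koch_domain) x * gauss (1/s) (x - y))" for y
  have gi: "integrable lborel (\<lambda>x. gauss (1/s) (x - y))" for y
  proof (rule integrableI_bounded)
    show "(\<integral>\<^sup>+ x. ennreal (norm (gauss (1 / s) (x - y))) \<partial>lborel) < \<infinity>"
      using gauss_nn_integral_shift[OF s1, of y] by simp
  qed simp
  have gv: "(LINT x|lborel. gauss (1/s) (x - y)) = 2 * pi * s\<^sup>2" for y
    using gauss_nn_integral_shift[OF s1, of y] s
    by (subst integral_eq_nn_integral) (auto simp: power_divide)
  have ia: "integrable lborel (\<lambda>x. indicator A x * gauss (1/s) (x - y))" if "A \<in> sets borel" for y and A :: "complex set"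
    using that by (intro Bochner_Integration.integrable_bound[OF gi[of y]]) (auto simp: indicator_def)
  have ab: "a y = 2 * pi * s\<^sup>2 - b y" for y
  proof -
    have "a y + b y = (LINT x|lborel. indicator koch_domain x * gauss (1/s) (x - y) + indicator (- koch_domain) x * gauss (1/s) (x - y))"
      unfolding a_def b_def by (rule Bochner_Integration.integral_add[symmetric]; rule ia) auto
    also have "\<dots> = (LINT x|lborel. gauss (1/s) (x - y))"
      by (intro Bochner_Integration.integral_cong) (auto simp: indicator_def)
    finally show ?thesis using gv[of y] by simp
  qed
  have b0: "0 \<le> b y" for y unfolding b_def by (intro integral_nonneg_AE) auto
  have [measurable]: "b \<in> borel_measurable borel" unfolding b_def by measurable
  have b1: "b y \<le> 2 * pi * s\<^sup>2" for y
  proof -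
    have "0 \<le> a y" unfolding a_def by (intro integral_nonneg_AE) auto
    then show ?thesis using ab[of y] by simp
  qed
  have ib: "integrable lborel (\<lambda>y. indicator koch_domain y * b y)"
    by (rule Bochner_Integration.integrable_bound[OF integrable_mult_left[OF koch_indicator_integrable, of "2 * pi * s\<^sup>2"]])
      (use b0 b1 in \<open>auto simp: indicator_def\<close>)
  have bheat: "(\<integral>\<^sup>+x. indicator (- koch_domain) x * ennreal (gauss (1/s) (x - y)) \<partial>lborel) = ennreal (b y)" for y
  proof -
    have "(\<integral>\<^sup>+x. indicator (- koch_domain) x * ennreal (gauss (1/s) (x - y)) \<partial>lborel) = (\<integral>\<^sup>+x. ennreal (indicator (- koch_domain) x * gauss (1/s) (x - y)) \<partial>lborel)"
      by (intro nn_integral_cong) (auto simp: indicator_def)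
    also have "\<dots> = ennreal (b y)"
      unfolding b_def by (rule nn_integral_eq_integral[OF ia]) auto
    finally show ?thesis .
  qed
  have "heat s = (\<integral>\<^sup>+y. ennreal (indicator koch_domain y * b y) \<partial>lborel)"
    unfolding heat_def bheat by (intro nn_integral_cong) (auto simp: indicator_def)
  also have "\<dots> = ennreal (LINT y|lborel. indicator koch_domain y * b y)"
    by (rule nn_integral_eq_integral[OF ib]) (auto simp: b0)
  finally have h: "enn2real (heat s) = (LINT y|lborel. indicator koch_domain y * b y)"
    by (simp add: b0 integral_nonneg_AE)
  have "(LINT y|lborel. (cmod (koch_FT y))\<^sup>2 * gauss s y) = 2*pi / s\<^sup>2 * (LINT y|lborel. indicator koch_domain y * a y)"
    unfolding a_def by (rule Plancherel_gauss[OF koch_indicator_integrable s])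
  also have "(LINT y|lborel. indicator koch_domain y * a y) = (LINT y|lborel. indicator koch_domain y * (2 * pi * s\<^sup>2) - indicator koch_domain y * b y)"
    unfolding ab by (simp add: algebra_simps)
  also have "\<dots> = koch_area * (2 * pi * s\<^sup>2) - enn2real (heat s)"
    unfolding h koch_indicator_integral[symmetric]
    by (subst Bochner_Integration.integral_diff) (use koch_indicator_integrable ib in auto)
  finally show ?thesis using s by (simp add: field_simps power2_eq_square)
qed

text \<open>With \<open>S = 3 ^ -k\<close> and a small multiple \<open>s\<close> of it, the weight \<open>gauss s - gauss S\<close> is concentrated on the
  annulus: its tails are dominated by small multiples of \<open>gauss s - gauss T\<close> (low frequencies,
  \<open>T\<close> a large multiple of \<open>S\<close>) and of \<open>gauss (s/2) - gauss s\<close> (high frequencies).\<close>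
lemma koch_FT_annulus:
  obtains A B c where "0 < A" "0 < B" "0 < c"
    "\<And>k. c * (4/9)^k \<le> (LINT y|lborel. indicator {y. A * 3^k \<le> cmod y \<and> cmod y \<le> B * 3^k} y * (cmod (koch_FT y))\<^sup>2)"
proof -
  obtain C where C: "C > 0" "\<And>s. s > 0 \<Longrightarrow> heat s \<le> ennreal (C * s\<^sup>2 * s powr koch_codim)"
    using heat_upper by blast
  obtain c1 where c1: "c1 > 0" "\<And>n. ennreal (c1 * (4/81)^n) \<le> heat ((1/3)^n)"
    using heat_lower by blast
  define h where "h s = enn2real (heat s) / s\<^sup>2" for s
  have h0: "h s \<ge> 0" for s unfolding h_def by simp
  have h_up: "h s \<le> C * s powr koch_codim" if s: "s > 0" for s
  proof -
    have "enn2real (heat s) \<le> C * s\<^sup>2 * s powr koch_codim"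
      by (rule enn2real_leI) (use C s in auto)
    then show ?thesis using s by (simp add: h_def field_simps)
  qed
  have h_low: "h ((1/3)^n) \<ge> c1 * (4/9)^n" for n
  proof -
    have "heat ((1/3)^n) < \<top>" using C(2)[of "(1/3)^n"] le_less_trans by fastforce
    then have "enn2real (ennreal (c1 * (4/81)^n)) \<le> enn2real (heat ((1/3)^n))"
      using c1(2) by (intro enn2real_mono)
    then have "c1 * (4/81)^n \<le> enn2real (heat ((1/3)^n))" using c1(1) by simp
    then have "c1 * (4/81)^n / ((1/3)^n)\<^sup>2 \<le> h ((1/3)^n)" unfolding h_def by (rule divide_right_mono) simp
    moreover have "(4/81)^n / ((1/3)^n)\<^sup>2 = (4/9::real)^n"
      by (simp add: power2_eq_square flip: power_mult_distrib power_divide)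
    ultimately show ?thesis by (metis times_divide_eq_right)
  qed
  define g where "g y = (cmod (koch_FT y))\<^sup>2" for y
  have g0: "g y \<ge> 0" for y by (simp add: g_def)
  have [measurable]: "g \<in> borel_measurable borel" unfolding g_def by measurable
  have gi: "integrable lborel (\<lambda>y. g y * gauss s y)" if "s > 0" for s
    unfolding g_def by (rule integrable_FT_gauss[OF koch_indicator_integrable that])
  have gd: "(LINT y|lborel. g y * (gauss s y - gauss t y)) = 2 * pi * (h t - h s)" if "s > 0" "t > 0" for s t
  proof -
    have "(LINT y|lborel. g y * (gauss s y - gauss t y)) = (LINT y|lborel. g y * gauss s y) - (LINT y|lborel. g y * gauss t y)"
      unfolding right_diff_distrib by (rule Bochner_Integration.integral_diff) (use gi that in auto)
    also have "\<dots> = 2 * pi * (h t - h s)"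
      unfolding g_def koch_FT_heat[OF that(1)] koch_FT_heat[OF that(2)] h_def by (simp add: algebra_simps)
    finally show ?thesis .
  qed
  have gdi: "integrable lborel (\<lambda>y. g y * (gauss s y - gauss t y))" if "s > 0" "t > 0" for s t
    unfolding right_diff_distrib by (intro Bochner_Integration.integrable_diff gi that)
  note \<beta> = koch_codim_bounds
  \<comment> \<open>Main term: \<open>h S\<close> is at least c1 (4/9)^k. The constants
    \<open>\<epsilon>\<close>, \<open>A\<close> and \<open>\<kappa>\<close> are chosen so that
    \<open>h s\<close>, the low tail and the high tail each cost at most a quarter of it; the
    remaining quarter is the lower bound on the annulus.\<close>
  define \<epsilon> where "\<epsilon> = (min (1/2) (c1 / (4 * C))) powr (1 / koch_codim)"
  have \<epsilon>: "0 < \<epsilon>" "\<epsilon> \<le> 1" "C * \<epsilon> powr koch_codim \<le> c1 / 4"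
  proof -
    have m: "0 < min (1/2) (c1 / (4 * C))" using c1 C by simp
    then show "0 < \<epsilon>" by (simp add: \<epsilon>_def)
    show "\<epsilon> \<le> 1" unfolding \<epsilon>_def using m \<beta> by (intro powr_le1) auto
    have "\<epsilon> powr koch_codim = min (1/2) (c1 / (4 * C))" unfolding \<epsilon>_def powr_powr using \<beta> m by simp
    also have "\<dots> \<le> c1 / (4 * C)" by simp
    finally show "C * \<epsilon> powr koch_codim \<le> c1 / 4" using C by (simp add: field_simps)
  qed
  define A where "A = min (1/2) (c1 / (16 * C))"
  have A: "0 < A" "A \<le> 1/2" "4 * C * A \<le> c1 / 4"
  proof -
    show "0 < A" "A \<le> 1/2" using c1 C by (auto simp: A_def)
    have "A \<le> c1 / (16 * C)" by (simp add: A_def)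
    then show "4 * C * A \<le> c1 / 4" using C by (simp add: field_simps)
  qed
  define \<kappa> where "\<kappa> = min (1/2) (c1 / (8 * C))"
  have \<kappa>: "0 < \<kappa>" "\<kappa> \<le> 1/2" "2 * \<kappa> * C \<le> c1 / 4"
  proof -
    show "0 < \<kappa>" "\<kappa> \<le> 1/2" using c1 C by (auto simp: \<kappa>_def)
    have "\<kappa> \<le> c1 / (8 * C)" by (simp add: \<kappa>_def)
    then show "2 * \<kappa> * C \<le> c1 / 4" using C by (simp add: field_simps)
  qed
  \<comment> \<open>For |y| > B/S this makes 3/4 of the exponent of \<open>gauss s\<close> at least
    -ln \<open>\<kappa>\<close>, so \<open>gauss s\<close> is at most \<open>\<kappa>\<close> times
    \<open>gauss (s/2)\<close>.\<close>
  define B where "B = sqrt (8 * (- ln \<kappa>) / (3 * \<epsilon>\<^sup>2))"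
  have ln\<kappa>: "ln \<kappa> < 0" using \<kappa> by simp
  have B: "0 < B" "3 * \<epsilon>\<^sup>2 * B\<^sup>2 / 8 = - ln \<kappa>"
  proof -
    have p: "0 < 8 * (- ln \<kappa>) / (3 * \<epsilon>\<^sup>2)" using ln\<kappa> \<epsilon> by (intro divide_pos_pos) auto
    then show "0 < B" by (simp add: B_def)
    have "B\<^sup>2 = 8 * (- ln \<kappa>) / (3 * \<epsilon>\<^sup>2)" using p by (simp add: B_def)
    then show "3 * \<epsilon>\<^sup>2 * B\<^sup>2 / 8 = - ln \<kappa>" using \<epsilon> by (simp add: field_simps)
  qed
  show ?thesis
  proof (rule that[of A B "2 * pi * (c1 / 4)"])
    fix k :: nat
    define S where "S = (1/3::real)^k"
    define s where "s = \<epsilon> * S"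
    define T where "T = S / A"
    have S: "S > 0" "3^k = 1 / S" by (simp_all add: S_def power_divide)
    have s: "s > 0" "s \<le> S" and T: "T > 0" "S \<le> T"
      using S \<epsilon> A by (auto simp: s_def T_def field_simps)
    define ann where "ann = {y::complex. A * 3^k \<le> cmod y \<and> cmod y \<le> B * 3^k}"
    have [measurable]: "ann \<in> sets borel" unfolding ann_def by measurable
    \<comment> \<open>Outside the annulus the weight is dominated by differences of Gaussians
      because exactly these have integrals expressible by \<open>h\<close>.\<close>
    have pt: "gauss s y - gauss S y \<le> indicator ann y + 4 * A\<^sup>2 * (gauss s y - gauss T y) + 2 * \<kappa> * (gauss (s/2) y - gauss s y)" for y
    proof -
      have n1: "0 \<le> 4 * A\<^sup>2 * (gauss s y - gauss T y)" using gauss_antimono[of s T y] s T by simp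
      have n2: "0 \<le> 2 * \<kappa> * (gauss (s/2) y - gauss s y)" using gauss_antimono[of "s/2" s y] s \<kappa> by simp
      consider "y \<in> ann" | "cmod y < A / S" | "cmod y > B / S" unfolding ann_def using S by fastforce
      then show ?thesis
      proof cases
        case 1
        then have i: "indicator ann y = (1::real)" by simp
        have "gauss s y - gauss S y \<le> 1" using gauss_le_1[of s y] gauss_nonneg[of S y] by linarith
        then show ?thesis using n1 n2 i by linarith
      next
        case 2
        define u where "u = S\<^sup>2 * (cmod y)\<^sup>2 / 2"
        have u0: "u \<ge> 0" by (simp add: u_def)
        have "S * cmod y \<le> A" using 2 S by (simp add: field_simps)
        then have "(S * cmod y)\<^sup>2 \<le> A\<^sup>2" using S by (intro power_mono) auto
        then have uA: "u / A\<^sup>2 \<le> 1/2" using A by (simp add: u_def power_mult_distrib field_simps)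
        have gS: "gauss S y = exp (-u)" by (simp add: gauss_def u_def)
        have gs: "gauss s y = exp (-(\<epsilon>\<^sup>2 * u))" by (simp add: gauss_def u_def s_def power_mult_distrib)
        have gT: "gauss T y = exp (-(u / A\<^sup>2))" by (simp add: gauss_def u_def T_def power_divide)
        have e1: "1 - t \<le> exp (-t)" for t :: real using exp_ge_add_one_self[of "-t"] by simp
        \<comment> \<open>Near 0 the exponential is squeezed between 1 - t and 1 - 3t/4; both bounds
          are needed to estimate a difference of two Gaussians from below.\<close>
        have e2: "exp (-t) \<le> 1 - 3/4 * t" if "0 \<le> t" "t \<le> 1/2" for t :: real
        proof -
          have "1 + t + t\<^sup>2 / 2 \<le> exp t" using that by (intro exp_lower_Taylor_quadratic) auto
          have "1 \<le> (1 - 3/4 * t) * (1 + t + t\<^sup>2/2)"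
          proof -
            have "(1 - 3/4 * t) * (1 + t + t\<^sup>2/2) - 1 = t * (1/4 - t/4 - 3/8 * t\<^sup>2)"
              by (simp add: power2_eq_square algebra_simps)
            moreover have "t\<^sup>2 \<le> 1/4" using that power_mono[of t "1/2" 2] by (simp add: power2_eq_square)
            then have "0 \<le> 1/4 - t/4 - 3/8 * t\<^sup>2" using that by linarith
            ultimately show ?thesis using that by (smt (verit) mult_nonneg_nonneg)
          qed
          also have "\<dots> \<le> (1 - 3/4 * t) * exp t" using \<open>1 + t + t\<^sup>2 / 2 \<le> exp t\<close> that by (intro mult_left_mono) auto
          finally show ?thesis by (simp add: exp_minus field_simps)
        qed
        have "gauss s y - gauss S y \<le> 1 - exp (-u)" using gauss_le_1[of s y] gS by simp
        also have "\<dots> \<le> u" using e1[of u] by simp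
        \<comment> \<open>The exponent of \<open>gauss T\<close> is u/A^2, much larger than u; so
          \<open>gauss s - gauss T\<close> is at least 3/4 (u/A^2) - u, and multiplication by 4 A^2
          <= 1 gives at least 2 u.\<close>
        also have "u \<le> 4 * A\<^sup>2 * (gauss s y - gauss T y)"
        proof -
          have "\<epsilon>\<^sup>2 * u \<le> 1 * u" using \<epsilon> u0 by (intro mult_right_mono power_le_one) auto
          moreover have "1 - \<epsilon>\<^sup>2 * u \<le> gauss s y" unfolding gs by (rule e1)
          moreover have "gauss T y \<le> 1 - 3/4 * (u / A\<^sup>2)" unfolding gT by (rule e2) (use u0 uA in auto)
          ultimately have "3/4 * (u / A\<^sup>2) - u \<le> gauss s y - gauss T y" by linarith
          moreover have "4 * A\<^sup>2 * (3/4 * (u / A\<^sup>2) - u) = 3 * u - 4 * A\<^sup>2 * u" using A by (simp add: field_simps)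
          moreover have "4 * A\<^sup>2 * u \<le> 1 * u"
            using A power_mono[of A "1/2" 2] u0 by (intro mult_right_mono) (auto simp: power2_eq_square)
          moreover have "4 * A\<^sup>2 * (3/4 * (u / A\<^sup>2) - u) \<le> 4 * A\<^sup>2 * (gauss s y - gauss T y)"
            using calculation(1) by (intro mult_left_mono) auto
          ultimately show ?thesis using u0 by linarith
        qed
        finally have le: "gauss s y - gauss S y \<le> 4 * A\<^sup>2 * (gauss s y - gauss T y)" .
        have "(0::real) \<le> indicator ann y" by simp
        then show ?thesis using n2 le by linarith
      next
        case 3
        define u where "u = s\<^sup>2 * (cmod y)\<^sup>2 / 2"
        have "B \<le> S * cmod y" using 3 S by (simp add: field_simps)
        then have "B\<^sup>2 \<le> (S * cmod y)\<^sup>2" using B by (intro power_mono) auto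
        then have "3 * \<epsilon>\<^sup>2 * B\<^sup>2 / 8 \<le> 3 * \<epsilon>\<^sup>2 * (S * cmod y)\<^sup>2 / 8"
          using \<epsilon> by (intro divide_right_mono mult_left_mono) auto
        then have uB: "- ln \<kappa> \<le> 3/4 * u" unfolding B(2) by (simp add: u_def s_def power_mult_distrib mult_ac)
        have gs: "gauss s y = exp (-(u/4)) * exp (- (3/4 * u))"
          unfolding gauss_def exp_add[symmetric] by (simp add: u_def)
        have gs2: "gauss (s/2) y = exp (-(u/4))" by (simp add: gauss_def u_def power_divide)
        have "exp (- (3/4 * u)) \<le> exp (ln \<kappa>)" using uB by simp
        then have le: "exp (- (3/4 * u)) \<le> \<kappa>" using \<kappa> by simp
        have 1: "gauss s y \<le> exp (-(u/4)) * \<kappa>" unfolding gs by (rule mult_left_mono[OF le]) simp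
        also have "\<dots> \<le> exp (-(u/4)) * (1/2)" using \<kappa> by (intro mult_left_mono) auto
        finally have "exp (-(u/4)) \<le> 2 * (gauss (s/2) y - gauss s y)" unfolding gs2 by simp
        then have "exp (-(u/4)) * \<kappa> \<le> 2 * (gauss (s/2) y - gauss s y) * \<kappa>" using \<kappa> by (intro mult_right_mono) auto
        then have "gauss s y \<le> 2 * \<kappa> * (gauss (s/2) y - gauss s y)" using 1 by (simp add: mult_ac)
        then show ?thesis using n1 gauss_nonneg[of S y] by (smt (verit) indicator_pos_le)
      qed
    qed
    have iann: "integrable lborel (\<lambda>y. indicator ann y * g y)"
    proof (rule Bochner_Integration.integrable_bound)
      let ?c = "exp ((B/S)\<^sup>2 / 2)"
      show "integrable lborel (\<lambda>y. ?c * (g y * gauss 1 y))" by (intro integrable_mult_right gi) simp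
      show "AE y in lborel. norm (indicator ann y * g y) \<le> norm (?c * (g y * gauss 1 y))"
      proof (rule AE_I2)
        fix y
        have "1 \<le> ?c * gauss 1 y" if "y \<in> ann"
        proof -
          have "cmod y \<le> B / S" using that S by (simp add: ann_def)
          then have "(cmod y)\<^sup>2 \<le> (B/S)\<^sup>2" by (intro power_mono) auto
          then show ?thesis unfolding gauss_def exp_add[symmetric] by simp
        qed
        then have "g y * 1 \<le> g y * (?c * gauss 1 y)" if "y \<in> ann"
          using that g0 by (intro mult_left_mono) auto
        then show "norm (indicator ann y * g y) \<le> norm (?c * (g y * gauss 1 y))"
          using g0[of y] by (auto simp: indicator_def abs_mult mult_ac)
      qed
    qed measurable
    have "2 * pi * (3/4 * c1 * (4/9)^k) \<le> 2 * pi * (h S - h s)"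
    proof -
      have "h s \<le> C * (\<epsilon> powr koch_codim * S powr koch_codim)" using h_up[OF s(1)] S \<epsilon> by (simp add: s_def powr_mult)
      also have "\<dots> = (C * \<epsilon> powr koch_codim) * (4/9)^k" by (simp add: S_def powr_koch_codim)
      also have "\<dots> \<le> c1/4 * (4/9)^k" by (rule mult_right_mono[OF \<epsilon>(3)]) simp
      finally have "3/4 * c1 * (4/9)^k \<le> h S - h s" using h_low[of k] by (simp add: S_def)
      then show ?thesis by (intro mult_left_mono) auto
    qed
    also have "\<dots> = (LINT y|lborel. g y * (gauss s y - gauss S y))" by (rule gd[symmetric]) fact+
    also have "\<dots> \<le> (LINT y|lborel. indicator ann y * g y + 4 * A\<^sup>2 * (g y * (gauss s y - gauss T y)) + 2 * \<kappa> * (g y * (gauss (s/2) y - gauss s y)))"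
    proof (rule integral_mono)
      fix y
      have "g y * (gauss s y - gauss S y) \<le> g y * (indicator ann y + 4 * A\<^sup>2 * (gauss s y - gauss T y) + 2 * \<kappa> * (gauss (s/2) y - gauss s y))"
        by (rule mult_left_mono[OF pt g0])
      then show "g y * (gauss s y - gauss S y) \<le> indicator ann y * g y + 4 * A\<^sup>2 * (g y * (gauss s y - gauss T y)) + 2 * \<kappa> * (g y * (gauss (s/2) y - gauss s y))"
        by (simp add: algebra_simps)
    qed (use gdi s S T iann in auto)
    also have "\<dots> = (LINT y|lborel. indicator ann y * g y) + 4 * A\<^sup>2 * (2 * pi * (h T - h s)) + 2 * \<kappa> * (2 * pi * (h s - h (s/2)))"
    proof -
      have "s/2 > 0" using s by simp
      note i = gdi[OF s(1) T(1)] gdi[OF this s(1)]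
      show ?thesis
        using iann i by (simp add: gd[OF s(1) T(1)] gd[OF \<open>s/2 > 0\<close> s(1)])
    qed
    \<comment> \<open>\<open>h T\<close> exceeds the scale of \<open>h S\<close> by the factor A to
      the power -\<open>koch_codim\<close>, which A^2 overcompensates: since the codimension is
      below 1, a factor A is left and can be made small.\<close>
    also have "4 * A\<^sup>2 * (2 * pi * (h T - h s)) \<le> 2 * pi * (c1/4 * (4/9)^k)"
    proof -
      have "h T \<le> C * (S powr koch_codim / A powr koch_codim)" using h_up[OF T(1)] S A by (simp add: T_def powr_divide)
      then have "4 * A\<^sup>2 * (h T - h s) \<le> 4 * A\<^sup>2 * (C * (S powr koch_codim / A powr koch_codim))"
        using h0[of s] by (intro mult_left_mono) auto
      also have "\<dots> = 4 * C * (A\<^sup>2 / A powr koch_codim) * S powr koch_codim" by simp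
      also have "\<dots> \<le> 4 * C * A * S powr koch_codim"
      proof (intro mult_right_mono mult_left_mono)
        have "A powr 1 \<le> A powr koch_codim" using A \<beta> by (intro powr_mono') auto
        then have "A * A \<le> A * A powr koch_codim" using A by (intro mult_left_mono) auto
        then show "A\<^sup>2 / A powr koch_codim \<le> A" using A by (simp add: power2_eq_square field_simps)
      qed (use C in auto)
      also have "\<dots> \<le> c1/4 * S powr koch_codim" by (rule mult_right_mono[OF A(3)]) simp
      finally have "4 * A\<^sup>2 * (h T - h s) \<le> c1/4 * (4/9)^k" by (simp add: S_def powr_koch_codim)
      then have "2 * pi * (4 * A\<^sup>2 * (h T - h s)) \<le> 2 * pi * (c1/4 * (4/9)^k)" by (intro mult_left_mono) auto
      then show ?thesis by (simp only: mult_ac)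
    qed
    also have "2 * \<kappa> * (2 * pi * (h s - h (s/2))) \<le> 2 * pi * (c1/4 * (4/9)^k)"
    proof -
      have "h s \<le> C * s powr koch_codim" by (rule h_up[OF s(1)])
      also have "\<dots> \<le> C * S powr koch_codim" using s C \<beta> by (intro mult_left_mono powr_mono2) auto
      finally have "2 * \<kappa> * (h s - h (s/2)) \<le> 2 * \<kappa> * (C * S powr koch_codim)"
        using h0[of "s/2"] \<kappa> by (intro mult_left_mono) auto
      also have "\<dots> = 2 * \<kappa> * C * S powr koch_codim" by simp
      also have "\<dots> \<le> c1/4 * S powr koch_codim" by (rule mult_right_mono[OF \<kappa>(3)]) simp
      finally have "2 * \<kappa> * (h s - h (s/2)) \<le> c1/4 * (4/9)^k" by (simp add: S_def powr_koch_codim)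
      then have "2 * pi * (2 * \<kappa> * (h s - h (s/2))) \<le> 2 * pi * (c1/4 * (4/9)^k)" by (intro mult_left_mono) auto
      then show ?thesis by (simp only: mult_ac)
    qed
    finally have "2 * pi * (3/4 * c1 * (4/9)^k) \<le> (LINT y|lborel. indicator ann y * g y) + 2 * pi * (c1/4 * (4/9)^k) + 2 * pi * (c1/4 * (4/9)^k)"
      by simp
    then have "2 * pi * (c1 / 4) * (4/9)^k \<le> (LINT y|lborel. indicator ann y * g y)" by (simp add: algebra_simps)
    then show "2 * pi * (c1 / 4) * (4/9)^k \<le> (LINT y|lborel. indicator {y. A * 3^k \<le> cmod y \<and> cmod y \<le> B * 3^k} y * (cmod (koch_FT y))\<^sup>2)"
      by (simp add: ann_def g_def)
  qed (use A B c1 in auto)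
qed

section \<open>The discrepancy as a convolution\<close>

lemma lborel_complex_mult:
  assumes c: "(c::complex) \<noteq> 0"
  shows "(lborel :: complex measure) = density (distr lborel borel ((*) c)) (\<lambda>_. ennreal ((cmod c)\<^sup>2))"
proof (rule measure_eqI)
  fix A :: "complex set" assume "A \<in> sets lborel"
  then have [measurable]: "A \<in> sets borel" by simp
  have "emeasure lborel A = ennreal ((cmod c)\<^sup>2) * (\<integral>\<^sup>+z. indicator A (c * z) \<partial>lborel)"
    using nn_integral_complex_mult[OF _ c, of "indicator A"] by simp
  also have "(\<integral>\<^sup>+z. indicator A (c * z) \<partial>lborel) = (\<integral>\<^sup>+z. indicator A z \<partial>distr lborel borel ((*) c))"
    by (rule nn_integral_distr[symmetric]) auto
  also have "ennreal ((cmod c)\<^sup>2) * \<dots> = emeasure (density (distr lborel borel ((*) c)) (\<lambda>_. ennreal ((cmod c)\<^sup>2))) A"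
    by (simp add: emeasure_density nn_integral_cmult)
  finally show "emeasure lborel A = emeasure (density (distr lborel borel ((*) c)) (\<lambda>_. ennreal ((cmod c)\<^sup>2))) A" .
qed simp

lemma integral_complex_mult:
  fixes f :: "complex \<Rightarrow> 'a::{banach, second_countable_topology}"
  assumes [measurable]: "f \<in> borel_measurable borel" and c: "(c::complex) \<noteq> 0"
  shows "(LINT z|lborel. f z) = (cmod c)\<^sup>2 *\<^sub>R (LINT z|lborel. f (c * z))"
  by (subst lborel_complex_mult[OF c]) (simp add: integral_density integral_distr)

lemma integral_lborel_translate:
  fixes f :: "'b::euclidean_space \<Rightarrow> 'a::{banach, second_countable_topology}"
  assumes [measurable]: "f \<in> borel_measurable borel"
  shows "(LINT z|lborel. f (c + z)) = (LINT z|lborel. f z)"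
proof -
  have "(LINT z|lborel. f z) = (LINT z|distr lborel borel ((+) c). f z)" by (subst lborel_distr_plus) simp
  also have "\<dots> = (LINT z|lborel. f (c + z))" by (rule integral_distr) auto
  finally show ?thesis by simp
qed

text \<open>Used to replace the angle theta by -theta when an annulus is swept by the conjugate of
  the rotation and dilation factor.\<close>

lemma nn_integral_complex_cnj:
  fixes f :: "complex \<Rightarrow> ennreal"
  assumes [measurable]: "f \<in> borel_measurable borel"
  shows "(\<integral>\<^sup>+z. f (cnj z) \<partial>lborel) = (\<integral>\<^sup>+z. f z \<partial>lborel)"
proof -
  have [measurable]: "cnj \<in> borel_measurable borel" by (intro borel_measurable_continuous_onI continuous_intros)
  have "(\<integral>\<^sup>+z. f z \<partial>lborel) = (\<integral>\<^sup>+x. \<integral>\<^sup>+y. f (Complex x y) \<partial>lborel \<partial>lborel)" by (rule nn_integral_complex) simp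
  also have "\<dots> = (\<integral>\<^sup>+x. \<integral>\<^sup>+y. f (cnj (Complex x y)) \<partial>lborel \<partial>lborel)"
  proof (rule nn_integral_cong)
    fix x :: real
    show "(\<integral>\<^sup>+y. f (Complex x y) \<partial>lborel) = (\<integral>\<^sup>+y. f (cnj (Complex x y)) \<partial>lborel)"
      by (subst nn_integral_real_affine[where c="-1" and t=0]) (auto simp: complex_cnj)
  qed
  also have "\<dots> = (\<integral>\<^sup>+z. f (cnj z) \<partial>lborel)" by (rule nn_integral_complex[symmetric]) measurable
  finally show ?thesis ..
qed

text \<open>A one-sided Plancherel bound, uniform in \<open>s\<close>. In the double integral of
  \<open>Plancherel_gauss\<close> use 2 |f(x) f(y)| <= f(x)^2 + f(y)^2; integrating the kernel in
  the free variable gives 2 pi s^2, which cancels the 1/s^2 in front.\<close>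

lemma FT_Bessel:
  assumes f: "integrable lborel f" and s: "s > 0"
  shows "ennreal (LINT y|lborel. (cmod (FT f y))\<^sup>2 * gauss s y) \<le> ennreal (4 * pi\<^sup>2) * (\<integral>\<^sup>+x. ennreal ((f x)\<^sup>2) \<partial>lborel)"
proof -
  note [measurable] = borel_measurable_integrable[OF f]
  have s1: "1/s > 0" using s by simp
  define F where "F y = (LINT x|lborel. f x * gauss (1/s) (x - y))" for y
  have gv: "(\<integral>\<^sup>+x. ennreal (gauss (1/s) (x - y)) \<partial>lborel) = ennreal (2 * pi * s\<^sup>2)"
    "(\<integral>\<^sup>+x. ennreal (gauss (1/s) (y - x)) \<partial>lborel) = ennreal (2 * pi * s\<^sup>2)" for y
  proof -
    show 1: "(\<integral>\<^sup>+x. ennreal (gauss (1/s) (x - y)) \<partial>lborel) = ennreal (2 * pi * s\<^sup>2)"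
      using gauss_nn_integral_shift[OF s1, of y] s by (simp add: power_divide)
    then show "(\<integral>\<^sup>+x. ennreal (gauss (1/s) (y - x)) \<partial>lborel) = ennreal (2 * pi * s\<^sup>2)"
      by (simp add: gauss_def norm_minus_commute)
  qed
  \<comment> \<open>Valid without integrability, since the Bochner integral of a non-integrable
    function is 0.\<close>
  have le: "ennreal (LINT x|lborel. h x) \<le> (\<integral>\<^sup>+x. ennreal \<bar>h x\<bar> \<partial>lborel)" for h :: "complex \<Rightarrow> real"
  proof (cases "integrable lborel h")
    case True
    have "ennreal (LINT x|lborel. h x) \<le> ennreal (norm (LINT x|lborel. h x))" by (intro ennreal_leI) simp
    also have "\<dots> \<le> (\<integral>\<^sup>+x. ennreal (norm (h x)) \<partial>lborel)" by (rule integral_norm_bound_ennreal[OF True])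
    finally show ?thesis by simp
  qed (simp add: not_integrable_integral_eq)
  have Fle: "ennreal \<bar>F y\<bar> \<le> (\<integral>\<^sup>+x. ennreal (\<bar>f x\<bar> * gauss (1/s) (x - y)) \<partial>lborel)" for y
  proof -
    have "\<bar>F y\<bar> \<le> (LINT x|lborel. \<bar>f x * gauss (1/s) (x - y)\<bar>)" unfolding F_def by (rule integral_abs_bound)
    then have "ennreal \<bar>F y\<bar> \<le> ennreal (LINT x|lborel. \<bar>f x * gauss (1/s) (x - y)\<bar>)" by (rule ennreal_leI)
    also have "\<dots> \<le> (\<integral>\<^sup>+x. ennreal \<bar>\<bar>f x * gauss (1/s) (x - y)\<bar>\<bar> \<partial>lborel)" by (rule le)
    finally show ?thesis by (simp add: abs_mult)
  qed
  have "ennreal (LINT y|lborel. f y * F y) \<le> (\<integral>\<^sup>+y. ennreal \<bar>f y * F y\<bar> \<partial>lborel)" by (rule le)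
  also have "\<dots> \<le> (\<integral>\<^sup>+y. \<integral>\<^sup>+x. ennreal (1/2) * (ennreal ((f y)\<^sup>2) * ennreal (gauss (1/s) (x - y)) + ennreal ((f x)\<^sup>2) * ennreal (gauss (1/s) (x - y))) \<partial>lborel \<partial>lborel)"
  proof (rule nn_integral_mono)
    fix y
    have "ennreal \<bar>f y * F y\<bar> = ennreal \<bar>f y\<bar> * ennreal \<bar>F y\<bar>" by (simp add: abs_mult ennreal_mult)
    also have "\<dots> \<le> ennreal \<bar>f y\<bar> * (\<integral>\<^sup>+x. ennreal (\<bar>f x\<bar> * gauss (1/s) (x - y)) \<partial>lborel)"
      by (rule mult_left_mono[OF Fle]) simp
    also have "\<dots> = (\<integral>\<^sup>+x. ennreal \<bar>f y\<bar> * ennreal (\<bar>f x\<bar> * gauss (1/s) (x - y)) \<partial>lborel)"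
      by (rule nn_integral_cmult[symmetric]) measurable
    also have "\<dots> \<le> (\<integral>\<^sup>+x. ennreal (1/2) * (ennreal ((f y)\<^sup>2) * ennreal (gauss (1/s) (x - y)) + ennreal ((f x)\<^sup>2) * ennreal (gauss (1/s) (x - y))) \<partial>lborel)"
    proof (rule nn_integral_mono)
      fix x
      have "2 * \<bar>f y\<bar> * \<bar>f x\<bar> \<le> (f y)\<^sup>2 + (f x)\<^sup>2" using sum_squares_bound[of "\<bar>f y\<bar>" "\<bar>f x\<bar>"] by simp
      then have "\<bar>f y\<bar> * \<bar>f x\<bar> * gauss (1/s) (x - y) \<le> 1/2 * ((f y)\<^sup>2 + (f x)\<^sup>2) * gauss (1/s) (x - y)"
        by (intro mult_right_mono) auto
      then have "\<bar>f y\<bar> * (\<bar>f x\<bar> * gauss (1/s) (x - y)) \<le> 1/2 * ((f y)\<^sup>2 * gauss (1/s) (x - y) + (f x)\<^sup>2 * gauss (1/s) (x - y))"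
        by (simp add: algebra_simps)
      then show "ennreal \<bar>f y\<bar> * ennreal (\<bar>f x\<bar> * gauss (1/s) (x - y)) \<le> ennreal (1/2) * (ennreal ((f y)\<^sup>2) * ennreal (gauss (1/s) (x - y)) + ennreal ((f x)\<^sup>2) * ennreal (gauss (1/s) (x - y)))"
      proof -
        assume *: "\<bar>f y\<bar> * (\<bar>f x\<bar> * gauss (1/s) (x - y)) \<le> 1/2 * ((f y)\<^sup>2 * gauss (1/s) (x - y) + (f x)\<^sup>2 * gauss (1/s) (x - y))"
        have "ennreal \<bar>f y\<bar> * ennreal (\<bar>f x\<bar> * gauss (1/s) (x - y)) = ennreal (\<bar>f y\<bar> * (\<bar>f x\<bar> * gauss (1/s) (x - y)))"
          by (rule ennreal_mult''[symmetric]) simp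
        also have "\<dots> \<le> ennreal (1/2 * ((f y)\<^sup>2 * gauss (1/s) (x - y) + (f x)\<^sup>2 * gauss (1/s) (x - y)))"
          by (rule ennreal_leI[OF *])
        also have "\<dots> = ennreal (1/2) * ennreal ((f y)\<^sup>2 * gauss (1/s) (x - y) + (f x)\<^sup>2 * gauss (1/s) (x - y))"
          by (rule ennreal_mult'') simp
        also have "ennreal ((f y)\<^sup>2 * gauss (1/s) (x - y) + (f x)\<^sup>2 * gauss (1/s) (x - y))
          = ennreal ((f y)\<^sup>2) * ennreal (gauss (1/s) (x - y)) + ennreal ((f x)\<^sup>2) * ennreal (gauss (1/s) (x - y))"
          by (simp add: ennreal_mult'')
        finally show ?thesis .
      qed
    qed
    finally show "ennreal \<bar>f y * F y\<bar> \<le> (\<integral>\<^sup>+x. ennreal (1/2) * (ennreal ((f y)\<^sup>2) * ennreal (gauss (1/s) (x - y)) + ennreal ((f x)\<^sup>2) * ennreal (gauss (1/s) (x - y))) \<partial>lborel)" .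
  qed
  also have "\<dots> = ennreal (1/2) * ((\<integral>\<^sup>+y. \<integral>\<^sup>+x. ennreal ((f y)\<^sup>2) * ennreal (gauss (1/s) (x - y)) \<partial>lborel \<partial>lborel)
      + (\<integral>\<^sup>+y. \<integral>\<^sup>+x. ennreal ((f x)\<^sup>2) * ennreal (gauss (1/s) (x - y)) \<partial>lborel \<partial>lborel))"
    by (simp add: nn_integral_cmult nn_integral_add)
  also have "(\<integral>\<^sup>+y. \<integral>\<^sup>+x. ennreal ((f x)\<^sup>2) * ennreal (gauss (1/s) (x - y)) \<partial>lborel \<partial>lborel)
     = (\<integral>\<^sup>+x. \<integral>\<^sup>+y. ennreal ((f x)\<^sup>2) * ennreal (gauss (1/s) (x - y)) \<partial>lborel \<partial>lborel)"
    by (rule lborel_pair.Fubini') measurable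
  also have "ennreal (1/2) * ((\<integral>\<^sup>+y. \<integral>\<^sup>+x. ennreal ((f y)\<^sup>2) * ennreal (gauss (1/s) (x - y)) \<partial>lborel \<partial>lborel)
      + (\<integral>\<^sup>+x. \<integral>\<^sup>+y. ennreal ((f x)\<^sup>2) * ennreal (gauss (1/s) (x - y)) \<partial>lborel \<partial>lborel))
    = ennreal (1/2) * (2 * ((\<integral>\<^sup>+x. ennreal ((f x)\<^sup>2) \<partial>lborel) * ennreal (2 * pi * s\<^sup>2)))"
  proof -
    have 1: "(\<integral>\<^sup>+y. \<integral>\<^sup>+x. ennreal ((f y)\<^sup>2) * ennreal (gauss (1/s) (x - y)) \<partial>lborel \<partial>lborel) = (\<integral>\<^sup>+x. ennreal ((f x)\<^sup>2) \<partial>lborel) * ennreal (2 * pi * s\<^sup>2)"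
      by (subst nn_integral_cmult, simp, simp only: gv, rule nn_integral_multc, simp)
    have 2: "(\<integral>\<^sup>+x. \<integral>\<^sup>+y. ennreal ((f x)\<^sup>2) * ennreal (gauss (1/s) (x - y)) \<partial>lborel \<partial>lborel) = (\<integral>\<^sup>+x. ennreal ((f x)\<^sup>2) \<partial>lborel) * ennreal (2 * pi * s\<^sup>2)"
      by (subst nn_integral_cmult, simp, simp only: gv, rule nn_integral_multc, simp)
    show ?thesis by (simp only: 1 2 mult_2)
  qed
  also have "\<dots> = ennreal (2 * pi * s\<^sup>2) * (\<integral>\<^sup>+x. ennreal ((f x)\<^sup>2) \<partial>lborel)"
  proof -
    have "ennreal (1/2) * ennreal 2 = ennreal 1" by (subst ennreal_mult[symmetric]) auto
    then have half: "ennreal (1/2) * 2 = 1" by (simp only: ennreal_numeral ennreal_1)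
    have "u * (2 * (X * b)) = b * X" if "u * 2 = 1" for u X b :: ennreal
    proof -
      have "u * (2 * (X * b)) = (u * 2) * (X * b)" by (simp only: mult.assoc)
      then show ?thesis by (simp only: that mult_1 mult.commute[of X b])
    qed
    from this[OF half] show ?thesis .
  qed
  finally have m: "ennreal (LINT y|lborel. f y * F y) \<le> ennreal (2 * pi * s\<^sup>2) * (\<integral>\<^sup>+x. ennreal ((f x)\<^sup>2) \<partial>lborel)" .
  have "ennreal (LINT y|lborel. (cmod (FT f y))\<^sup>2 * gauss s y) = ennreal (2*pi / s\<^sup>2) * ennreal (LINT y|lborel. f y * F y)"
    unfolding Plancherel_gauss[OF f s] F_def by (rule ennreal_mult') simp
  also have "\<dots> \<le> ennreal (2*pi / s\<^sup>2) * (ennreal (2 * pi * s\<^sup>2) * (\<integral>\<^sup>+x. ennreal ((f x)\<^sup>2) \<partial>lborel))"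
    by (rule mult_left_mono[OF m]) simp
  also have "\<dots> = ennreal (4 * pi\<^sup>2) * (\<integral>\<^sup>+x. ennreal ((f x)\<^sup>2) \<partial>lborel)"
    using s by (simp add: mult.assoc[symmetric] ennreal_mult[symmetric] power2_eq_square)
  finally show ?thesis .
qed

lemma koch_copy_iff:
  assumes "\<tau> \<noteq> 0"
  shows "z \<in> koch_copy x \<tau> \<theta> \<longleftrightarrow> (z - x) / (of_real \<tau> * cis \<theta>) \<in> koch_domain"
proof -
  have c: "of_real \<tau> * cis \<theta> \<noteq> 0" using assms by (simp add: cis_neq_zero)
  show ?thesis
  proof
    assume "z \<in> koch_copy x \<tau> \<theta>"
    then obtain y where "y \<in> koch_domain" "z = x + of_real \<tau> * cis \<theta> * y" unfolding koch_copy_def by blast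
    then show "(z - x) / (of_real \<tau> * cis \<theta>) \<in> koch_domain" using c by simp
  next
    assume "(z - x) / (of_real \<tau> * cis \<theta>) \<in> koch_domain"
    then show "z \<in> koch_copy x \<tau> \<theta>" unfolding koch_copy_def
      by (rule image_eqI[rotated]) (use c in simp)
  qed
qed

text \<open>Seen as a function of the translation \<open>x\<close>, the discrepancy of the copies \<open>x + c \<Omega>\<close> is the
  convolution of \<open>\<Sum>\<^sub>p \<delta>\<^sub>p - N \<mu>\<close> with \<open>koch_shape c\<close>.\<close>
definition koch_shape :: "complex \<Rightarrow> complex \<Rightarrow> real" where
  "koch_shape c u = indicator koch_domain (- (u / c))"

lemma koch_shape_measurable [measurable]: "koch_shape c \<in> borel_measurable borel"
  unfolding koch_shape_def divide_inverse by measurable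

lemma koch_shape_bounds [simp]: "0 \<le> koch_shape c u" "koch_shape c u \<le> 1"
  by (simp_all add: koch_shape_def indicator_def)

lemma koch_domain_norm: "z \<in> koch_domain \<Longrightarrow> cmod z < 6"
proof -
  assume "z \<in> koch_domain"
  then have "z \<in> koch_hexagon" using inner_region_subset koch_domain_eq by blast
  then have x: "\<bar>Re z\<bar> \<le> 2" and h: "\<bar>sqrt 3 * Im z\<bar> \<le> 3"
    unfolding koch_level0_defs edge_x_initial by auto
  have "\<bar>Im z\<bar> \<le> \<bar>sqrt 3 * Im z\<bar>" by (simp add: abs_mult mult_le_cancel_right1)
  then show "cmod z < 6" using cmod_le[of z] x h by linarith
qed

lemma koch_shape_support: "c \<noteq> 0 \<Longrightarrow> koch_shape c u \<noteq> 0 \<Longrightarrow> cmod u < 6 * cmod c"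
  using koch_domain_norm[of "-(u/c)"] by (auto simp: koch_shape_def indicator_def norm_divide field_simps split: if_splits)

lemma koch_shape_integrable:
  assumes "c \<noteq> 0"
  shows "integrable lborel (koch_shape c)"
proof (rule Bochner_Integration.integrable_bound)
  show "integrable lborel (indicator (ball 0 (6 * cmod c)) :: complex \<Rightarrow> real)"
    by (intro integrable_real_indicator) (auto simp: emeasure_complex_ball)
  show "AE u in lborel. norm (koch_shape c u) \<le> norm (indicator (ball 0 (6 * cmod c)) u :: real)"
  proof (rule AE_I2)
    fix u show "norm (koch_shape c u) \<le> norm (indicator (ball 0 (6 * cmod c)) u :: real)"
      using koch_shape_support[OF assms, of u] by (cases "koch_shape c u = 0") auto
  qed
qed simp

definition koch_disc :: "complex set \<Rightarrow> complex \<Rightarrow> complex \<Rightarrow> real" where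
  "koch_disc P c x = (\<Sum>p\<in>P. koch_shape c (x - p))
     - real (card P) / koch_area * (LINT y|lborel. indicator koch_domain y * koch_shape c (x - y))"

lemma discrepancy_eq:
  assumes "finite P" "\<tau> \<noteq> 0"
  shows "discrepancy P (koch_copy x \<tau> \<theta>) = koch_disc P (of_real \<tau> * cis \<theta>) x"
proof -
  define c where "c = of_real \<tau> * cis \<theta>"
  have c: "c \<noteq> 0" using assms by (simp add: c_def cis_neq_zero)
  have shape: "koch_shape c (x - z) = indicator (koch_copy x \<tau> \<theta>) z" for z
    using koch_copy_iff[OF assms(2), of z x \<theta>] c
    by (simp add: koch_shape_def indicator_def c_def[symmetric] minus_divide_left)
  have "koch_copy x \<tau> \<theta> = (\<lambda>z. (z - x) / c) -` koch_domain"
    using koch_copy_iff[OF assms(2)] by (auto simp: c_def)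
  moreover have "(\<lambda>z. (z - x) / c) -` koch_domain \<in> sets borel"
    by (rule measurable_sets_borel[of _ borel]) (auto simp: divide_inverse)
  ultimately have [measurable]: "koch_copy x \<tau> \<theta> \<in> sets borel" by simp
  have "real (card (P \<inter> koch_copy x \<tau> \<theta>)) = (\<Sum>p\<in>P. koch_shape c (x - p))"
    unfolding shape using assms(1) by (simp add: sum.If_cases indicator_def Int_def)
  moreover have "koch_mu (koch_copy x \<tau> \<theta>) = (LINT y|lborel. indicator koch_domain y * koch_shape c (x - y)) / koch_area"
  proof -
    have "measure lebesgue (koch_copy x \<tau> \<theta> \<inter> koch_domain) = measure lborel (koch_copy x \<tau> \<theta> \<inter> koch_domain)"
      by (simp add: measure_completion)
    also have "\<dots> = (LINT y|lborel. indicator (koch_copy x \<tau> \<theta> \<inter> koch_domain) y)" by simp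
    also have "\<dots> = (LINT y|lborel. indicator koch_domain y * koch_shape c (x - y))"
      unfolding shape by (intro Bochner_Integration.integral_cong) (auto simp: indicator_def)
    finally show ?thesis unfolding koch_mu_def by (simp add: measure_completion)
  qed
  ultimately show ?thesis unfolding discrepancy_def koch_disc_def c_def[symmetric] by simp
qed

text \<open>Substituting u = -c z moves c to the frequency as its conjugate, because (c z) . y = z .
  (cnj c y); the minus sign only conjugates the transform and disappears in the modulus. The
  Jacobian |c|^2 is squared.\<close>

lemma FT_koch_shape:
  assumes "c \<noteq> 0"
  shows "(cmod (FT (koch_shape c) y))\<^sup>2 = (cmod c)^4 * (cmod (koch_FT (cnj c * y)))\<^sup>2"
proof -
  have i: "(- c * z) \<bullet> y = - (z \<bullet> (cnj c * y))" for z
    by (simp add: inner_complex_def algebra_simps)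
  have "FT (koch_shape c) y = (cmod (-c))\<^sup>2 *\<^sub>R (LINT z|lborel. koch_shape c (- c * z) *\<^sub>R cis ((- c * z) \<bullet> y))"
    unfolding FT_def by (rule integral_complex_mult) (use assms in auto)
  also have "(LINT z|lborel. koch_shape c (- c * z) *\<^sub>R cis ((- c * z) \<bullet> y)) = (LINT z|lborel. cnj (indicator koch_domain z *\<^sub>R cis (z \<bullet> (cnj c * y))))"
    unfolding i using assms by (simp add: koch_shape_def cis_cnj)
  also have "\<dots> = cnj (koch_FT (cnj c * y))" unfolding FT_def by (rule Bochner_Integration.integral_cnj)
  finally show ?thesis by (simp add: power_mult_distrib)
qed

text \<open>The convolution theorem: each point contributes a translate of the shape, hence an
  exponential factor, and the area term is an average of such translates over the domain, hence the
  factor \<open>koch_FT\<close>.\<close>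

lemma FT_koch_disc:
  assumes P: "finite P" and c: "c \<noteq> 0"
  shows "integrable lborel (koch_disc P c)"
    "FT (koch_disc P c) y = FT (koch_shape c) y * ((\<Sum>p\<in>P. cis (p \<bullet> y)) - of_real (real (card P) / koch_area) * koch_FT y)"
proof -
  note si = koch_shape_integrable[OF c]
  define S where "S x = (LINT y|lborel. indicator koch_domain y * koch_shape c (x - y))" for x
  define B where "B = ball (0::complex) (6 + 6 * cmod c)"
  have [measurable]: "S \<in> borel_measurable borel" unfolding S_def by measurable
  have inB: "x \<in> B" if "y \<in> koch_domain" "koch_shape c (x - y) \<noteq> 0" for x y
    using koch_domain_norm[OF that(1)] koch_shape_support[OF c that(2)] norm_triangle_ineq[of y "x - y"] by (simp add: B_def)
  have Bi: "integrable lborel (indicator B :: complex \<Rightarrow> real)"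
    unfolding B_def by (intro integrable_real_indicator) (auto simp: emeasure_complex_ball)
  have ii: "integrable lborel (\<lambda>y. indicator koch_domain y * koch_shape c (x - y))" for x
    by (rule Bochner_Integration.integrable_bound[OF koch_indicator_integrable]) (auto simp: indicator_def)
  have S0: "0 \<le> S x" for x unfolding S_def by (intro integral_nonneg_AE) auto
  have SB: "S x \<le> koch_area * indicator B x" for x
  proof (cases "x \<in> B")
    case True
    have "S x \<le> (LINT y|lborel. indicator koch_domain y)" unfolding S_def
      by (rule integral_mono[OF ii koch_indicator_integrable]) (auto simp: indicator_def)
    then show ?thesis using True by simp
  next
    case False
    then have "S x = (LINT (y::complex)|lborel. 0)" unfolding S_def using inB
      by (intro Bochner_Integration.integral_cong) (auto simp: indicator_def)
    then show ?thesis by simp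
  qed
  have Si: "integrable lborel S"
    by (rule Bochner_Integration.integrable_bound[OF integrable_mult_right[OF Bi, of koch_area]])
      (use S0 SB koch_area_pos in \<open>auto simp: abs_mult\<close>)
  have ti: "integrable lborel (\<lambda>x. koch_shape c (x - p))" for p
  proof (rule Bochner_Integration.integrable_bound)
    show "integrable lborel (indicator (ball p (6 * cmod c)) :: complex \<Rightarrow> real)"
      by (intro integrable_real_indicator) (auto simp: emeasure_complex_ball)
    show "AE u in lborel. norm (koch_shape c (u - p)) \<le> norm (indicator (ball p (6 * cmod c)) u :: real)"
    proof (rule AE_I2)
      fix u show "norm (koch_shape c (u - p)) \<le> norm (indicator (ball p (6 * cmod c)) u :: real)"
        using koch_shape_support[OF c, of "u - p"]
        by (cases "koch_shape c (u - p) = 0") (auto simp: dist_norm norm_minus_commute)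
    qed
  qed simp
  show Di: "integrable lborel (koch_disc P c)"
    unfolding koch_disc_def[abs_def] S_def[symmetric]
    by (intro Bochner_Integration.integrable_diff Bochner_Integration.integrable_sum ti integrable_mult_right Si)
  have FTt: "FT (\<lambda>x. koch_shape c (x - p)) y = cis (p \<bullet> y) * FT (koch_shape c) y" for p
  proof -
    have "FT (\<lambda>x. koch_shape c (x - p)) y = (LINT x|lborel. koch_shape c (p + x - p) *\<^sub>R cis ((p + x) \<bullet> y))"
      unfolding FT_def by (rule integral_lborel_translate[symmetric]) measurable
    also have "\<dots> = (LINT x|lborel. cis (p \<bullet> y) * (koch_shape c x *\<^sub>R cis (x \<bullet> y)))"
      by (simp add: inner_add_left cis_mult[symmetric])
    also have "\<dots> = cis (p \<bullet> y) * FT (koch_shape c) y" unfolding FT_def by (rule integral_mult_right_zero)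
    finally show ?thesis .
  qed
  have FTS: "FT S y = koch_FT y * FT (koch_shape c) y"
  proof -
    \<comment> \<open>The exponential is cut off to a ball \<open>B\<close> outside which
      \<open>S\<close> and all translates of the shape by points of the domain vanish. This makes it
      the integrable factor in Fubini, with the shape as bounded kernel.\<close>
    define k where "k z = complex_of_real (indicator B z) * cis (z \<bullet> y)" for z
    have ki: "integrable lborel k"
      unfolding k_def by (rule Bochner_Integration.integrable_bound[OF Bi]) (auto simp: norm_mult indicator_def B_def)
    have "FT S y = (LINT z|lborel. k z * (LINT x|lborel. indicator koch_domain x *\<^sub>R complex_of_real (koch_shape c (z - x))))"
      unfolding FT_def
    proof (rule Bochner_Integration.integral_cong[OF refl])
      fix z
      have "(LINT x|lborel. indicator koch_domain x *\<^sub>R complex_of_real (koch_shape c (z - x))) = (LINT x|lborel. complex_of_real (indicator koch_domain x * koch_shape c (z - x)))"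
        by (simp add: scaleR_conv_of_real)
      also have "\<dots> = of_real (S z)" unfolding S_def by (rule integral_complex_of_real)
      finally have e: "(LINT x|lborel. indicator koch_domain x *\<^sub>R complex_of_real (koch_shape c (z - x))) = of_real (S z)" .
      show "S z *\<^sub>R cis (z \<bullet> y) = k z * (LINT x|lborel. indicator koch_domain x *\<^sub>R complex_of_real (koch_shape c (z - x)))"
        unfolding e k_def using S0[of z] SB[of z] by (auto simp: indicator_def scaleR_conv_of_real)
    qed
    also have "\<dots> = (LINT x|lborel. indicator koch_domain x *\<^sub>R (LINT z|lborel. k z * complex_of_real (koch_shape c (z - x))))"
      by (rule Fubini_bounded_kernel[OF koch_indicator_integrable ki]) auto
    also have "\<dots> = (LINT x|lborel. (indicator koch_domain x *\<^sub>R cis (x \<bullet> y)) * FT (koch_shape c) y)"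
    proof (rule Bochner_Integration.integral_cong[OF refl])
      fix x
      show "indicator koch_domain x *\<^sub>R (LINT z|lborel. k z * complex_of_real (koch_shape c (z - x))) = (indicator koch_domain x *\<^sub>R cis (x \<bullet> y)) * FT (koch_shape c) y"
      proof (cases "x \<in> koch_domain")
        case True
        have "(LINT z|lborel. k z * complex_of_real (koch_shape c (z - x))) = FT (\<lambda>z. koch_shape c (z - x)) y"
          unfolding FT_def using inB[OF True]
          by (intro Bochner_Integration.integral_cong[OF refl]) (auto simp: k_def indicator_def scaleR_conv_of_real mult.commute)
        then show ?thesis using True by (simp add: FTt)
      qed simp
    qed
    also have "\<dots> = koch_FT y * FT (koch_shape c) y" unfolding FT_def by (rule integral_mult_left_zero)
    finally show ?thesis .
  qed
  have "FT (koch_disc P c) y = (LINT x|lborel. (\<Sum>p\<in>P. koch_shape c (x - p) *\<^sub>R cis (x \<bullet> y)) - of_real (real (card P) / koch_area) * (S x *\<^sub>R cis (x \<bullet> y)))"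
    unfolding FT_def koch_disc_def S_def[symmetric]
    by (intro Bochner_Integration.integral_cong[OF refl]) (simp add: scaleR_diff_left scaleR_sum_left scaleR_conv_of_real sum_distrib_left right_diff_distrib mult_ac)
  also have "\<dots> = (\<Sum>p\<in>P. FT (\<lambda>x. koch_shape c (x - p)) y) - of_real (real (card P) / koch_area) * FT S y"
  proof -
    have 1: "integrable lborel (\<lambda>x. \<Sum>p\<in>P. koch_shape c (x - p) *\<^sub>R cis (x \<bullet> y))"
      by (intro Bochner_Integration.integrable_sum FT_integrable[OF ti])
    have 2: "integrable lborel (\<lambda>x. complex_of_real (real (card P) / koch_area) * (S x *\<^sub>R cis (x \<bullet> y)))"
      by (rule integrable_mult_right[OF FT_integrable[OF Si]])
    show ?thesis
      unfolding FT_def Bochner_Integration.integral_diff[OF 1 2] Bochner_Integration.integral_sum[OF FT_integrable[OF ti]]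
        integral_mult_right_zero ..
  qed
  finally show "FT (koch_disc P c) y = FT (koch_shape c) y * ((\<Sum>p\<in>P. cis (p \<bullet> y)) - of_real (real (card P) / koch_area) * koch_FT y)"
    unfolding FTt FTS by (simp add: sum_distrib_left sum_distrib_right algebra_simps)
qed

section \<open>The lower bound\<close>

text \<open>The Fourier transform of the signed measure \<open>\<nu>\<close>, whose continuous part
  has density \<open>card P / koch_area\<close> on the domain.\<close>

definition koch_nu :: "complex set \<Rightarrow> complex \<Rightarrow> complex" where
  "koch_nu P y = (\<Sum>p\<in>P. cis (p \<bullet> y)) - of_real (real (card P) / koch_area) * koch_FT y"

lemma koch_nu_measurable [measurable]: "koch_nu P \<in> borel_measurable borel"
  unfolding koch_nu_def by measurable

lemma integral_le_nn_integral:
  assumes "integrable M h"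
  shows "ennreal (integral\<^sup>L M h) \<le> (\<integral>\<^sup>+x. ennreal (h x) \<partial>M)"
proof -
  have i: "integrable M (\<lambda>x. max 0 (h x))" using assms by simp
  have "ennreal (integral\<^sup>L M h) \<le> ennreal (integral\<^sup>L M (\<lambda>x. max 0 (h x)))"
    by (intro ennreal_leI integral_mono assms i) simp
  also have "\<dots> = (\<integral>\<^sup>+x. ennreal (max 0 (h x)) \<partial>M)"
    by (rule nn_integral_eq_integral[symmetric, OF i]) simp
  also have "\<dots> = (\<integral>\<^sup>+x. ennreal (h x) \<partial>M)"
    by (intro nn_integral_cong) (simp add: max_def ennreal_neg)
  finally show ?thesis .
qed

text \<open>The off-diagonal terms of the exponential sum contribute nonnegatively because the Fourier
  transform of a Gaussian is positive; so the \<open>N\<close> diagonal terms already dominate.\<close>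
lemma koch_nu_gauss_lower:
  assumes P: "finite P" "card P = N" "N > 0" and \<delta>: "\<delta> > 0" "\<delta>\<^sup>2 = koch_area / (8 * pi * real N)"
  shows "ennreal (8 * pi\<^sup>2 * (real N)\<^sup>2 / koch_area) \<le> (\<integral>\<^sup>+y. ennreal ((cmod (koch_nu P y))\<^sup>2 * gauss \<delta> y) \<partial>lborel)"
proof -
  define K where "K = real N / koch_area"
  have K0: "K \<ge> 0" using koch_area_pos by (simp add: K_def)
  define w where "w y = complex_of_real (gauss \<delta> y)" for y
  define S where "S y = (\<Sum>p\<in>P. cis (p \<bullet> y))" for y
  define G where "G p = (LINT x|lborel. indicator koch_domain x * gauss (1/\<delta>) (x - p))" for p
  \<comment> \<open>Expanding the square of \<open>koch_nu\<close>, the term K^2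
    |\<open>koch_FT\<close>|^2 is nonnegative and is dropped. Up to taking real parts,
    \<open>H\<close> is the point sum squared together with the cross term, both with explicit
    Gaussian integrals.\<close>
  define H where "H y = (\<Sum>p\<in>P. \<Sum>q\<in>P. cis ((p - q) \<bullet> y) * w y)
     - of_real (2 * K) * (\<Sum>p\<in>P. (cis (-(p \<bullet> y)) * w y) * koch_FT y)" for y
  have iF: "integrable lborel (\<lambda>y. (cis (-(p \<bullet> y)) * w y) * koch_FT y)" for p
  proof (rule Bochner_Integration.integrable_bound)
    show "integrable lborel (\<lambda>y. (LINT x|lborel. \<bar>indicator koch_domain x :: real\<bar>) * gauss \<delta> y)"
      using \<delta> by (intro integrable_mult_right gauss_integrable)
    show "AE y in lborel. norm ((cis (-(p \<bullet> y)) * w y) * koch_FT y) \<le> norm ((LINT x|lborel. \<bar>indicator koch_domain x :: real\<bar>) * gauss \<delta> y)"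
    proof (rule AE_I2)
      fix y
      have "cmod (koch_FT y) * gauss \<delta> y \<le> (LINT x|lborel. \<bar>indicator koch_domain x :: real\<bar>) * gauss \<delta> y"
        by (rule mult_right_mono[OF FT_bound[OF koch_indicator_integrable]]) simp
      then show "norm ((cis (-(p \<bullet> y)) * w y) * koch_FT y) \<le> norm ((LINT x|lborel. \<bar>indicator koch_domain x :: real\<bar>) * gauss \<delta> y)"
        by (simp add: norm_mult w_def mult.commute)
    qed
  qed (unfold w_def, measurable)
  have iS: "integrable lborel (\<lambda>y. cis ((p - q) \<bullet> y) * w y)" for p q
    unfolding w_def by (rule gauss_FT(1)[OF \<delta>(1)])
  have i1: "integrable lborel (\<lambda>y. \<Sum>p\<in>P. \<Sum>q\<in>P. cis ((p - q) \<bullet> y) * w y)"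
    by (intro Bochner_Integration.integrable_sum iS)
  have i2: "integrable lborel (\<lambda>y. of_real (2 * K) * (\<Sum>p\<in>P. (cis (-(p \<bullet> y)) * w y) * koch_FT y))"
    by (intro integrable_mult_right Bochner_Integration.integrable_sum iF)
  have iH: "integrable lborel H" unfolding H_def[abs_def] by (rule Bochner_Integration.integrable_diff[OF i1 i2])
  have "(LINT y|lborel. H y) = (\<Sum>p\<in>P. \<Sum>q\<in>P. of_real (2*pi/\<delta>\<^sup>2 * gauss (1/\<delta>) (p - q))) - of_real (2 * K) * (\<Sum>p\<in>P. of_real (2*pi/\<delta>\<^sup>2 * G p))"
  proof -
    have a: "(LINT y|lborel. (\<Sum>p\<in>P. \<Sum>q\<in>P. cis ((p - q) \<bullet> y) * w y)) = (\<Sum>p\<in>P. \<Sum>q\<in>P. of_real (2*pi/\<delta>\<^sup>2 * gauss (1/\<delta>) (p - q)))"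
      unfolding gauss_FT(2)[OF \<delta>(1), symmetric] w_def[symmetric]
      by (subst Bochner_Integration.integral_sum, intro Bochner_Integration.integrable_sum iS,
          subst Bochner_Integration.integral_sum, rule iS, rule refl)
    have b: "(LINT y|lborel. (\<Sum>p\<in>P. (cis (-(p \<bullet> y)) * w y) * koch_FT y)) = (\<Sum>p\<in>P. of_real (2*pi/\<delta>\<^sup>2 * G p))"
      unfolding G_def FT_gauss_inversion[OF koch_indicator_integrable \<delta>(1), symmetric] w_def[symmetric]
      by (rule Bochner_Integration.integral_sum[OF iF])
    show ?thesis unfolding H_def Bochner_Integration.integral_diff[OF i1 i2] integral_mult_right_zero a b ..
  qed
  then have "(LINT y|lborel. Re (H y)) = Re ((\<Sum>p\<in>P. \<Sum>q\<in>P. of_real (2*pi/\<delta>\<^sup>2 * gauss (1/\<delta>) (p - q))) - of_real (2 * K) * (\<Sum>p\<in>P. of_real (2*pi/\<delta>\<^sup>2 * G p)))"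
    using iH by simp
  also have "\<dots> = (\<Sum>p\<in>P. \<Sum>q\<in>P. 2*pi/\<delta>\<^sup>2 * gauss (1/\<delta>) (p - q)) - 2 * K * (\<Sum>p\<in>P. 2*pi/\<delta>\<^sup>2 * G p)"
    by (simp only: minus_complex.simps Re_sum Re_complex_of_real of_real_sum[symmetric] of_real_mult[symmetric])
  finally have intR: "(LINT y|lborel. Re (H y)) = (\<Sum>p\<in>P. \<Sum>q\<in>P. 2*pi/\<delta>\<^sup>2 * gauss (1/\<delta>) (p - q)) - 2 * K * (\<Sum>p\<in>P. 2*pi/\<delta>\<^sup>2 * G p)" .
  have diag: "real N * (2*pi/\<delta>\<^sup>2) \<le> (\<Sum>p\<in>P. \<Sum>q\<in>P. 2*pi/\<delta>\<^sup>2 * gauss (1/\<delta>) (p - q))"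
  proof -
    have "(\<Sum>p\<in>P. 2*pi/\<delta>\<^sup>2) \<le> (\<Sum>p\<in>P. \<Sum>q\<in>P. 2*pi/\<delta>\<^sup>2 * gauss (1/\<delta>) (p - q))"
    proof (rule sum_mono)
      fix p assume p: "p \<in> P"
      have "2*pi/\<delta>\<^sup>2 = 2*pi/\<delta>\<^sup>2 * gauss (1/\<delta>) (p - p)" by (simp add: gauss_def)
      also have "\<dots> \<le> (\<Sum>q\<in>P. 2*pi/\<delta>\<^sup>2 * gauss (1/\<delta>) (p - q))"
        by (rule member_le_sum[OF p]) (use P in auto)
      finally show "2*pi/\<delta>\<^sup>2 \<le> (\<Sum>q\<in>P. 2*pi/\<delta>\<^sup>2 * gauss (1/\<delta>) (p - q))" .
    qed
    then show ?thesis using P by simp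
  qed
  \<comment> \<open>\<open>G p\<close> is at most the mass 2 pi \<open>\<delta>\<close>^2 of its
    kernel, independently of the position of p.\<close>
  have Gle: "2*pi/\<delta>\<^sup>2 * G p \<le> 4 * pi\<^sup>2" for p
  proof -
    have d1: "1/\<delta> > 0" using \<delta> by simp
    have v: "(\<integral>\<^sup>+x. ennreal (gauss (1/\<delta>) (x - p)) \<partial>lborel) = ennreal (2 * pi * \<delta>\<^sup>2)"
      using gauss_nn_integral_shift[OF d1, of p] \<delta> by (simp add: power_divide)
    have "G p = enn2real (\<integral>\<^sup>+x. ennreal (indicator koch_domain x * gauss (1/\<delta>) (x - p)) \<partial>lborel)"
      unfolding G_def by (rule integral_eq_nn_integral) auto
    also have "\<dots> \<le> 2 * pi * \<delta>\<^sup>2"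
    proof (rule enn2real_leI)
      have "(\<integral>\<^sup>+x. ennreal (indicator koch_domain x * gauss (1/\<delta>) (x - p)) \<partial>lborel) \<le> (\<integral>\<^sup>+x. ennreal (gauss (1/\<delta>) (x - p)) \<partial>lborel)"
        by (intro nn_integral_mono ennreal_leI) (auto simp: indicator_def)
      then show "(\<integral>\<^sup>+x. ennreal (indicator koch_domain x * gauss (1/\<delta>) (x - p)) \<partial>lborel) \<le> ennreal (2 * pi * \<delta>\<^sup>2)" unfolding v .
    qed simp
    finally have "2*pi/\<delta>\<^sup>2 * G p \<le> 2*pi/\<delta>\<^sup>2 * (2 * pi * \<delta>\<^sup>2)" by (rule mult_left_mono) simp
    also have "\<dots> = 4 * pi\<^sup>2" using \<delta>(1) by (simp add: power2_eq_square)
    finally show ?thesis .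
  qed
  have "2 * K * (\<Sum>p\<in>P. 2*pi/\<delta>\<^sup>2 * G p) \<le> 2 * K * (\<Sum>p\<in>P. 4 * pi\<^sup>2)"
    using Gle K0 by (intro mult_left_mono sum_mono) auto
  also have "\<dots> = 8 * pi\<^sup>2 * (real N)\<^sup>2 / koch_area" using P by (simp add: K_def power2_eq_square)
  finally have cross: "2 * K * (\<Sum>p\<in>P. 2*pi/\<delta>\<^sup>2 * G p) \<le> 8 * pi\<^sup>2 * (real N)\<^sup>2 / koch_area" .
  \<comment> \<open>This explains the choice of \<open>\<delta>\<close>: the diagonal becomes
    exactly twice the bound for the cross term, so half of it survives.\<close>
  have "real N * (2*pi/\<delta>\<^sup>2) = 2 * (8 * pi\<^sup>2 * (real N)\<^sup>2 / koch_area)"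
    unfolding \<delta>(2) using P koch_area_pos by (simp add: power2_eq_square)
  with diag cross have low: "8 * pi\<^sup>2 * (real N)\<^sup>2 / koch_area \<le> (LINT y|lborel. Re (H y))"
    unfolding intR by linarith
  have pt: "Re (H y) \<le> (cmod (koch_nu P y))\<^sup>2 * gauss \<delta> y" for y
  proof -
    have "(\<Sum>p\<in>P. \<Sum>q\<in>P. cis ((p - q) \<bullet> y) * w y) = (S y * cnj (S y)) * w y"
    proof -
      have "cis ((p - q) \<bullet> y) = cis (p \<bullet> y) * cnj (cis (q \<bullet> y))" for p q
        by (simp add: inner_diff_left cis_cnj cis_mult)
      then have "(\<Sum>p\<in>P. \<Sum>q\<in>P. cis ((p - q) \<bullet> y) * w y) = (\<Sum>p\<in>P. \<Sum>q\<in>P. cis (p \<bullet> y) * cnj (cis (q \<bullet> y))) * w y"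
        by (simp only: sum_distrib_right)
      also have "(\<Sum>p\<in>P. \<Sum>q\<in>P. cis (p \<bullet> y) * cnj (cis (q \<bullet> y))) = S y * cnj (S y)"
        unfolding S_def cnj_sum sum_product ..
      finally show ?thesis .
    qed
    moreover have "(\<Sum>p\<in>P. (cis (-(p \<bullet> y)) * w y) * koch_FT y) = cnj (S y) * koch_FT y * w y"
      unfolding S_def cnj_sum sum_distrib_right by (simp add: cis_cnj mult_ac)
    ultimately have "H y = (S y * cnj (S y) - of_real (2 * K) * (cnj (S y) * koch_FT y)) * w y"
      unfolding H_def by (simp only: algebra_simps)
    then have 1: "Re (H y) = Re (S y * cnj (S y) - of_real (2 * K) * (cnj (S y) * koch_FT y)) * gauss \<delta> y"
      by (simp add: w_def)
    have "(cmod (S y - of_real K * koch_FT y))\<^sup>2 = Re (S y * cnj (S y) - of_real (2 * K) * (cnj (S y) * koch_FT y)) + K\<^sup>2 * (cmod (koch_FT y))\<^sup>2"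
      unfolding cmod_power2 by (simp add: power2_eq_square algebra_simps)
    then have "Re (S y * cnj (S y) - of_real (2 * K) * (cnj (S y) * koch_FT y)) \<le> (cmod (S y - of_real K * koch_FT y))\<^sup>2"
      using zero_le_power2[of "K * cmod (koch_FT y)"] by (simp add: power_mult_distrib)
    then show ?thesis
      unfolding 1 by (intro mult_right_mono) (auto simp: koch_nu_def S_def K_def P(2))
  qed
  have "ennreal (8 * pi\<^sup>2 * (real N)\<^sup>2 / koch_area) \<le> ennreal (LINT y|lborel. Re (H y))" by (rule ennreal_leI[OF low])
  also have "\<dots> \<le> (\<integral>\<^sup>+y. ennreal (Re (H y)) \<partial>lborel)"
    using iH by (intro integral_le_nn_integral integrable_Re)
  also have "\<dots> \<le> (\<integral>\<^sup>+y. ennreal ((cmod (koch_nu P y))\<^sup>2 * gauss \<delta> y) \<partial>lborel)"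
    by (intro nn_integral_mono ennreal_leI pt)
  finally show ?thesis .
qed

text \<open>The squared transform of the shape of a copy, averaged over rotations and integrated
  over dilations, as a function of the frequency. The factor \<open>\<tau>^4\<close> and the angle
  \<open>-\<theta>\<close> come from \<open>FT_koch_shape\<close> with c = \<open>\<tau>\<close> cis
  \<open>\<theta>\<close>.\<close>

definition koch_avg :: "real \<Rightarrow> real \<Rightarrow> complex \<Rightarrow> ennreal" where
  "koch_avg a b y = (\<integral>\<^sup>+\<tau>. indicator {a..b} \<tau> * (\<integral>\<^sup>+\<theta>. indicator {0..<2*pi} \<theta> * ennreal (1 / (2*pi)) *
     ennreal (\<tau>^4 * (cmod (koch_FT (of_real \<tau> * cis (-\<theta>) * y)))\<^sup>2) \<partial>lborel) \<partial>lborel)"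

text \<open>For each rotation and dilation the transform of the discrepancy factors, and
  \<open>FT_Bessel\<close> bounds its weighted mass. As \<open>koch_nu\<close> does not depend on
  the copy, Tonelli collects the other factor into \<open>koch_avg\<close>.\<close>

lemma koch_L2sq_lower:
  assumes P: "finite P" and a: "a > 0" and s: "s > 0"
  shows "(\<integral>\<^sup>+y. ennreal (1 / (4 * pi\<^sup>2)) * ennreal ((cmod (koch_nu P y))\<^sup>2 * gauss s y) * koch_avg a b y \<partial>lborel) \<le> koch_L2sq P a b"
proof -
  define W where "W y = ennreal (1 / (4 * pi\<^sup>2)) * ennreal ((cmod (koch_nu P y))\<^sup>2 * gauss s y)" for y
  have [measurable]: "W \<in> borel_measurable borel" unfolding W_def by measurable
  define U where "U \<tau> \<theta> y = ennreal (\<tau>^4 * (cmod (koch_FT (of_real \<tau> * cis (-\<theta>) * y)))\<^sup>2)" for \<tau> \<theta> y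
  have U_m[measurable]: "(\<lambda>x. U (f x) (g x) (h x)) \<in> borel_measurable M"
    if [measurable]: "f \<in> borel_measurable M" "g \<in> borel_measurable M" "h \<in> borel_measurable M" for M :: "'x measure" and f g h
    unfolding U_def by measurable
  have key: "(\<integral>\<^sup>+y. W y * U \<tau> \<theta> y \<partial>lborel) \<le> (\<integral>\<^sup>+ x. ennreal ((discrepancy P (koch_copy x \<tau> \<theta>))\<^sup>2) \<partial>lborel)"
    if \<tau>: "\<tau> \<in> {a..b}" for \<tau> \<theta>
  proof -
    define c where "c = of_real \<tau> * cis \<theta>"
    have t0: "\<tau> > 0" using \<tau> a by auto
    have c: "c \<noteq> 0" using t0 by (simp add: c_def cis_neq_zero)
    have cc: "cnj c = of_real \<tau> * cis (-\<theta>)" by (simp add: c_def cis_cnj)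
    have cm: "cmod c = \<tau>" using t0 by (simp add: c_def norm_mult)
    note Di = FT_koch_disc(1)[OF P c]
    have [measurable]: "koch_disc P c \<in> borel_measurable borel" using borel_measurable_integrable[OF Di] by simp
    have F: "(cmod (FT (koch_disc P c) y))\<^sup>2 = \<tau>^4 * (cmod (koch_FT (of_real \<tau> * cis (-\<theta>) * y)))\<^sup>2 * (cmod (koch_nu P y))\<^sup>2" for y
      unfolding FT_koch_disc(2)[OF P c] koch_nu_def[symmetric] norm_mult power_mult_distrib FT_koch_shape[OF c] cc cm ..
    have "(\<integral>\<^sup>+y. W y * U \<tau> \<theta> y \<partial>lborel) = (\<integral>\<^sup>+y. ennreal (1 / (4 * pi\<^sup>2)) * ennreal ((cmod (FT (koch_disc P c) y))\<^sup>2 * gauss s y) \<partial>lborel)"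
      unfolding F W_def U_def by (intro nn_integral_cong) (simp add: ennreal_mult''[symmetric] mult_ac)
    also have "\<dots> = ennreal (1 / (4 * pi\<^sup>2)) * (\<integral>\<^sup>+y. ennreal ((cmod (FT (koch_disc P c) y))\<^sup>2 * gauss s y) \<partial>lborel)"
      by (rule nn_integral_cmult) measurable
    also have "(\<integral>\<^sup>+y. ennreal ((cmod (FT (koch_disc P c) y))\<^sup>2 * gauss s y) \<partial>lborel) = ennreal (LINT y|lborel. (cmod (FT (koch_disc P c) y))\<^sup>2 * gauss s y)"
      by (rule nn_integral_eq_integral[OF integrable_FT_gauss[OF Di s]]) auto
    also have "ennreal (1 / (4 * pi\<^sup>2)) * \<dots> \<le> ennreal (1 / (4 * pi\<^sup>2)) * (ennreal (4 * pi\<^sup>2) * (\<integral>\<^sup>+x. ennreal ((koch_disc P c x)\<^sup>2) \<partial>lborel))"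
      by (rule mult_left_mono[OF FT_Bessel[OF Di s]]) simp
    also have "\<dots> = (\<integral>\<^sup>+x. ennreal ((koch_disc P c x)\<^sup>2) \<partial>lborel)"
      by (simp add: mult.assoc[symmetric] ennreal_mult[symmetric])
    also have "\<dots> = (\<integral>\<^sup>+ x. ennreal ((discrepancy P (koch_copy x \<tau> \<theta>))\<^sup>2) \<partial>lborel)"
      using t0 by (simp add: discrepancy_eq[OF P] c_def)
    finally show ?thesis .
  qed
  have "(\<integral>\<^sup>+y. W y * koch_avg a b y \<partial>lborel)
     = (\<integral>\<^sup>+y. \<integral>\<^sup>+\<tau>. indicator {a..b} \<tau> * (\<integral>\<^sup>+\<theta>. indicator {0..<2*pi} \<theta> * ennreal (1 / (2*pi)) * (W y * U \<tau> \<theta> y) \<partial>lborel) \<partial>lborel \<partial>lborel)"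
  proof (rule nn_integral_cong)
    fix y
    have "W y * koch_avg a b y = (\<integral>\<^sup>+\<tau>. W y * (indicator {a..b} \<tau> * (\<integral>\<^sup>+\<theta>. indicator {0..<2*pi} \<theta> * ennreal (1 / (2*pi)) * U \<tau> \<theta> y \<partial>lborel)) \<partial>lborel)"
      unfolding koch_avg_def U_def[symmetric] by (rule nn_integral_cmult[symmetric]) measurable
    also have "\<dots> = (\<integral>\<^sup>+\<tau>. indicator {a..b} \<tau> * (\<integral>\<^sup>+\<theta>. indicator {0..<2*pi} \<theta> * ennreal (1 / (2*pi)) * (W y * U \<tau> \<theta> y) \<partial>lborel) \<partial>lborel)"
    proof (rule nn_integral_cong)
      fix \<tau> :: real
      have "(\<integral>\<^sup>+\<theta>. indicator {0..<2*pi} \<theta> * ennreal (1 / (2*pi)) * (W y * U \<tau> \<theta> y) \<partial>lborel) = (\<integral>\<^sup>+\<theta>. W y * (indicator {0..<2*pi} \<theta> * ennreal (1 / (2*pi)) * U \<tau> \<theta> y) \<partial>lborel)"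
        by (simp only: mult_ac)
      also have "\<dots> = W y * (\<integral>\<^sup>+\<theta>. indicator {0..<2*pi} \<theta> * ennreal (1 / (2*pi)) * U \<tau> \<theta> y \<partial>lborel)"
        by (rule nn_integral_cmult) measurable
      finally show "W y * (indicator {a..b} \<tau> * (\<integral>\<^sup>+\<theta>. indicator {0..<2*pi} \<theta> * ennreal (1 / (2*pi)) * U \<tau> \<theta> y \<partial>lborel))
        = indicator {a..b} \<tau> * (\<integral>\<^sup>+\<theta>. indicator {0..<2*pi} \<theta> * ennreal (1 / (2*pi)) * (W y * U \<tau> \<theta> y) \<partial>lborel)"
        by (simp only: mult_ac)
    qed
    finally show "W y * koch_avg a b y = (\<integral>\<^sup>+\<tau>. indicator {a..b} \<tau> * (\<integral>\<^sup>+\<theta>. indicator {0..<2*pi} \<theta> * ennreal (1 / (2*pi)) * (W y * U \<tau> \<theta> y) \<partial>lborel) \<partial>lborel)" .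
  qed
  also have "\<dots> = (\<integral>\<^sup>+\<tau>. \<integral>\<^sup>+y. indicator {a..b} \<tau> * (\<integral>\<^sup>+\<theta>. indicator {0..<2*pi} \<theta> * ennreal (1 / (2*pi)) * (W y * U \<tau> \<theta> y) \<partial>lborel) \<partial>lborel \<partial>lborel)"
    by (rule lborel_pair.Fubini') measurable
  also have "\<dots> = (\<integral>\<^sup>+\<tau>. indicator {a..b} \<tau> * (\<integral>\<^sup>+\<theta>. indicator {0..<2*pi} \<theta> * ennreal (1 / (2*pi)) * (\<integral>\<^sup>+y. W y * U \<tau> \<theta> y \<partial>lborel) \<partial>lborel) \<partial>lborel)"
  proof (rule nn_integral_cong)
    fix \<tau> :: real
    have "(\<integral>\<^sup>+y. indicator {a..b} \<tau> * (\<integral>\<^sup>+\<theta>. indicator {0..<2*pi} \<theta> * ennreal (1 / (2*pi)) * (W y * U \<tau> \<theta> y) \<partial>lborel) \<partial>lborel)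
      = indicator {a..b} \<tau> * (\<integral>\<^sup>+y. \<integral>\<^sup>+\<theta>. indicator {0..<2*pi} \<theta> * ennreal (1 / (2*pi)) * (W y * U \<tau> \<theta> y) \<partial>lborel \<partial>lborel)"
      by (rule nn_integral_cmult) measurable
    also have "(\<integral>\<^sup>+y. \<integral>\<^sup>+\<theta>. indicator {0..<2*pi} \<theta> * ennreal (1 / (2*pi)) * (W y * U \<tau> \<theta> y) \<partial>lborel \<partial>lborel)
       = (\<integral>\<^sup>+\<theta>. \<integral>\<^sup>+y. indicator {0..<2*pi} \<theta> * ennreal (1 / (2*pi)) * (W y * U \<tau> \<theta> y) \<partial>lborel \<partial>lborel)"
      by (rule lborel_pair.Fubini') measurable
    also have "\<dots> = (\<integral>\<^sup>+\<theta>. indicator {0..<2*pi} \<theta> * ennreal (1 / (2*pi)) * (\<integral>\<^sup>+y. W y * U \<tau> \<theta> y \<partial>lborel) \<partial>lborel)"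
      by (intro nn_integral_cong nn_integral_cmult) measurable
    finally show "(\<integral>\<^sup>+y. indicator {a..b} \<tau> * (\<integral>\<^sup>+\<theta>. indicator {0..<2*pi} \<theta> * ennreal (1 / (2*pi)) * (W y * U \<tau> \<theta> y) \<partial>lborel) \<partial>lborel)
      = indicator {a..b} \<tau> * (\<integral>\<^sup>+\<theta>. indicator {0..<2*pi} \<theta> * ennreal (1 / (2*pi)) * (\<integral>\<^sup>+y. W y * U \<tau> \<theta> y \<partial>lborel) \<partial>lborel)" .
  qed
  also have "\<dots> \<le> koch_L2sq P a b"
    unfolding koch_L2sq_def
  proof (rule nn_integral_mono)
    fix \<tau> :: real
    show "indicator {a..b} \<tau> * (\<integral>\<^sup>+\<theta>. indicator {0..<2*pi} \<theta> * ennreal (1 / (2*pi)) * (\<integral>\<^sup>+y. W y * U \<tau> \<theta> y \<partial>lborel) \<partial>lborel)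
      \<le> indicator {a..b} \<tau> * (\<integral>\<^sup>+\<theta>. indicator {0..<2*pi} \<theta> * ennreal (1 / (2*pi)) * (\<integral>\<^sup>+ x. ennreal ((discrepancy P (koch_copy x \<tau> \<theta>))\<^sup>2) \<partial>lborel) \<partial>lborel)"
    proof (cases "\<tau> \<in> {a..b}")
      case True
      then show ?thesis by (intro mult_left_mono nn_integral_mono key) auto
    qed simp
  qed
  finally show ?thesis unfolding W_def .
qed

text \<open>The domain has norm below 6, so for |y| <= 1/12 the exponential differs from 1 by at
  most 1/2 on it, and the transform differs from the area by at most half the area.\<close>

lemma koch_FT_near_0:
  assumes "cmod y \<le> 1/12"
  shows "koch_area / 2 \<le> cmod (koch_FT y)"
proof -
  have i: "integrable lborel (\<lambda>x. (indicator koch_domain x :: real) *\<^sub>R (cis (x \<bullet> y) - 1))"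
    unfolding scaleR_diff_right by (rule Bochner_Integration.integrable_diff[OF FT_integrable[OF koch_indicator_integrable]])
      (intro integrable_scaleR_left koch_indicator_integrable)
  have "koch_FT y - of_real koch_area = (LINT x|lborel. indicator koch_domain x *\<^sub>R cis (x \<bullet> y)) - (LINT x|lborel. (indicator koch_domain x :: real) *\<^sub>R (1::complex))"
    unfolding FT_def by (subst integral_scaleR_left) (use koch_indicator_integrable in \<open>auto simp: scaleR_conv_of_real\<close>)
  also have "\<dots> = (LINT x|lborel. (indicator koch_domain x :: real) *\<^sub>R (cis (x \<bullet> y) - 1))"
    unfolding scaleR_diff_right
    by (rule Bochner_Integration.integral_diff[symmetric, OF FT_integrable[OF koch_indicator_integrable]])
      (intro integrable_scaleR_left koch_indicator_integrable)
  finally have "cmod (koch_FT y - of_real koch_area) \<le> (LINT x|lborel. norm ((indicator koch_domain x :: real) *\<^sub>R (cis (x \<bullet> y) - 1)))"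
    by (simp only: integral_norm_bound)
  also have "\<dots> \<le> (LINT x|lborel. indicator koch_domain x * (1/2))"
  proof (rule integral_mono[OF integrable_norm[OF i]])
    show "integrable lborel (\<lambda>x. indicator koch_domain x * (1/2::real))" by (rule integrable_mult_left[OF koch_indicator_integrable])
    fix x
    have "cmod (cis (x \<bullet> y) - 1) \<le> 1/2" if "x \<in> koch_domain"
    proof -
      have "cmod (cis (x \<bullet> y) - 1) \<le> \<bar>x \<bullet> y\<bar>"
        using iexp_approx1[of "x \<bullet> y" 0] by (simp add: cis_conv_exp)
      also have "\<dots> \<le> cmod x * cmod y" by (rule Cauchy_Schwarz_ineq2)
      also have "\<dots> \<le> 6 * (1/12)" using koch_domain_norm[OF that] assms by (intro mult_mono) auto
      finally show ?thesis by simp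
    qed
    then show "norm ((indicator koch_domain x :: real) *\<^sub>R (cis (x \<bullet> y) - 1)) \<le> indicator koch_domain x * (1/2)"
      by (auto simp: indicator_def)
  qed
  also have "\<dots> = koch_area / 2" by simp
  finally have "cmod (koch_FT y - of_real koch_area) \<le> koch_area / 2" .
  moreover have "koch_area \<le> cmod (koch_FT y) + cmod (koch_FT y - of_real koch_area)"
    using norm_triangle_ineq[of "koch_FT y" "of_real koch_area - koch_FT y"] by (simp add: norm_minus_commute)
  ultimately show ?thesis by linarith
qed

section \<open>Lower bounds for the averaged transform at every frequency\<close>

lemma circle_total: "(\<integral>\<^sup>+\<theta>. indicator {0..<2*pi} \<theta> * ennreal (1 / (2*pi)) \<partial>lborel) = 1"
proof -
  have "(\<integral>\<^sup>+\<theta>. indicator {0..<2*pi} \<theta> * ennreal (1 / (2*pi)) \<partial>lborel) = (\<integral>\<^sup>+\<theta>. ennreal (1 / (2*pi)) * indicator {0..<2*pi} \<theta> \<partial>lborel)"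
    by (simp only: mult.commute)
  also have "\<dots> = ennreal (1 / (2*pi)) * ennreal (2 * pi)" by (subst nn_integral_cmult_indicator) auto
  also have "\<dots> = 1" by (subst ennreal_mult[symmetric]) auto
  finally show ?thesis .
qed

text \<open>For |y| <= 1 the dilations in [a, 2a] move y into the ball where the transform is at
  least half the area; the weight a^4 and the length a of this interval give a^5.\<close>

lemma koch_avg_low:
  assumes a: "0 < a" "2 * a \<le> b" "2 * a \<le> 1/12" and y: "cmod y \<le> 1"
  shows "ennreal (a ^ 5 * koch_area\<^sup>2 / 4) \<le> koch_avg a b y"
proof -
  have "ennreal (a ^ 5 * koch_area\<^sup>2 / 4) = (\<integral>\<^sup>+\<tau>. ennreal (a^4 * koch_area\<^sup>2 / 4) * indicator {a..2*a} \<tau> \<partial>lborel)"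
    using a by (subst nn_integral_cmult_indicator) (auto simp: ennreal_mult''[symmetric] power_numeral_reduce mult_ac)
  also have "\<dots> \<le> koch_avg a b y"
    unfolding koch_avg_def
  proof (rule nn_integral_mono)
    fix \<tau> :: real
    show "ennreal (a^4 * koch_area\<^sup>2 / 4) * indicator {a..2*a} \<tau> \<le> indicator {a..b} \<tau> * (\<integral>\<^sup>+\<theta>. indicator {0..<2*pi} \<theta> * ennreal (1 / (2*pi)) *
       ennreal (\<tau>^4 * (cmod (koch_FT (of_real \<tau> * cis (-\<theta>) * y)))\<^sup>2) \<partial>lborel)"
    proof (cases "\<tau> \<in> {a..2*a}")
      case True
      have "ennreal (a^4 * koch_area\<^sup>2 / 4) = ennreal (a^4 * koch_area\<^sup>2 / 4) * (\<integral>\<^sup>+\<theta>. indicator {0..<2*pi} \<theta> * ennreal (1 / (2*pi)) \<partial>lborel)"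
        by (simp only: circle_total mult_1_right)
      also have "\<dots> = (\<integral>\<^sup>+\<theta>. ennreal (a^4 * koch_area\<^sup>2 / 4) * (indicator {0..<2*pi} \<theta> * ennreal (1 / (2*pi))) \<partial>lborel)"
        by (rule nn_integral_cmult[symmetric]) measurable
      also have "\<dots> \<le> (\<integral>\<^sup>+\<theta>. indicator {0..<2*pi} \<theta> * ennreal (1 / (2*pi)) *
         ennreal (\<tau>^4 * (cmod (koch_FT (of_real \<tau> * cis (-\<theta>) * y)))\<^sup>2) \<partial>lborel)"
      proof (rule nn_integral_mono)
        fix \<theta>
        have "cmod (of_real \<tau> * cis (-\<theta>) * y) = \<tau> * cmod y" using True a by (simp add: norm_mult)
        also have "\<dots> \<le> (1/12) * 1" using True a y by (intro mult_mono) auto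
        finally have "koch_area / 2 \<le> cmod (koch_FT (of_real \<tau> * cis (-\<theta>) * y))" by (intro koch_FT_near_0) simp
        then have "a^4 * (koch_area / 2)\<^sup>2 \<le> \<tau>^4 * (cmod (koch_FT (of_real \<tau> * cis (-\<theta>) * y)))\<^sup>2"
          using True a koch_area_pos by (intro mult_mono power_mono) auto
        then have "ennreal (a^4 * koch_area\<^sup>2 / 4) \<le> ennreal (\<tau>^4 * (cmod (koch_FT (of_real \<tau> * cis (-\<theta>) * y)))\<^sup>2)"
          by (intro ennreal_leI) (simp add: power_divide)
        then have "(indicator {0..<2*pi} \<theta> * ennreal (1 / (2*pi))) * ennreal (a^4 * koch_area\<^sup>2 / 4) \<le> (indicator {0..<2*pi} \<theta> * ennreal (1 / (2*pi))) * ennreal (\<tau>^4 * (cmod (koch_FT (of_real \<tau> * cis (-\<theta>) * y)))\<^sup>2)"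
          by (rule mult_left_mono) simp
        then show "ennreal (a^4 * koch_area\<^sup>2 / 4) * (indicator {0..<2*pi} \<theta> * ennreal (1 / (2*pi))) \<le> indicator {0..<2*pi} \<theta> * ennreal (1 / (2*pi)) *
         ennreal (\<tau>^4 * (cmod (koch_FT (of_real \<tau> * cis (-\<theta>) * y)))\<^sup>2)"
          by (simp only: mult.commute)
      qed
      finally show ?thesis using True a by (simp add: indicator_def)
    qed simp
  qed
  finally show ?thesis .
qed


text \<open>In polar coordinates the annulus of \<open>koch_FT_annulus\<close> is swept by the
  rotated and dilated copies of y. Since |y| lies between 3^k and 3^(k+1), only dilations between
  A/3 and B occur, and all of them belong to [a, b].\<close>

lemma koch_avg_high:
  assumes AB: "0 < A" "0 < c" "\<And>k. c * (4/9)^k \<le> (LINT y|lborel. indicator {y. A * 3^k \<le> cmod y \<and> cmod y \<le> B * 3^k} y * (cmod (koch_FT y))\<^sup>2)"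
    and a: "0 < a" "a \<le> A / 3" "B \<le> b" and y: "3^k \<le> cmod y" "cmod y \<le> 3^Suc k"
  shows "ennreal (a^3 * c / (72 * pi) * (4/81)^k) \<le> koch_avg a b y"
proof -
  define r where "r = cmod y"
  have "(0::real) < 3^k" by simp
  then have r: "r > 0" using y(1) unfolding r_def by linarith
  \<comment> \<open>Rotation by the direction of y and conjugation turn the polar point of radius
    \<open>r * \<tau>\<close> into the argument of the transform in \<open>koch_avg\<close>.\<close>
  define u where "u = y / of_real r"
  have u: "cmod u = 1" "u \<noteq> 0" using r by (auto simp: u_def r_def norm_divide)
  define g where "g z = (cmod (koch_FT z))\<^sup>2" for z
  have [measurable]: "g \<in> borel_measurable borel" unfolding g_def by measurable
  define ann where "ann = {z::complex. A * 3^k \<le> cmod z \<and> cmod z \<le> B * 3^k}"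
  have [measurable]: "ann \<in> sets borel" unfolding ann_def by measurable
  have [measurable]: "cnj \<in> borel_measurable borel" by (intro borel_measurable_continuous_onI continuous_intros)
  define V where "V \<tau> \<theta> = ennreal (\<tau>^4 * g (of_real \<tau> * cis (-\<theta>) * y))" for \<tau> \<theta>
  have V_m[measurable]: "(\<lambda>x. V (f x) (h x)) \<in> borel_measurable M"
    if [measurable]: "f \<in> borel_measurable M" "h \<in> borel_measurable M" for M :: "'x measure" and f h
    unfolding V_def by measurable
  have "ennreal (c * (4/9)^k) \<le> ennreal (LINT z|lborel. indicator ann z * g z)"
    unfolding ann_def g_def by (rule ennreal_leI[OF AB(3)])
  also have "\<dots> \<le> (\<integral>\<^sup>+z. ennreal (indicator ann z * g z) \<partial>lborel)"
  proof (cases "integrable lborel (\<lambda>z. indicator ann z * g z)")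
    case True then show ?thesis by (rule integral_le_nn_integral)
  qed (simp add: not_integrable_integral_eq)
  also have "\<dots> = (\<integral>\<^sup>+z. ennreal (indicator ann (u * z) * g (u * z)) \<partial>lborel)"
    using nn_integral_complex_mult[OF _ u(2), of "\<lambda>z. ennreal (indicator ann z * g z)"] u by simp
  also have "\<dots> = (\<integral>\<^sup>+z. ennreal (indicator ann (u * cnj z) * g (u * cnj z)) \<partial>lborel)"
    by (rule nn_integral_complex_cnj[symmetric]) measurable
  also have "\<dots> \<le> 4 * (\<integral>\<^sup>+\<theta>. indicator {0..<2*pi} \<theta> * (\<integral>\<^sup>+\<rho>. indicator {0<..} \<rho> * ennreal \<rho> * ennreal (indicator ann (u * cnj (of_real \<rho> * cis \<theta>)) * g (u * cnj (of_real \<rho> * cis \<theta>))) \<partial>lborel) \<partial>lborel)"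
    by (rule nn_integral_polar_le) measurable
  also have "\<dots> \<le> 4 * (\<integral>\<^sup>+\<theta>. indicator {0..<2*pi} \<theta> * (ennreal (r\<^sup>2 / a^3) * (\<integral>\<^sup>+\<tau>. indicator {a..b} \<tau> * V \<tau> \<theta> \<partial>lborel)) \<partial>lborel)"
  proof (intro mult_left_mono nn_integral_mono)
    fix \<theta> :: real
    have "(\<integral>\<^sup>+\<rho>. indicator {0<..} \<rho> * ennreal \<rho> * ennreal (indicator ann (u * cnj (of_real \<rho> * cis \<theta>)) * g (u * cnj (of_real \<rho> * cis \<theta>))) \<partial>lborel)
      = ennreal \<bar>r\<bar> * (\<integral>\<^sup>+\<tau>. indicator {0<..} (0 + r * \<tau>) * ennreal (0 + r * \<tau>) * ennreal (indicator ann (u * cnj (of_real (0 + r * \<tau>) * cis \<theta>)) * g (u * cnj (of_real (0 + r * \<tau>) * cis \<theta>))) \<partial>lborel)"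
      by (rule nn_integral_real_affine) (use r in auto)
    also have "\<dots> \<le> ennreal \<bar>r\<bar> * (\<integral>\<^sup>+\<tau>. ennreal (r / a^3) * (indicator {a..b} \<tau> * V \<tau> \<theta>) \<partial>lborel)"
    proof (intro mult_left_mono nn_integral_mono)
      fix \<tau> :: real
      have uc: "u * cnj (of_real (0 + r * \<tau>) * cis \<theta>) = of_real \<tau> * cis (-\<theta>) * y"
        using r by (simp add: u_def cis_cnj)
      have "ennreal (0 + r * \<tau>) * ennreal (indicator ann (of_real \<tau> * cis (-\<theta>) * y) * g (of_real \<tau> * cis (-\<theta>) * y)) \<le> ennreal (r / a^3) * (indicator {a..b} \<tau> * V \<tau> \<theta>)"
        if t: "\<tau> > 0"
      proof (cases "of_real \<tau> * cis (-\<theta>) * y \<in> ann")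
        case True
        then have tr: "A * 3^k \<le> \<tau> * r" "\<tau> * r \<le> B * 3^k"
          using t by (auto simp: ann_def norm_mult r_def)
        have k0: "(0::real) < 3^k" by simp
        have "A * 3^k \<le> \<tau> * 3^Suc k" using tr(1) y(2) t by (smt (verit) mult_left_mono r_def)
        then have "(A / 3) * (3 * 3^k) \<le> \<tau> * (3 * 3^k)" by simp
        then have "A / 3 \<le> \<tau>" using k0 by (simp only: mult_le_cancel_right_pos mult_pos_pos zero_less_numeral)
        then have ta: "a \<le> \<tau>" using a by linarith
        have "\<tau> * 3^k \<le> \<tau> * r" using y(1) t by (intro mult_left_mono) (auto simp: r_def)
        then have "\<tau> * 3^k \<le> B * 3^k" using tr(2) by linarith
        then have "\<tau> \<le> b" using a(3) by simp
        \<comment> \<open>The polar weight carries one power of \<open>\<tau>\<close>, the average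
          four; as \<open>\<tau>\<close> is at least a, the exchange costs a^-3.\<close>
        have "a^3 * 1 \<le> \<tau>^3 * 1" using ta a by (intro mult_right_mono power_mono) auto
        then have "1 \<le> \<tau>^3 / a^3" using a by simp
        then have "(r * \<tau> * g (of_real \<tau> * cis (-\<theta>) * y)) * 1 \<le> (r * \<tau> * g (of_real \<tau> * cis (-\<theta>) * y)) * (\<tau>^3 / a^3)"
          using r t by (intro mult_left_mono) (auto simp: g_def)
        then have "r * \<tau> * g (of_real \<tau> * cis (-\<theta>) * y) \<le> r / a^3 * (\<tau>^4 * g (of_real \<tau> * cis (-\<theta>) * y))"
          by (simp add: power_numeral_reduce mult_ac)
        then have "ennreal (r * \<tau> * g (of_real \<tau> * cis (-\<theta>) * y)) \<le> ennreal (r / a^3 * (\<tau>^4 * g (of_real \<tau> * cis (-\<theta>) * y)))"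
          by (rule ennreal_leI)
        moreover have "ennreal (r / a^3 * (\<tau>^4 * g (of_real \<tau> * cis (-\<theta>) * y))) = ennreal (r / a^3) * V \<tau> \<theta>"
          unfolding V_def by (rule ennreal_mult'') (simp add: g_def)
        moreover have "ennreal (r * \<tau> * g (of_real \<tau> * cis (-\<theta>) * y)) = ennreal (r * \<tau>) * ennreal (g (of_real \<tau> * cis (-\<theta>) * y))"
          by (rule ennreal_mult'') (simp add: g_def)
        ultimately show ?thesis using True ta \<open>\<tau> \<le> b\<close> by simp
      qed simp
      then show "indicator {0<..} (0 + r * \<tau>) * ennreal (0 + r * \<tau>) * ennreal (indicator ann (u * cnj (of_real (0 + r * \<tau>) * cis \<theta>)) * g (u * cnj (of_real (0 + r * \<tau>) * cis \<theta>))) \<le> ennreal (r / a^3) * (indicator {a..b} \<tau> * V \<tau> \<theta>)"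
        unfolding uc using r by (auto simp: indicator_def zero_less_mult_iff)
    qed simp
    also have "\<dots> = ennreal (r\<^sup>2 / a^3) * (\<integral>\<^sup>+\<tau>. indicator {a..b} \<tau> * V \<tau> \<theta> \<partial>lborel)"
    proof -
      have "(\<integral>\<^sup>+\<tau>. ennreal (r / a^3) * (indicator {a..b} \<tau> * V \<tau> \<theta>) \<partial>lborel) = ennreal (r / a^3) * (\<integral>\<^sup>+\<tau>. indicator {a..b} \<tau> * V \<tau> \<theta> \<partial>lborel)"
        by (rule nn_integral_cmult) measurable
      moreover have "ennreal \<bar>r\<bar> * ennreal (r / a^3) = ennreal (r\<^sup>2 / a^3)"
        using r a by (simp add: ennreal_mult''[symmetric] power2_eq_square)
      ultimately show ?thesis by (simp only: mult.assoc[symmetric])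
    qed
    finally show "(\<integral>\<^sup>+\<rho>. indicator {0<..} \<rho> * ennreal \<rho> * ennreal (indicator ann (u * cnj (of_real \<rho> * cis \<theta>)) * g (u * cnj (of_real \<rho> * cis \<theta>))) \<partial>lborel)
      \<le> ennreal (r\<^sup>2 / a^3) * (\<integral>\<^sup>+\<tau>. indicator {a..b} \<tau> * V \<tau> \<theta> \<partial>lborel)" .
  qed simp_all
  also have "\<dots> = ennreal (8 * pi * r\<^sup>2 / a^3) * koch_avg a b y"
  proof -
    have "koch_avg a b y = (\<integral>\<^sup>+\<tau>. \<integral>\<^sup>+\<theta>. indicator {a..b} \<tau> * (indicator {0..<2*pi} \<theta> * ennreal (1 / (2*pi)) * V \<tau> \<theta>) \<partial>lborel \<partial>lborel)"
      unfolding koch_avg_def g_def[symmetric] V_def[symmetric]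
      by (intro nn_integral_cong nn_integral_cmult[symmetric]) measurable
    also have "\<dots> = (\<integral>\<^sup>+\<theta>. \<integral>\<^sup>+\<tau>. indicator {a..b} \<tau> * (indicator {0..<2*pi} \<theta> * ennreal (1 / (2*pi)) * V \<tau> \<theta>) \<partial>lborel \<partial>lborel)"
      by (rule lborel_pair.Fubini') measurable
    also have "\<dots> = (\<integral>\<^sup>+\<theta>. \<integral>\<^sup>+\<tau>. (ennreal (1 / (2*pi)) * indicator {0..<2*pi} \<theta>) * (indicator {a..b} \<tau> * V \<tau> \<theta>) \<partial>lborel \<partial>lborel)"
      by (simp only: mult_ac)
    also have "\<dots> = (\<integral>\<^sup>+\<theta>. (ennreal (1 / (2*pi)) * indicator {0..<2*pi} \<theta>) * (\<integral>\<^sup>+\<tau>. indicator {a..b} \<tau> * V \<tau> \<theta> \<partial>lborel) \<partial>lborel)"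
      by (intro nn_integral_cong nn_integral_cmult) measurable
    finally have avg: "koch_avg a b y = (\<integral>\<^sup>+\<theta>. (ennreal (1 / (2*pi)) * indicator {0..<2*pi} \<theta>) * (\<integral>\<^sup>+\<tau>. indicator {a..b} \<tau> * V \<tau> \<theta> \<partial>lborel) \<partial>lborel)" .
    have "ennreal (8 * pi * r\<^sup>2 / a^3) * koch_avg a b y = (\<integral>\<^sup>+\<theta>. ennreal (8 * pi * r\<^sup>2 / a^3) * ((ennreal (1 / (2*pi)) * indicator {0..<2*pi} \<theta>) * (\<integral>\<^sup>+\<tau>. indicator {a..b} \<tau> * V \<tau> \<theta> \<partial>lborel)) \<partial>lborel)"
      unfolding avg by (rule nn_integral_cmult[symmetric]) measurable
    also have "\<dots> = (\<integral>\<^sup>+\<theta>. 4 * (indicator {0..<2*pi} \<theta> * (ennreal (r\<^sup>2 / a^3) * (\<integral>\<^sup>+\<tau>. indicator {a..b} \<tau> * V \<tau> \<theta> \<partial>lborel))) \<partial>lborel)"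
    proof (rule nn_integral_cong)
      fix \<theta> :: real
      have "ennreal (8 * pi * r\<^sup>2 / a^3) * ennreal (1 / (2*pi)) = ennreal (4 * (r\<^sup>2 / a^3))"
        using a by (subst ennreal_mult''[symmetric]) auto
      also have "\<dots> = 4 * ennreal (r\<^sup>2 / a^3)" using a by (subst ennreal_mult) auto
      finally have e: "ennreal (8 * pi * r\<^sup>2 / a^3) * ennreal (1 / (2*pi)) = 4 * ennreal (r\<^sup>2 / a^3)" .
      have "X * ((Y * I) * J) = 4 * (I * (Z * J))" if "X * Y = 4 * Z" for X Y Z I J :: ennreal
      proof -
        have "X * ((Y * I) * J) = (X * Y) * (I * J)" by (simp only: mult_ac)
        also have "\<dots> = 4 * (I * (Z * J))" unfolding that by (simp only: mult_ac)
        finally show ?thesis .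
      qed
      from this[OF e] show "ennreal (8 * pi * r\<^sup>2 / a^3) * ((ennreal (1 / (2*pi)) * indicator {0..<2*pi} \<theta>) * (\<integral>\<^sup>+\<tau>. indicator {a..b} \<tau> * V \<tau> \<theta> \<partial>lborel))
        = 4 * (indicator {0..<2*pi} \<theta> * (ennreal (r\<^sup>2 / a^3) * (\<integral>\<^sup>+\<tau>. indicator {a..b} \<tau> * V \<tau> \<theta> \<partial>lborel)))" .
    qed
    also have "\<dots> = 4 * (\<integral>\<^sup>+\<theta>. indicator {0..<2*pi} \<theta> * (ennreal (r\<^sup>2 / a^3) * (\<integral>\<^sup>+\<tau>. indicator {a..b} \<tau> * V \<tau> \<theta> \<partial>lborel)) \<partial>lborel)"
      by (rule nn_integral_cmult) measurable
    finally show ?thesis ..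
  qed
  finally have main: "ennreal (c * (4/9)^k) \<le> ennreal (8 * pi * r\<^sup>2 / a^3) * koch_avg a b y" .
  define q where "q = a^3 / (8 * pi * r\<^sup>2)"
  have q: "q \<ge> 0" using a by (simp add: q_def)
  have "ennreal q * ennreal (c * (4/9)^k) \<le> ennreal q * (ennreal (8 * pi * r\<^sup>2 / a^3) * koch_avg a b y)"
    by (rule mult_left_mono[OF main]) simp
  also have "\<dots> = (ennreal q * ennreal (8 * pi * r\<^sup>2 / a^3)) * koch_avg a b y" by (simp only: mult.assoc)
  also have "ennreal q * ennreal (8 * pi * r\<^sup>2 / a^3) = 1"
    using a r by (subst ennreal_mult''[symmetric]) (auto simp: q_def)
  finally have "ennreal (q * (c * (4/9)^k)) \<le> koch_avg a b y" using AB by (simp add: ennreal_mult'')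
  \<comment> \<open>The squared radius is at most 9 * 9^k: this gives 72 pi = 9 * 8 pi and turns
    (4/9)^k into (4/81)^k.\<close>
  moreover have "a^3 * c / (72 * pi) * (4/81)^k \<le> q * (c * (4/9)^k)"
  proof -
    have "r\<^sup>2 \<le> (3^Suc k)\<^sup>2" using y(2) r by (intro power_mono) (auto simp: r_def)
    also have "(3^Suc k)\<^sup>2 = 9 * (9::real)^k" by (simp add: power2_eq_square flip: power_mult_distrib)
    finally have "a^3 / (8 * pi * (9 * 9^k)) \<le> q"
      unfolding q_def using a r by (intro divide_left_mono mult_left_mono) auto
    then have "a^3 / (8 * pi * (9 * 9^k)) * (c * (4/9)^k) \<le> q * (c * (4/9)^k)"
      using AB by (intro mult_right_mono) auto
    moreover have "(4/9)^k / 9^k = (4/81::real)^k" by (simp flip: power_divide)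
    then have "a^3 / (8 * pi * (9 * 9^k)) * (c * (4/9)^k) = a^3 * c / (72 * pi) * (4/81)^k"
      by (simp add: field_simps)
    ultimately show ?thesis by simp
  qed
  ultimately show ?thesis using ennreal_leI order_trans by (meson)
qed

lemma power_scale:
  assumes "1 \<le> (x::real)" "1 < b"
  obtains k where "b^k \<le> x" "x < b^Suc k"
proof -
  define n where "n = (LEAST n. x < b ^ n)"
  have ex: "\<exists>n. x < b ^ n" using real_arch_pow assms by blast
  have 1: "x < b ^ n" unfolding n_def by (rule LeastI_ex[OF ex])
  then obtain k where k: "n = Suc k" using assms by (cases n) auto
  then have "\<not> x < b ^ k" using not_less_Least[of k "\<lambda>n. x < b ^ n"] by (simp add: n_def)
  then show ?thesis using that[of k] 1 k by simp
qed

text \<open>The point is a single bound for \<open>koch_avg\<close>, valid at all frequencies, by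
  (4/81)^n times a Gaussian. Inserted into \<open>koch_L2sq_lower\<close> it leaves (4/81)^n N^2 up
  to constants, and N >= 9^n makes this at least 4^n.\<close>

lemma koch_lower_bound:
  obtains a b c where "0 < a" "a < b" "0 < c"
    "\<And>P N n. finite P \<Longrightarrow> card P = N \<Longrightarrow> 9^n \<le> N \<Longrightarrow> N < 9^Suc n \<Longrightarrow> ennreal (c * 4^n) \<le> koch_L2sq P a b"
proof -
  obtain A B c1 where AB: "0 < A" "0 < B" "0 < c1"
    "\<And>k. c1 * (4/9)^k \<le> (LINT y|lborel. indicator {y. A * 3^k \<le> cmod y \<and> cmod y \<le> B * 3^k} y * (cmod (koch_FT y))\<^sup>2)"
    using koch_FT_annulus by blast
  define a where "a = min (A / 3) (1/24)"
  define b where "b = max B (2 * a)"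
  have a: "0 < a" "a \<le> A / 3" "2 * a \<le> 1/12" using AB by (auto simp: a_def)
  have b: "B \<le> b" "2 * a \<le> b" by (auto simp: b_def)
  define cl where "cl = a ^ 5 * koch_area\<^sup>2 / 4"
  define ch where "ch = a^3 * c1 / (72 * pi)"
  \<comment> \<open>Here 288 = 8 * 9 * 4: the 8 is from \<open>\<delta>\<close>, the 9 from N <
    9^(n+1), and the 4 from s^2/2 = \<open>\<delta>\<close>^2/4.\<close>
  define \<kappa> where "\<kappa> = koch_area / (288 * pi)"
  have \<kappa>: "\<kappa> > 0" using koch_area_pos by (simp add: \<kappa>_def)
  \<comment> \<open>One entry for each range: |y| <= 1, shells with k <= n, and shells with k >
    n.\<close>
  define c2 where "c2 = min cl (min ch (ch * \<kappa>\<^sup>2 / 2))"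
  have cl: "cl > 0" and ch: "ch > 0" using a AB koch_area_pos by (auto simp: cl_def ch_def)
  have c2: "c2 > 0" "c2 \<le> cl" "c2 \<le> ch" "c2 \<le> ch * \<kappa>\<^sup>2 / 2" using cl ch \<kappa> by (auto simp: c2_def)
  show ?thesis
  proof (rule that[of a b "2 * c2 / koch_area"])
    show "0 < a" "a < b" using a b by auto
    show "0 < 2 * c2 / koch_area" using c2 koch_area_pos by simp
    fix P :: "complex set" and N n :: nat
    assume P: "finite P" "card P = N" and N: "9^n \<le> N" "N < 9^Suc n"
    have N0: "N > 0" using N(1) by (metis gr0I not_less zero_less_numeral zero_less_power)
    have Nr: "9^n \<le> real N" "real N < 9^Suc n"
      using N by (metis of_nat_le_iff of_nat_numeral of_nat_power, metis of_nat_less_iff of_nat_numeral of_nat_power)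
    define \<delta> where "\<delta> = sqrt (koch_area / (8 * pi * real N))"
    have \<delta>: "\<delta> > 0" "\<delta>\<^sup>2 = koch_area / (8 * pi * real N)" using koch_area_pos N0 by (auto simp: \<delta>_def)
    \<comment> \<open>The Gaussian of parameter \<open>\<delta>\<close> is the square of the one of
      parameter s: one factor is the damping in \<open>FT_Bessel\<close>, the other is used up in
      bounding \<open>koch_avg\<close>.\<close>
    define s where "s = \<delta> / sqrt 2"
    have s: "s > 0" using \<delta> by (simp add: s_def)
    have ss: "gauss s y * gauss s y = gauss \<delta> y" for y
      unfolding gauss_def exp_add[symmetric] by (simp add: s_def power_divide field_simps)
    have avg: "ennreal (c2 * (4/81)^n * gauss s y) \<le> koch_avg a b y" for y
    proof (cases "cmod y \<le> 1")
      case True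
      have "c2 * (4/81)^n * gauss s y \<le> cl * 1 * 1"
        using c2 cl by (intro mult_mono power_le_one gauss_le_1) auto
      then have "ennreal (c2 * (4/81)^n * gauss s y) \<le> ennreal cl" by (intro ennreal_leI) simp
      also have "\<dots> \<le> koch_avg a b y" unfolding cl_def by (rule koch_avg_low) (use a b True in auto)
      finally show ?thesis .
    next
      case False
      then obtain k where k: "3^k \<le> cmod y" "cmod y < 3^Suc k" using power_scale[of "cmod y" 3] by auto
      have "c2 * (4/81)^n * gauss s y \<le> ch * (4/81)^k"
      proof (cases "k \<le> n")
        case True
        have "c2 * (4/81)^n * gauss s y \<le> ch * (4/81)^k * 1"
          using c2 ch True by (intro mult_mono power_decreasing gauss_le_1) auto
        then show ?thesis by simp
      next
        \<comment> \<open>Beyond radius 3^n the bound for the average loses (4/81)^j, but the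
          Gaussian is at most exp(-\<open>\<kappa>\<close> 9^j), hence at most 2 /
          (\<open>\<kappa>\<close> 9^j)^2, a constant times (1/81)^j.\<close>
        case kn: False
        then obtain j where j: "k = n + j" using less_imp_add_positive[of n k] by (auto simp: not_le)
        define x where "x = (9::real)^j"
        have x0: "x > 0" by (simp add: x_def)
        have "\<kappa> * x \<le> s\<^sup>2 * (cmod y)\<^sup>2 / 2"
        proof -
          have "(3^k)\<^sup>2 \<le> (cmod y)\<^sup>2" using k by (intro power_mono) auto
          moreover have "((3::real)^k)\<^sup>2 = 9^n * x"
            by (simp add: power2_eq_square x_def j flip: power_mult_distrib power_add)
          ultimately have "9^n * x \<le> (cmod y)\<^sup>2" by simp
          then have "\<delta>\<^sup>2 / 4 * (9^n * x) \<le> \<delta>\<^sup>2 / 4 * (cmod y)\<^sup>2" by (intro mult_left_mono) auto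
          moreover have "\<kappa> * x \<le> \<delta>\<^sup>2 / 4 * (9^n * x)"
          proof -
            have "koch_area / (8 * pi * 9^Suc n) \<le> \<delta>\<^sup>2"
              unfolding \<delta>(2) using Nr koch_area_pos N0 by (intro divide_left_mono mult_left_mono) auto
            then have "koch_area / (8 * pi * 9^Suc n) / 4 * (9^n * x) \<le> \<delta>\<^sup>2 / 4 * (9^n * x)"
              using x0 by (intro mult_right_mono divide_right_mono) auto
            moreover have "koch_area / (8 * pi * 9^Suc n) / 4 * (9^n * x) = \<kappa> * x" by (simp add: \<kappa>_def)
            ultimately show ?thesis by (simp only:)
          qed
          moreover have "s\<^sup>2 * (cmod y)\<^sup>2 / 2 = \<delta>\<^sup>2 / 4 * (cmod y)\<^sup>2" by (simp add: s_def power_divide)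
          ultimately show ?thesis by linarith
        qed
        then have "gauss s y \<le> exp (-(\<kappa> * x))" unfolding gauss_def by simp
        moreover have "\<kappa>\<^sup>2 / 2 * exp (-(\<kappa> * x)) \<le> (1/81)^j"
        proof -
          have "(\<kappa> * x)\<^sup>2 / 2 \<le> exp (\<kappa> * x)"
          proof -
            have "0 < \<kappa> * x" using \<kappa> x0 by simp
            then show ?thesis using exp_lower_Taylor_quadratic[of "\<kappa> * x"] by linarith
          qed
          then have "\<kappa>\<^sup>2 / 2 * x\<^sup>2 * exp (-(\<kappa> * x)) \<le> exp (\<kappa> * x) * exp (-(\<kappa> * x))"
            by (intro mult_right_mono) (auto simp: power_mult_distrib)
          then have "\<kappa>\<^sup>2 / 2 * x\<^sup>2 * exp (-(\<kappa> * x)) \<le> 1" by (simp add: exp_minus)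
          then have "\<kappa>\<^sup>2 / 2 * exp (-(\<kappa> * x)) \<le> 1 / x\<^sup>2" using x0 by (simp add: field_simps)
          also have "1 / x\<^sup>2 = (1/81)^j" by (simp add: x_def power2_eq_square power_divide flip: power_mult_distrib)
          finally show ?thesis .
        qed
        ultimately have "\<kappa>\<^sup>2 / 2 * gauss s y \<le> (1/81)^j" by (smt (verit) mult_left_mono zero_le_power2 divide_nonneg_nonneg)
        also have "\<dots> \<le> (4/81)^j" by (intro power_mono) auto
        finally have g: "ch * (\<kappa>\<^sup>2 / 2 * gauss s y) \<le> ch * (4/81)^j" using ch by (intro mult_left_mono) auto
        have "c2 * (4/81)^n * gauss s y \<le> (ch * \<kappa>\<^sup>2 / 2) * (4/81)^n * gauss s y"
          using c2 by (intro mult_right_mono) auto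
        also have "\<dots> = (4/81)^n * (ch * (\<kappa>\<^sup>2 / 2 * gauss s y))" by simp
        also have "\<dots> \<le> (4/81)^n * (ch * (4/81)^j)" by (rule mult_left_mono[OF g]) simp
        also have "\<dots> = ch * (4/81)^k" by (simp add: j power_add)
        finally show ?thesis .
      qed
      then have "ennreal (c2 * (4/81)^n * gauss s y) \<le> ennreal (ch * (4/81)^k)" by (rule ennreal_leI)
      also have "\<dots> \<le> koch_avg a b y" unfolding ch_def
        by (rule koch_avg_high[OF AB(1,3,4) a(1,2) b(1)]) (use k in auto)
      finally show ?thesis .
    qed
    define w where "w = 1 / (4 * pi\<^sup>2) * (c2 * (4/81)^n)"
    have w: "w \<ge> 0" using c2 by (simp add: w_def)
    have "2 * c2 / koch_area * 4^n \<le> w * (8 * pi\<^sup>2 * (real N)\<^sup>2 / koch_area)"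
    proof -
      have "4^n = (4/81)^n * ((9::real)^n)\<^sup>2" by (simp add: power2_eq_square flip: power_mult_distrib)
      also have "\<dots> \<le> (4/81)^n * (real N)\<^sup>2" using Nr by (intro mult_left_mono power_mono) auto
      finally have "2 * c2 / koch_area * 4^n \<le> 2 * c2 / koch_area * ((4/81)^n * (real N)\<^sup>2)"
        using c2 koch_area_pos by (intro mult_left_mono) auto
      also have "\<dots> = w * (8 * pi\<^sup>2 * (real N)\<^sup>2 / koch_area)" by (simp add: w_def)
      finally show ?thesis .
    qed
    then have "ennreal (2 * c2 / koch_area * 4^n) \<le> ennreal w * ennreal (8 * pi\<^sup>2 * (real N)\<^sup>2 / koch_area)"
      using w koch_area_pos by (subst ennreal_mult''[symmetric]) (auto intro: ennreal_leI)
    also have "\<dots> \<le> ennreal w * (\<integral>\<^sup>+y. ennreal ((cmod (koch_nu P y))\<^sup>2 * gauss \<delta> y) \<partial>lborel)"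
      by (rule mult_left_mono[OF koch_nu_gauss_lower[OF P N0 \<delta>]]) simp
    also have "\<dots> = (\<integral>\<^sup>+y. ennreal w * ennreal ((cmod (koch_nu P y))\<^sup>2 * gauss \<delta> y) \<partial>lborel)"
      by (rule nn_integral_cmult[symmetric]) measurable
    also have "\<dots> \<le> (\<integral>\<^sup>+y. ennreal (1 / (4 * pi\<^sup>2)) * ennreal ((cmod (koch_nu P y))\<^sup>2 * gauss s y) * koch_avg a b y \<partial>lborel)"
    proof (rule nn_integral_mono)
      fix y
      have "ennreal w * ennreal ((cmod (koch_nu P y))\<^sup>2 * gauss \<delta> y)
        = ennreal (1 / (4 * pi\<^sup>2) * ((cmod (koch_nu P y))\<^sup>2 * gauss s y) * (c2 * (4/81)^n * gauss s y))"
        using w by (simp add: ennreal_mult''[symmetric] w_def flip: ss) (simp add: mult_ac)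
      also have "\<dots> = ennreal (1 / (4 * pi\<^sup>2)) * ennreal ((cmod (koch_nu P y))\<^sup>2 * gauss s y) * ennreal (c2 * (4/81)^n * gauss s y)"
      proof -
        have *: "ennreal (u * v * t) = ennreal u * ennreal v * ennreal t" if "0 \<le> u" "0 \<le> v" "0 \<le> t" for u v t
          using that by (simp add: ennreal_mult)
        show ?thesis by (rule *) (use c2 in auto)
      qed
      also have "\<dots> \<le> ennreal (1 / (4 * pi\<^sup>2)) * ennreal ((cmod (koch_nu P y))\<^sup>2 * gauss s y) * koch_avg a b y"
        by (rule mult_left_mono[OF avg]) simp
      finally show "ennreal w * ennreal ((cmod (koch_nu P y))\<^sup>2 * gauss \<delta> y) \<le> ennreal (1 / (4 * pi\<^sup>2)) * ennreal ((cmod (koch_nu P y))\<^sup>2 * gauss s y) * koch_avg a b y" .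
    qed
    also have "\<dots> \<le> koch_L2sq P a b" by (rule koch_L2sq_lower[OF P(1) a(1) s])
    finally show "ennreal (2 * c2 / koch_area * 4^n) \<le> koch_L2sq P a b" .
  qed
qed

section \<open>Sampling with small variance\<close>

text \<open>If \<open>z\<close> is uniform on \<open>A\<close>, the mean over \<open>z\<close> of the left-hand side is the right-hand side.\<close>
lemma sampling_step:
  fixes w :: "'r::euclidean_space \<Rightarrow> ennreal" and hit :: "'r \<Rightarrow> complex \<Rightarrow> real" and S :: "'r \<Rightarrow> real"
  assumes [measurable]: "w \<in> borel_measurable borel" "S \<in> borel_measurable borel" "A \<in> sets borel"
    and hitm[measurable]: "(\<lambda>(r, z). hit r z) \<in> borel_measurable (borel \<Otimes>\<^sub>M borel)"
    and hit01: "\<And>r z. hit r z = 0 \<or> hit r z = 1"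
    and A: "emeasure lborel A < \<infinity>" "measure lborel A > 0" and F: "finite F"
    and p: "\<And>r. p r = (LINT z|lborel. indicator A z * hit r z) / measure lborel A"
  shows "\<exists>z\<in>A - F. (\<integral>\<^sup>+r. w r * ennreal ((S r + hit r z - p r)\<^sup>2) \<partial>lborel)
    \<le> (\<integral>\<^sup>+r. w r * ennreal ((S r)\<^sup>2) \<partial>lborel) + (\<integral>\<^sup>+r. w r * ennreal (p r * (1 - p r)) \<partial>lborel)"
proof (rule ccontr)
  assume neg: "\<not> ?thesis"
  define v where "v = measure lborel A"
  have v: "v > 0" using A by (simp add: v_def)
  have eA: "emeasure lborel A = ennreal v" using A by (simp add: v_def emeasure_eq_ennreal_measure)
  have [measurable]: "p \<in> borel_measurable borel" unfolding p by measurable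
  define T where "T = (\<integral>\<^sup>+r. w r * ennreal ((S r)\<^sup>2) \<partial>lborel) + (\<integral>\<^sup>+r. w r * ennreal (p r * (1 - p r)) \<partial>lborel)"
  define G where "G z = (\<integral>\<^sup>+r. w r * ennreal ((S r + hit r z - p r)\<^sup>2) \<partial>lborel)" for z
  have [measurable]: "G \<in> borel_measurable borel" unfolding G_def by measurable
  have GT: "T < G z" if "z \<in> A" "z \<notin> F" for z using neg that unfolding T_def G_def by (auto simp: not_le)
  have iA: "integrable lborel (indicator A :: complex \<Rightarrow> real)" using A by (intro integrable_real_indicator) auto
  have ihit: "integrable lborel (\<lambda>z. indicator A z * hit r z)" for r
  proof (rule Bochner_Integration.integrable_bound[OF iA])
    show "AE z in lborel. norm (indicator A z * hit r z) \<le> norm (indicator A z :: real)"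
    proof (rule AE_I2)
      fix z show "norm (indicator A z * hit r z) \<le> norm (indicator A z :: real)"
        using hit01[of r z] by (auto simp: indicator_def)
    qed
  qed measurable
  have p01: "0 \<le> p r" "p r \<le> 1" for r
  proof -
    have "0 \<le> indicator A z * hit r z" "indicator A z * hit r z \<le> indicator A z" for z
      using hit01[of r z] by (auto simp: indicator_def)
    note b = this
    have "0 \<le> (LINT z|lborel. indicator A z * hit r z)" by (intro integral_nonneg_AE AE_I2 b)
    moreover have "(LINT z|lborel. indicator A z * hit r z) \<le> (LINT z|lborel. indicator A z)"
      by (rule integral_mono[OF ihit iA b(2)])
    ultimately show "0 \<le> p r" "p r \<le> 1" using v by (auto simp: p v_def[symmetric])
  qed
  \<comment> \<open>As \<open>hit\<close> takes only the values 0 and 1, it equals its square; its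
    mean is \<open>p r\<close>, so the cross term with \<open>S r\<close> averages to zero and the
    variance is p (1 - p).\<close>
  have inner: "(\<integral>\<^sup>+z. (ennreal (1/v) * indicator A z) * ennreal ((S r + hit r z - p r)\<^sup>2) \<partial>lborel) = ennreal ((S r)\<^sup>2) + ennreal (p r * (1 - p r))" for r
  proof -
    define q where "q = S r - p r"
    have e: "(1/v * indicator A z) * (S r + hit r z - p r)\<^sup>2 = (q\<^sup>2 / v) * indicator A z + ((2 * q + 1) / v) * (indicator A z * hit r z)" for z
    proof -
      have "S r + hit r z - p r = q + hit r z" by (simp add: q_def)
      moreover have "(q + hit r z)\<^sup>2 = q\<^sup>2 + (2 * q + 1) * hit r z"
        using hit01[of r z] by (auto simp: power2_eq_square algebra_simps)
      ultimately show ?thesis by (simp only:) (simp add: divide_inverse algebra_simps)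
    qed
    have i: "integrable lborel (\<lambda>z. (q\<^sup>2 / v) * indicator A z + ((2 * q + 1) / v) * (indicator A z * hit r z))"
      by (intro Bochner_Integration.integrable_add integrable_mult_right iA ihit)
    have "(\<integral>\<^sup>+z. (ennreal (1/v) * indicator A z) * ennreal ((S r + hit r z - p r)\<^sup>2) \<partial>lborel) = (\<integral>\<^sup>+z. ennreal ((1/v * indicator A z) * (S r + hit r z - p r)\<^sup>2) \<partial>lborel)"
      using v by (intro nn_integral_cong) (auto simp: indicator_def ennreal_mult''[symmetric])
    also have "\<dots> = ennreal (LINT z|lborel. (1/v * indicator A z) * (S r + hit r z - p r)\<^sup>2)"
    proof (rule nn_integral_eq_integral)
      show "integrable lborel (\<lambda>z. (1/v * indicator A z) * (S r + hit r z - p r)\<^sup>2)" unfolding e by (rule i)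
      show "AE z in lborel. 0 \<le> (1/v * indicator A z) * (S r + hit r z - p r)\<^sup>2" using v by auto
    qed
    also have "(LINT z|lborel. (1/v * indicator A z) * (S r + hit r z - p r)\<^sup>2) = (q\<^sup>2 / v) * v + ((2 * q + 1) / v) * (p r * v)"
      unfolding e using v ihit iA
      by (subst Bochner_Integration.integral_add) (auto simp: p v_def[symmetric])
    also have "\<dots> = (S r)\<^sup>2 + p r * (1 - p r)"
    proof -
      have "(q\<^sup>2 / v) * v = q\<^sup>2" "((2 * q + 1) / v) * (p r * v) = (2 * q + 1) * p r" using v by simp_all
      then show ?thesis by (simp only:) (simp add: q_def power2_eq_square algebra_simps)
    qed
    finally show ?thesis using p01[of r] by (simp add: ennreal_plus)
  qed
  have "(\<integral>\<^sup>+z. (ennreal (1/v) * indicator A z) * G z \<partial>lborel) = (\<integral>\<^sup>+z. \<integral>\<^sup>+r. w r * ((ennreal (1/v) * indicator A z) * ennreal ((S r + hit r z - p r)\<^sup>2)) \<partial>lborel \<partial>lborel)"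
  proof (rule nn_integral_cong)
    fix z
    have "(ennreal (1/v) * indicator A z) * G z = (\<integral>\<^sup>+r. (ennreal (1/v) * indicator A z) * (w r * ennreal ((S r + hit r z - p r)\<^sup>2)) \<partial>lborel)"
      unfolding G_def by (rule nn_integral_cmult[symmetric]) measurable
    then show "(ennreal (1/v) * indicator A z) * G z = (\<integral>\<^sup>+r. w r * ((ennreal (1/v) * indicator A z) * ennreal ((S r + hit r z - p r)\<^sup>2)) \<partial>lborel)"
      by (simp only: mult_ac)
  qed
  also have "\<dots> = (\<integral>\<^sup>+r. \<integral>\<^sup>+z. w r * ((ennreal (1/v) * indicator A z) * ennreal ((S r + hit r z - p r)\<^sup>2)) \<partial>lborel \<partial>lborel)"
    by (rule lborel_pair.Fubini') measurable
  also have "\<dots> = (\<integral>\<^sup>+r. w r * (\<integral>\<^sup>+z. (ennreal (1/v) * indicator A z) * ennreal ((S r + hit r z - p r)\<^sup>2) \<partial>lborel) \<partial>lborel)"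
    by (intro nn_integral_cong nn_integral_cmult) measurable
  also have "\<dots> = T"
    unfolding inner T_def distrib_left by (rule nn_integral_add) measurable
  finally have GI: "(\<integral>\<^sup>+z. (ennreal (1/v) * indicator A z) * G z \<partial>lborel) = T" .
  have TI: "(\<integral>\<^sup>+z. (ennreal (1/v) * indicator A z) * T \<partial>lborel) = T"
  proof -
    have "(\<integral>\<^sup>+z. (ennreal (1/v) * indicator A z) * T \<partial>lborel) = (ennreal (1/v) * emeasure lborel A) * T"
      by (subst nn_integral_multc, measurable) (simp add: nn_integral_cmult_indicator)
    also have "ennreal (1/v) * emeasure lborel A = 1" using v unfolding eA by (simp add: ennreal_mult''[symmetric])
    finally show ?thesis by simp
  qed
  have Fn: "AE z in lborel. z \<notin> F"
    using F by (intro AE_not_in null_sets.finite_UN countable_imp_null_set_lborel countable_finite)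
  \<comment> \<open>With infinite T the strict inequality \<open>GT\<close> is impossible, so A
    would be contained in the finite set F although it has positive area.\<close>
  have Tfin: "T < \<infinity>"
  proof (rule ccontr)
    assume "\<not> T < \<infinity>"
    then have "T = \<infinity>" using less_top[of T] by auto
    then have "A \<subseteq> F" using GT by force
    then have "emeasure lborel A = 0"
      using F by (metis emeasure_lborel_countable countable_finite finite_subset)
    then show False using eA v by simp
  qed
  have "(\<integral>\<^sup>+z. (ennreal (1/v) * indicator A z) * G z - (ennreal (1/v) * indicator A z) * T \<partial>lborel)
    = (\<integral>\<^sup>+z. (ennreal (1/v) * indicator A z) * G z \<partial>lborel) - (\<integral>\<^sup>+z. (ennreal (1/v) * indicator A z) * T \<partial>lborel)"
  proof (rule nn_integral_diff)
    show "AE z in lborel. (ennreal (1/v) * indicator A z) * T \<le> (ennreal (1/v) * indicator A z) * G z"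
      using Fn
    proof eventually_elim
      case (elim z)
      show ?case using GT[of z] elim by (cases "z \<in> A") (auto intro!: mult_left_mono)
    qed
    show "(\<integral>\<^sup>+z. (ennreal (1/v) * indicator A z) * T \<partial>lborel) \<noteq> \<infinity>" unfolding TI using Tfin by simp
  qed measurable
  also have "\<dots> = 0" unfolding GI TI using Tfin by (simp add: diff_eq_0_iff_ennreal)
  \<comment> \<open>\<open>G\<close> has mean T but exceeds T on all of A outside the null set F. A
    nonnegative difference with integral zero vanishes almost everywhere, which leaves A no
    area.\<close>
  finally have "AE z in lborel. (ennreal (1/v) * indicator A z) * G z - (ennreal (1/v) * indicator A z) * T = 0"
    by (subst (asm) nn_integral_0_iff_AE) auto
  then have "AE z in lborel. z \<notin> A"
    using Fn
  proof eventually_elim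
    case (elim z)
    show ?case
    proof
      assume z: "z \<in> A"
      have "ennreal (1/v) * T < ennreal (1/v) * G z"
        using GT[OF z elim(2)] v by (intro ennreal_mult_strict_left_mono) (auto simp: ennreal_zero_less_divide)
      moreover have "ennreal (1/v) * G z - ennreal (1/v) * T = 0" using elim(1) z by simp
      ultimately show False by (auto simp: diff_eq_0_iff_ennreal)
    qed
  qed
  then have "emeasure lborel A = 0" by (subst (asm) AE_iff_measurable[of A]) auto
  then show False using eA v by simp
qed

text \<open>Points are chosen one after another, each at least as good as the average choice, so no
  product probability space is needed: every step adds at most the variance of its own cell. The
  points already chosen form the forbidden set, which keeps \<open>z\<close> injective even if cells
  coincide.\<close>

lemma sampling:
  fixes N :: nat and w :: "'r::euclidean_space \<Rightarrow> ennreal" and hit :: "'r \<Rightarrow> complex \<Rightarrow> real"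
  assumes [measurable]: "w \<in> borel_measurable borel" and Am: "\<And>j. j < N \<Longrightarrow> A j \<in> sets borel"
    and hitm[measurable]: "(\<lambda>(r, z). hit r z) \<in> borel_measurable (borel \<Otimes>\<^sub>M borel)"
    and hit01: "\<And>r z. hit r z = 0 \<or> hit r z = 1"
    and A: "\<And>j. j < N \<Longrightarrow> emeasure lborel (A j) < \<infinity>" "\<And>j. j < N \<Longrightarrow> measure lborel (A j) > 0"
    and p: "\<And>j r. p j r = (LINT z|lborel. indicator (A j) z * hit r z) / measure lborel (A j)"
  shows "\<exists>z. inj_on z {..<N} \<and> (\<forall>j<N. z j \<in> A j) \<and>
    (\<integral>\<^sup>+r. w r * ennreal ((\<Sum>j<N. hit r (z j) - p j r)\<^sup>2) \<partial>lborel) \<le> (\<Sum>j<N. \<integral>\<^sup>+r. w r * ennreal (p j r * (1 - p j r)) \<partial>lborel)"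
  using Am A
proof (induction N)
  case 0
  then show ?case by simp
next
  case (Suc n)
  have "\<exists>z. inj_on z {..<n} \<and> (\<forall>j<n. z j \<in> A j) \<and>
    (\<integral>\<^sup>+r. w r * ennreal ((\<Sum>j<n. hit r (z j) - p j r)\<^sup>2) \<partial>lborel) \<le> (\<Sum>j<n. \<integral>\<^sup>+r. w r * ennreal (p j r * (1 - p j r)) \<partial>lborel)"
    by (rule Suc.IH) (use Suc.prems in auto)
  then obtain z where z: "inj_on z {..<n}" "\<And>j. j < n \<Longrightarrow> z j \<in> A j"
    "(\<integral>\<^sup>+r. w r * ennreal ((\<Sum>j<n. hit r (z j) - p j r)\<^sup>2) \<partial>lborel) \<le> (\<Sum>j<n. \<integral>\<^sup>+r. w r * ennreal (p j r * (1 - p j r)) \<partial>lborel)"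
    by blast
  have An: "A n \<in> sets borel" using Suc.prems by simp
  have pm: "p j \<in> borel_measurable borel" if "j < n" for j
  proof -
    have [measurable]: "A j \<in> sets borel" using Suc.prems that by simp
    show ?thesis unfolding p by measurable
  qed
  have [measurable]: "(\<lambda>r. \<Sum>j<n. hit r (z j) - p j r) \<in> borel_measurable borel"
    by (intro borel_measurable_sum borel_measurable_diff pm) auto
  obtain y where y: "y \<in> A n - z ` {..<n}"
    "(\<integral>\<^sup>+r. w r * ennreal (((\<Sum>j<n. hit r (z j) - p j r) + hit r y - p n r)\<^sup>2) \<partial>lborel)
      \<le> (\<integral>\<^sup>+r. w r * ennreal ((\<Sum>j<n. hit r (z j) - p j r)\<^sup>2) \<partial>lborel) + (\<integral>\<^sup>+r. w r * ennreal (p n r * (1 - p n r)) \<partial>lborel)"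
    using sampling_step[of w "\<lambda>r. \<Sum>j<n. hit r (z j) - p j r" "A n" hit "z ` {..<n}" "p n"] Suc.prems An hit01 p hitm by auto
  define z' where "z' = z(n := y)"
  have s: "(\<Sum>j<Suc n. hit r (z' j) - p j r) = (\<Sum>j<n. hit r (z j) - p j r) + hit r y - p n r" for r
    by (simp add: z'_def)
  have "inj_on z' {..<Suc n}"
    using z(1) y(1) by (auto simp: z'_def inj_on_def lessThan_Suc)
  moreover have "\<forall>j<Suc n. z' j \<in> A j" using z(2) y(1) by (auto simp: z'_def less_Suc_eq)
  moreover have "(\<integral>\<^sup>+r. w r * ennreal ((\<Sum>j<Suc n. hit r (z' j) - p j r)\<^sup>2) \<partial>lborel) \<le> (\<Sum>j<Suc n. \<integral>\<^sup>+r. w r * ennreal (p j r * (1 - p j r)) \<partial>lborel)"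
    unfolding s using order_trans[OF y(2) add_right_mono[OF z(3)]] by simp
  ultimately show ?case by blast
qed

section \<open>Variance of the cells\<close>

lemma koch_shape_measurable2 [measurable (raw)]:
  assumes [measurable]: "f \<in> borel_measurable M" "g \<in> borel_measurable M"
  shows "(\<lambda>r. koch_shape (f r) (g r)) \<in> borel_measurable M"
  unfolding koch_shape_def divide_inverse by measurable

lemma koch_shape_01: "koch_shape c u = 0 \<or> koch_shape c u = 1"
  by (auto simp: koch_shape_def indicator_def)

text \<open>Packs the three nested integrals of \<open>koch_L2sq\<close> into one weighted integral
  over triples of dilation, angle and translation, the form that \<open>sampling\<close> works
  with.\<close>

definition koch_weight :: "real \<Rightarrow> real \<Rightarrow> real \<times> real \<times> complex \<Rightarrow> ennreal" where
  "koch_weight a b r = indicator {a..b} (fst r) * (indicator {0..<2*pi} (fst (snd r)) * ennreal (1 / (2*pi)))"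

definition koch_hit :: "real \<times> real \<times> complex \<Rightarrow> complex \<Rightarrow> real" where
  "koch_hit r z = koch_shape (of_real (fst r) * cis (fst (snd r))) (snd (snd r) - z)"

lemma measurable_borel_fst_snd [measurable]:
  "fst \<in> borel_measurable (borel :: ('a::second_countable_topology \<times> 'b::second_countable_topology) measure)"
  "snd \<in> borel_measurable (borel :: ('a::second_countable_topology \<times> 'b::second_countable_topology) measure)"
  by (intro borel_measurable_continuous_onI continuous_intros)+

lemma koch_weight_measurable [measurable]: "koch_weight a b \<in> borel_measurable borel"
  unfolding koch_weight_def by measurable

lemma koch_hit_measurable [measurable]: "(\<lambda>(r, z). koch_hit r z) \<in> borel_measurable (borel \<Otimes>\<^sub>M borel)"
  unfolding koch_hit_def by measurable

lemma koch_weight_integral: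
  assumes [measurable]: "f \<in> borel_measurable borel"
  shows "(\<integral>\<^sup>+r. koch_weight a b r * f r \<partial>lborel) = (\<integral>\<^sup>+\<tau>. indicator {a..b} \<tau> *
     (\<integral>\<^sup>+\<theta>. indicator {0..<2*pi} \<theta> * ennreal (1 / (2*pi)) * (\<integral>\<^sup>+x. f (\<tau>, \<theta>, x) \<partial>lborel) \<partial>lborel) \<partial>lborel)"
proof -
  define g where "g r = koch_weight a b r * f r" for r
  have [measurable]: "g \<in> borel_measurable borel" unfolding g_def by measurable
  have split: "(\<integral>\<^sup>+r. u r \<partial>lborel) = (\<integral>\<^sup>+x. \<integral>\<^sup>+y. u (x, y) \<partial>lborel \<partial>lborel)"
    if [measurable]: "u \<in> borel_measurable borel" for u :: "'x::euclidean_space \<times> 'y::euclidean_space \<Rightarrow> ennreal"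
    by (subst lborel_prod[symmetric], rule lborel.nn_integral_fst[symmetric]) (simp add: lborel_prod)
  have "(\<integral>\<^sup>+r. koch_weight a b r * f r \<partial>lborel) = (\<integral>\<^sup>+\<tau>. \<integral>\<^sup>+q. g (\<tau>, q) \<partial>lborel \<partial>lborel)"
    unfolding g_def[symmetric] by (rule split) measurable
  also have "\<dots> = (\<integral>\<^sup>+\<tau>. \<integral>\<^sup>+\<theta>. \<integral>\<^sup>+x. koch_weight a b (\<tau>, \<theta>, x) * f (\<tau>, \<theta>, x) \<partial>lborel \<partial>lborel \<partial>lborel)"
    unfolding g_def[symmetric] by (intro nn_integral_cong split) measurable
  also have "\<dots> = (\<integral>\<^sup>+\<tau>. indicator {a..b} \<tau> *
     (\<integral>\<^sup>+\<theta>. indicator {0..<2*pi} \<theta> * ennreal (1 / (2*pi)) * (\<integral>\<^sup>+x. f (\<tau>, \<theta>, x) \<partial>lborel) \<partial>lborel) \<partial>lborel)"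
  proof (rule nn_integral_cong)
    fix \<tau> :: real
    have "(\<integral>\<^sup>+\<theta>. \<integral>\<^sup>+x. koch_weight a b (\<tau>, \<theta>, x) * f (\<tau>, \<theta>, x) \<partial>lborel \<partial>lborel)
       = (\<integral>\<^sup>+\<theta>. indicator {a..b} \<tau> * (indicator {0..<2*pi} \<theta> * ennreal (1 / (2*pi)) * (\<integral>\<^sup>+x. f (\<tau>, \<theta>, x) \<partial>lborel)) \<partial>lborel)"
    proof (rule nn_integral_cong)
      fix \<theta> :: real
      have "(\<integral>\<^sup>+x. koch_weight a b (\<tau>, \<theta>, x) * f (\<tau>, \<theta>, x) \<partial>lborel) = (indicator {a..b} \<tau> * (indicator {0..<2*pi} \<theta> * ennreal (1 / (2*pi)))) * (\<integral>\<^sup>+x. f (\<tau>, \<theta>, x) \<partial>lborel)"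
        unfolding koch_weight_def fst_conv snd_conv by (rule nn_integral_cmult) measurable
      then show "(\<integral>\<^sup>+x. koch_weight a b (\<tau>, \<theta>, x) * f (\<tau>, \<theta>, x) \<partial>lborel) = indicator {a..b} \<tau> * (indicator {0..<2*pi} \<theta> * ennreal (1 / (2*pi)) * (\<integral>\<^sup>+x. f (\<tau>, \<theta>, x) \<partial>lborel))"
        by (simp only: mult.assoc)
    qed
    also have "\<dots> = indicator {a..b} \<tau> * (\<integral>\<^sup>+\<theta>. indicator {0..<2*pi} \<theta> * ennreal (1 / (2*pi)) * (\<integral>\<^sup>+x. f (\<tau>, \<theta>, x) \<partial>lborel) \<partial>lborel)"
      by (rule nn_integral_cmult) measurable
    finally show "(\<integral>\<^sup>+\<theta>. \<integral>\<^sup>+x. koch_weight a b (\<tau>, \<theta>, x) * f (\<tau>, \<theta>, x) \<partial>lborel \<partial>lborel)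
       = indicator {a..b} \<tau> * (\<integral>\<^sup>+\<theta>. indicator {0..<2*pi} \<theta> * ennreal (1 / (2*pi)) * (\<integral>\<^sup>+x. f (\<tau>, \<theta>, x) \<partial>lborel) \<partial>lborel)" .
  qed
  finally show ?thesis .
qed

lemma koch_weight_integral_le:
  assumes [measurable]: "f \<in> borel_measurable borel" and B: "0 \<le> B" "a \<le> b"
    and le: "\<And>\<tau> \<theta>. a \<le> \<tau> \<Longrightarrow> \<tau> \<le> b \<Longrightarrow> (\<integral>\<^sup>+x. f (\<tau>, \<theta>, x) \<partial>lborel) \<le> ennreal B"
  shows "(\<integral>\<^sup>+r. koch_weight a b r * f r \<partial>lborel) \<le> ennreal ((b - a) * B)"
proof -
  have "(\<integral>\<^sup>+r. koch_weight a b r * f r \<partial>lborel) \<le> (\<integral>\<^sup>+\<tau>. indicator {a..b} \<tau> * (\<integral>\<^sup>+\<theta>. indicator {0..<2*pi} \<theta> * ennreal (1 / (2*pi)) * ennreal B \<partial>lborel) \<partial>lborel)"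
    unfolding koch_weight_integral[OF assms(1)]
  proof (rule nn_integral_mono)
    fix \<tau> :: real
    show "indicator {a..b} \<tau> * (\<integral>\<^sup>+\<theta>. indicator {0..<2*pi} \<theta> * ennreal (1 / (2*pi)) * (\<integral>\<^sup>+x. f (\<tau>, \<theta>, x) \<partial>lborel) \<partial>lborel)
      \<le> indicator {a..b} \<tau> * (\<integral>\<^sup>+\<theta>. indicator {0..<2*pi} \<theta> * ennreal (1 / (2*pi)) * ennreal B \<partial>lborel)"
    proof (cases "\<tau> \<in> {a..b}")
      case True
      then show ?thesis by (intro mult_left_mono nn_integral_mono le) auto
    qed simp
  qed
  also have "(\<integral>\<^sup>+\<theta>. indicator {0..<2*pi} \<theta> * ennreal (1 / (2*pi)) * ennreal B \<partial>lborel) = ennreal B"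
    by (subst nn_integral_multc, measurable) (simp add: circle_total)
  also have "(\<integral>\<^sup>+\<tau>. indicator {a..b} \<tau> * ennreal B \<partial>lborel) = ennreal (b - a) * ennreal B"
    using B by (simp add: nn_integral_multc)
  also have "\<dots> = ennreal ((b - a) * B)" using B by (simp add: ennreal_mult'')
  finally show ?thesis .
qed

lemma koch_L2sq_eq:
  assumes P: "finite P" and a: "0 < a"
  shows "koch_L2sq P a b = (\<integral>\<^sup>+r. koch_weight a b r * ennreal (((\<Sum>p\<in>P. koch_hit r p)
     - real (card P) / koch_area * (LINT y|lborel. indicator koch_domain y * koch_hit r y))\<^sup>2) \<partial>lborel)"
proof -
  have m: "(\<lambda>r. ennreal (((\<Sum>p\<in>P. koch_hit r p)
     - real (card P) / koch_area * (LINT y|lborel. indicator koch_domain y * koch_hit r y))\<^sup>2)) \<in> borel_measurable borel"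
    unfolding koch_hit_def by measurable
  show ?thesis
    unfolding koch_weight_integral[OF m] koch_L2sq_def
  proof (rule nn_integral_cong)
    fix \<tau> :: real
    show "indicator {a..b} \<tau> * (\<integral>\<^sup>+\<theta>. indicator {0..<2*pi} \<theta> * ennreal (1 / (2*pi)) * (\<integral>\<^sup>+ x. ennreal ((discrepancy P (koch_copy x \<tau> \<theta>))\<^sup>2) \<partial>lborel) \<partial>lborel)
      = indicator {a..b} \<tau> * (\<integral>\<^sup>+\<theta>. indicator {0..<2*pi} \<theta> * ennreal (1 / (2*pi)) * (\<integral>\<^sup>+ x. ennreal (((\<Sum>p\<in>P. koch_hit (\<tau>, \<theta>, x) p)
     - real (card P) / koch_area * (LINT y|lborel. indicator koch_domain y * koch_hit (\<tau>, \<theta>, x) y))\<^sup>2) \<partial>lborel) \<partial>lborel)"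
      using a by (cases "\<tau> \<in> {a..b}") (simp_all add: discrepancy_eq[OF P] koch_disc_def koch_hit_def)
  qed
qed

lemma mean_hit_bounds:
  assumes A[measurable]: "A \<in> sets borel" "emeasure lborel A < \<infinity>" "measure lborel A > 0"
  shows "0 \<le> (LINT z|lborel. indicator A z * koch_hit r z) / measure lborel A"
    "(LINT z|lborel. indicator A z * koch_hit r z) / measure lborel A \<le> 1"
    "(\<And>z. z \<in> A \<Longrightarrow> koch_hit r z = 0) \<Longrightarrow> (LINT z|lborel. indicator A z * koch_hit r z) / measure lborel A = 0"
    "(\<And>z. z \<in> A \<Longrightarrow> koch_hit r z = 1) \<Longrightarrow> (LINT z|lborel. indicator A z * koch_hit r z) / measure lborel A = 1"
proof -
  have iA: "integrable lborel (indicator A :: complex \<Rightarrow> real)" using assms by (intro integrable_real_indicator) auto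
  have b: "0 \<le> indicator A z * koch_hit r z" "indicator A z * koch_hit r z \<le> indicator A z" for z
    by (auto simp: indicator_def koch_hit_def)
  have [measurable]: "koch_hit r \<in> borel_measurable borel" unfolding koch_hit_def by measurable
  have i: "integrable lborel (\<lambda>z. indicator A z * koch_hit r z)"
  proof (rule Bochner_Integration.integrable_bound[OF iA])
    show "AE z in lborel. norm (indicator A z * koch_hit r z) \<le> norm (indicator A z :: real)" using b by auto
  qed measurable
  have 0: "0 \<le> (LINT z|lborel. indicator A z * koch_hit r z)" by (intro integral_nonneg_AE AE_I2 b)
  then show "0 \<le> (LINT z|lborel. indicator A z * koch_hit r z) / measure lborel A" by simp
  have "(LINT z|lborel. indicator A z * koch_hit r z) \<le> (LINT z|lborel. indicator A z)"
    by (rule integral_mono[OF i iA b(2)])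
  then show "(LINT z|lborel. indicator A z * koch_hit r z) / measure lborel A \<le> 1" using assms(3) by simp
  show "(LINT z|lborel. indicator A z * koch_hit r z) / measure lborel A = 0" if "\<And>z. z \<in> A \<Longrightarrow> koch_hit r z = 0"
  proof -
    have "(\<lambda>z. indicator A z * koch_hit r z) = (\<lambda>z. 0)" using that by (auto simp: indicator_def)
    then show ?thesis by (simp only:) simp
  qed
  show "(LINT z|lborel. indicator A z * koch_hit r z) / measure lborel A = 1" if "\<And>z. z \<in> A \<Longrightarrow> koch_hit r z = 1"
  proof -
    have "(\<lambda>z. indicator A z * koch_hit r z) = indicator A" using that by (auto simp: indicator_def)
    then show ?thesis using assms(3) by (simp only:) simp
  qed
qed

lemma nn_integral_reflect:
  fixes f :: "complex \<Rightarrow> ennreal"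
  assumes [measurable]: "f \<in> borel_measurable borel" and c: "c \<noteq> 0"
  shows "(\<integral>\<^sup>+x. f ((q - x) / c) \<partial>lborel) = ennreal ((cmod c)\<^sup>2) * (\<integral>\<^sup>+y. f y \<partial>lborel)"
proof -
  have "(\<integral>\<^sup>+x. f ((q - x) / c) \<partial>lborel) = (\<integral>\<^sup>+x. f ((q - (q + x)) / c) \<partial>lborel)"
    unfolding divide_inverse by (rule nn_integral_lborel_translate[symmetric]) measurable
  also have "\<dots> = ennreal ((cmod (-c))\<^sup>2) * (\<integral>\<^sup>+y. f ((q - (q + (-c) * y)) / c) \<partial>lborel)"
    unfolding divide_inverse by (rule nn_integral_complex_mult) (use c in auto)
  finally show ?thesis using c by simp
qed

text \<open>A cell of diameter \<open>d\<close> has nonzero variance only if the boundary of the copy passes through it.\<close>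
lemma cell_variance:
  assumes a: "0 < a" "a \<le> b" and A: "A \<in> sets borel" "emeasure lborel A < \<infinity>" "measure lborel A > 0"
    and d: "0 < d" "\<And>z z'. z \<in> A \<Longrightarrow> z' \<in> A \<Longrightarrow> dist z z' < d"
    and p: "\<And>r. p r = (LINT z|lborel. indicator A z * koch_hit r z) / measure lborel A"
    and K: "0 \<le> K" "emeasure lborel (koch_nbhd (2 * d / a)) \<le> ennreal K"
  shows "(\<integral>\<^sup>+r. koch_weight a b r * ennreal (p r * (1 - p r)) \<partial>lborel) \<le> ennreal ((b - a) * (b\<^sup>2 * K))"
proof (rule koch_weight_integral_le)
  have [measurable]: "A \<in> sets borel" by fact
  show "(\<lambda>r. ennreal (p r * (1 - p r))) \<in> borel_measurable borel" unfolding p koch_hit_def by measurable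
  show "0 \<le> b\<^sup>2 * K" "a \<le> b" using K a by auto
  have "A \<noteq> {}" using A(3) by auto
  then obtain q where q: "q \<in> A" by blast
  fix \<tau> \<theta> :: real
  assume \<tau>: "a \<le> \<tau>" "\<tau> \<le> b"
  define c where "c = of_real \<tau> * cis \<theta>"
  have c: "c \<noteq> 0" "cmod c = \<tau>" using \<tau> a by (auto simp: c_def cis_neq_zero norm_mult)
  have hit: "koch_hit (\<tau>, \<theta>, x) z = indicator koch_domain ((z - x) / c)" for x z
    by (simp add: koch_hit_def koch_shape_def c_def[symmetric] minus_divide_left)
  have "(\<integral>\<^sup>+x. ennreal (p (\<tau>, \<theta>, x) * (1 - p (\<tau>, \<theta>, x))) \<partial>lborel) \<le> (\<integral>\<^sup>+x. indicator (koch_nbhd (2 * d / a)) ((q - x) / c) \<partial>lborel)"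
  proof (rule nn_integral_mono)
    fix x
    note mb = mean_hit_bounds[OF A, of "(\<tau>, \<theta>, x)", folded p]
    show "ennreal (p (\<tau>, \<theta>, x) * (1 - p (\<tau>, \<theta>, x))) \<le> indicator (koch_nbhd (2 * d / a)) ((q - x) / c)"
    proof (cases "p (\<tau>, \<theta>, x) = 0 \<or> p (\<tau>, \<theta>, x) = 1")
      case False
      \<comment> \<open>If the mean is neither 0 nor 1, two points of the cell lie on different
        sides. The curve meets the segment between their images, which is shorter than d/a, and the
        image of \<open>q\<close> is within another d/a.\<close>
      then obtain z z' where z: "z \<in> A" "koch_hit (\<tau>, \<theta>, x) z \<noteq> 0" and z': "z' \<in> A" "koch_hit (\<tau>, \<theta>, x) z' \<noteq> 1"
        using mb(3,4) by blast
      have "(z - x) / c \<in> koch_domain" "(z' - x) / c \<notin> koch_domain"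
        using z z' unfolding hit by (auto simp: indicator_def split: if_splits)
      then obtain k where k: "k \<in> koch_curve" "k \<in> closed_segment ((z - x) / c) ((z' - x) / c)"
        using segment_meets_koch_curve by blast
      have ds: "dist ((u - x) / c) ((v - x) / c) < d / a" if "u \<in> A" "v \<in> A" for u v
      proof -
        have "dist ((u - x) / c) ((v - x) / c) = dist u v / \<tau>"
          using c by (simp add: dist_norm norm_divide flip: diff_divide_distrib)
        also have "\<dots> \<le> dist u v / a" using \<tau> a by (intro divide_left_mono) auto
        also have "\<dots> < d / a" using d(2)[OF that] a by (simp add: divide_strict_right_mono)
        finally show ?thesis .
      qed
      have "dist k ((z - x) / c) \<le> dist ((z - x) / c) ((z' - x) / c)"
        using dist_in_closed_segment[OF k(2)] by (simp add: dist_commute)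
      then have "dist k ((q - x) / c) < d / a + d / a"
        using ds[OF z(1) z'(1)] ds[OF z(1) q] dist_triangle[of k "(q - x) / c" "(z - x) / c"] by linarith
      then have "(q - x) / c \<in> koch_nbhd (2 * d / a)" using k(1) unfolding koch_nbhd_def by auto
      moreover have "p (\<tau>, \<theta>, x) * (1 - p (\<tau>, \<theta>, x)) \<le> 1 * 1"
        using mb(1,2) by (intro mult_mono) auto
      ultimately show ?thesis by simp
    qed auto
  qed
  also have "\<dots> = ennreal (\<tau>\<^sup>2) * emeasure lborel (koch_nbhd (2 * d / a))"
    by (subst nn_integral_reflect[OF _ c(1)]) (auto simp: c(2))
  also have "\<dots> \<le> ennreal (b\<^sup>2) * ennreal K"
    using \<tau> a by (intro mult_mono K ennreal_leI power_mono) auto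
  also have "\<dots> = ennreal (b\<^sup>2 * K)" using K by (simp add: ennreal_mult'')
  finally show "(\<integral>\<^sup>+x. ennreal (p (\<tau>, \<theta>, x) * (1 - p (\<tau>, \<theta>, x))) \<partial>lborel) \<le> ennreal (b\<^sup>2 * K)" .
qed

text \<open>The trivial bound for a set of arbitrary diameter: the variance is at most 1 and
  vanishes unless the copy can reach the domain, that is, unless |x| < 6 + 6 b.\<close>

lemma subdomain_variance:
  assumes a: "0 < a" "a \<le> b" and A: "A \<in> sets borel" "emeasure lborel A < \<infinity>" "measure lborel A > 0" "A \<subseteq> koch_domain"
    and p: "\<And>r. p r = (LINT z|lborel. indicator A z * koch_hit r z) / measure lborel A"
  shows "(\<integral>\<^sup>+r. koch_weight a b r * ennreal (p r * (1 - p r)) \<partial>lborel) \<le> ennreal ((b - a) * (pi * (6 + 6 * b)\<^sup>2))"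
proof (rule koch_weight_integral_le)
  have [measurable]: "A \<in> sets borel" by fact
  show "(\<lambda>r. ennreal (p r * (1 - p r))) \<in> borel_measurable borel" unfolding p koch_hit_def by measurable
  show "0 \<le> pi * (6 + 6 * b)\<^sup>2" "a \<le> b" using a by auto
  fix \<tau> \<theta> :: real
  assume \<tau>: "a \<le> \<tau>" "\<tau> \<le> b"
  define c where "c = of_real \<tau> * cis \<theta>"
  have c: "c \<noteq> 0" "cmod c = \<tau>" using \<tau> a by (auto simp: c_def cis_neq_zero norm_mult)
  have "(\<integral>\<^sup>+x. ennreal (p (\<tau>, \<theta>, x) * (1 - p (\<tau>, \<theta>, x))) \<partial>lborel) \<le> (\<integral>\<^sup>+x. indicator (ball (0::complex) (6 + 6 * b)) x \<partial>lborel)"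
  proof (rule nn_integral_mono)
    fix x
    note mb = mean_hit_bounds[OF A(1-3), of "(\<tau>, \<theta>, x)", folded p]
    show "ennreal (p (\<tau>, \<theta>, x) * (1 - p (\<tau>, \<theta>, x))) \<le> indicator (ball 0 (6 + 6 * b)) x"
    proof (cases "p (\<tau>, \<theta>, x) = 0")
      case False
      then obtain z where z: "z \<in> A" "koch_hit (\<tau>, \<theta>, x) z \<noteq> 0" using mb(3) by blast
      have "cmod (x - z) < 6 * \<tau>"
        using koch_shape_support[OF c(1), of "x - z"] z(2) by (simp add: koch_hit_def c_def[symmetric] c(2))
      moreover have "cmod z < 6" using z(1) A(4) koch_domain_norm by blast
      moreover have "cmod x \<le> cmod z + cmod (x - z)" using norm_triangle_ineq[of z "x - z"] by simp
      ultimately have "x \<in> ball 0 (6 + 6 * b)" using \<tau> by simp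
      moreover have "p (\<tau>, \<theta>, x) * (1 - p (\<tau>, \<theta>, x)) \<le> 1 * 1"
        using mb(1,2) by (intro mult_mono) auto
      ultimately show ?thesis by simp
    qed auto
  qed
  also have "\<dots> = ennreal (pi * (6 + 6 * b)\<^sup>2)" using a by (simp add: emeasure_complex_ball)
  finally show "(\<integral>\<^sup>+x. ennreal (p (\<tau>, \<theta>, x) * (1 - p (\<tau>, \<theta>, x))) \<partial>lborel) \<le> ennreal (pi * (6 + 6 * b)\<^sup>2)" .
qed

lemma emeasure_rect:
  assumes "a \<le> b" "c \<le> d"
  shows "emeasure lborel {z. a \<le> Re z \<and> Re z < b \<and> c \<le> Im z \<and> Im z < d} = ennreal ((b - a) * (d - c))"
proof -
  have v: "(\<lambda>(x, y). Complex x y) -` {z. a \<le> Re z \<and> Re z < b \<and> c \<le> Im z \<and> Im z < d} = {a..<b} \<times> {c..<d}" by auto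
  have [measurable]: "{z. a \<le> Re z \<and> Re z < b \<and> c \<le> Im z \<and> Im z < d} \<in> sets borel" by measurable
  have "emeasure lborel {z. a \<le> Re z \<and> Re z < b \<and> c \<le> Im z \<and> Im z < d} = emeasure (lborel \<Otimes>\<^sub>M lborel) ({a..<b} \<times> {c..<d})"
    by (subst lborel_complex_pair, subst emeasure_distr) (simp_all only: v space_pair_measure space_lborel UNIV_Times_UNIV Int_UNIV_right, measurable)
  also have "\<dots> = ennreal ((b - a) * (d - c))"
    using assms by (simp add: lborel.emeasure_pair_measure_Times ennreal_mult'')
  finally show ?thesis .
qed

section \<open>The upper bound\<close>

definition grid_cell :: "real \<Rightarrow> int \<times> int \<Rightarrow> complex set" where
  "grid_cell l ij = {z. of_int (fst ij) * l \<le> Re z \<and> Re z < (of_int (fst ij) + 1) * l \<and>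
     of_int (snd ij) * l \<le> Im z \<and> Im z < (of_int (snd ij) + 1) * l}"

lemma grid_cell_borel [measurable]: "grid_cell l ij \<in> sets borel"
  unfolding grid_cell_def by measurable

lemma grid_cell_iff:
  assumes "l > 0"
  shows "z \<in> grid_cell l ij \<longleftrightarrow> ij = (\<lfloor>Re z / l\<rfloor>, \<lfloor>Im z / l\<rfloor>)"
proof -
  have fl: "of_int i * l \<le> x \<and> x < (of_int i + 1) * l \<longleftrightarrow> \<lfloor>x / l\<rfloor> = i" for i :: int and x :: real
    using assms by (simp add: floor_eq_iff field_simps)
  show ?thesis
    unfolding grid_cell_def mem_Collect_eq prod_eq_iff using fl[of "fst ij" "Re z"] fl[of "snd ij" "Im z"] by auto
qed

lemma emeasure_grid_cell:
  assumes "l > 0"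
  shows "emeasure lborel (grid_cell l ij) = ennreal (l\<^sup>2)"
  unfolding grid_cell_def using assms
  by (subst emeasure_rect) (auto simp: algebra_simps power2_eq_square)

lemma grid_cell_dist:
  assumes "l > 0" "z \<in> grid_cell l ij" "z' \<in> grid_cell l ij"
  shows "dist z z' < 2 * l"
proof -
  have "\<bar>Re (z - z')\<bar> < l" "\<bar>Im (z - z')\<bar> < l"
    using assms unfolding grid_cell_def by (auto simp: abs_less_iff algebra_simps)
  then show ?thesis using cmod_le[of "z - z'"] by (simp add: dist_norm)
qed

definition koch_cells :: "real \<Rightarrow> (int \<times> int) set" where
  "koch_cells l = {ij. grid_cell l ij \<subseteq> koch_domain}"

definition koch_rest :: "real \<Rightarrow> complex set" where
  "koch_rest l = koch_domain - (\<Union>ij\<in>koch_cells l. grid_cell l ij)"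

lemma grid_cells_measure:
  assumes "l > 0" "finite J"
  shows "emeasure lborel (\<Union>ij\<in>J. grid_cell l ij) = ennreal (real (card J) * l\<^sup>2)"
proof -
  have "emeasure lborel (\<Union>ij\<in>J. grid_cell l ij) = (\<Sum>ij\<in>J. emeasure lborel (grid_cell l ij))"
    using assms grid_cell_iff[OF assms(1)]
    by (intro sum_emeasure[symmetric]) (auto simp: disjoint_family_on_def)
  also have "\<dots> = ennreal (real (card J) * l\<^sup>2)"
    by (simp add: emeasure_grid_cell[OF assms(1)] ennreal_of_nat_eq_real_of_nat ennreal_mult'')
  finally show ?thesis .
qed

lemma koch_cells_finite:
  assumes "l > 0"
  shows "finite (koch_cells l)" "real (card (koch_cells l)) * l\<^sup>2 \<le> koch_area"
proof -
  have bd: "real (card J) * l\<^sup>2 \<le> koch_area" if J: "J \<subseteq> koch_cells l" "finite J" for J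
  proof -
    have "ennreal (real (card J) * l\<^sup>2) \<le> emeasure lborel koch_domain"
      unfolding grid_cells_measure[OF assms J(2), symmetric]
      by (rule emeasure_mono) (use J in \<open>auto simp: koch_cells_def\<close>)
    then show ?thesis using koch_area_pos by (simp add: emeasure_koch_domain_eq ennreal_le_iff)
  qed
  show "finite (koch_cells l)"
  proof (rule finite_if_finite_subsets_card_bdd[THEN conjunct1])
    show "\<And>G. G \<subseteq> koch_cells l \<Longrightarrow> finite G \<Longrightarrow> card G \<le> nat \<lceil>koch_area / l\<^sup>2\<rceil>"
    proof -
      fix J assume "J \<subseteq> koch_cells l" "finite J"
      then have "real (card J) \<le> koch_area / l\<^sup>2" using bd[of J] assms by (simp add: field_simps)
      then show "card J \<le> nat \<lceil>koch_area / l\<^sup>2\<rceil>" by linarith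
    qed
  qed
  then show "real (card (koch_cells l)) * l\<^sup>2 \<le> koch_area" by (rule bd[OF order_refl])
qed

text \<open>A point of the rest shares its grid cell with a point outside the domain, so the curve
  passes within the cell diameter, which is below 2 l. Thus the area of the rest is controlled by a
  neighbourhood of the curve.\<close>

lemma koch_rest_props:
  assumes "l > 0"
  shows "koch_rest l \<in> sets borel" "koch_rest l \<subseteq> koch_domain" "koch_rest l \<subseteq> koch_nbhd (2 * l)"
    "emeasure lborel (koch_rest l) = ennreal (koch_area - real (card (koch_cells l)) * l\<^sup>2)"
    "z \<in> koch_domain \<Longrightarrow> indicator koch_domain z = (\<Sum>ij\<in>koch_cells l. indicator (grid_cell l ij) z) + (indicator (koch_rest l) z :: real)"
proof -
  note fin = koch_cells_finite[OF assms]
  have Um: "(\<Union>ij\<in>koch_cells l. grid_cell l ij) \<in> sets borel" using fin(1) by (intro sets.finite_UN) auto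
  show "koch_rest l \<in> sets borel" unfolding koch_rest_def by (intro sets.Diff Um) simp
  show "koch_rest l \<subseteq> koch_domain" unfolding koch_rest_def by blast
  show "koch_rest l \<subseteq> koch_nbhd (2 * l)"
  proof
    fix z assume z: "z \<in> koch_rest l"
    define ij where "ij = (\<lfloor>Re z / l\<rfloor>, \<lfloor>Im z / l\<rfloor>)"
    have zc: "z \<in> grid_cell l ij" using grid_cell_iff[OF assms] by (simp add: ij_def)
    then have "ij \<notin> koch_cells l" using z unfolding koch_rest_def by blast
    then obtain y where y: "y \<in> grid_cell l ij" "y \<notin> koch_domain" unfolding koch_cells_def by blast
    have "z \<in> koch_domain" using z unfolding koch_rest_def by blast
    then obtain k where k: "k \<in> koch_curve" "k \<in> closed_segment z y" using segment_meets_koch_curve y by blast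
    have "dist k z \<le> dist z y" using dist_in_closed_segment[OF k(2)] by (simp add: dist_commute)
    also have "\<dots> < 2 * l" by (rule grid_cell_dist[OF assms zc y(1)])
    finally show "z \<in> koch_nbhd (2 * l)" using k(1) unfolding koch_nbhd_def by auto
  qed
  have "emeasure lborel (koch_rest l) = emeasure lborel koch_domain - emeasure lborel (\<Union>ij\<in>koch_cells l. grid_cell l ij)"
    unfolding koch_rest_def
  proof (rule emeasure_Diff)
    show "emeasure lborel (\<Union>ij\<in>koch_cells l. grid_cell l ij) \<noteq> \<infinity>" by (simp add: grid_cells_measure[OF assms fin(1)])
  qed (use Um in \<open>auto simp: koch_cells_def\<close>)
  then show "emeasure lborel (koch_rest l) = ennreal (koch_area - real (card (koch_cells l)) * l\<^sup>2)"
    by (simp add: grid_cells_measure[OF assms fin(1)] emeasure_koch_domain_eq ennreal_minus)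
  show "indicator koch_domain z = (\<Sum>ij\<in>koch_cells l. indicator (grid_cell l ij) z) + (indicator (koch_rest l) z :: real)"
    if z: "z \<in> koch_domain"
  proof -
    define ij where "ij = (\<lfloor>Re z / l\<rfloor>, \<lfloor>Im z / l\<rfloor>)"
    have "(\<Sum>ij\<in>koch_cells l. indicator (grid_cell l ij) z :: real) = (\<Sum>kl\<in>koch_cells l. if kl = ij then 1 else 0)"
      using grid_cell_iff[OF assms, of z] by (intro sum.cong) (auto simp: indicator_def ij_def)
    also have "\<dots> = (if ij \<in> koch_cells l then 1 else 0)" using fin(1) by simp
    finally show ?thesis
      using z grid_cell_iff[OF assms, of z] unfolding koch_rest_def by (auto simp: indicator_def ij_def)
  qed
qed

text \<open>The areas are matched exactly: a full cell has the area that corresponds to one point,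
  and the rest has the area of \<open>N - m\<close> points. Hence the expected number of hits is N
  times the measure of the copy, the discrepancy is centred, and only variances are left.\<close>

lemma koch_upper_bound:
  assumes ab: "0 < a" "a < b"
  obtains K where "K > 0" "\<And>N. N > 0 \<Longrightarrow> \<exists>P. finite P \<and> card P = N \<and> P \<subseteq> koch_domain \<and>
      koch_L2sq P a b \<le> ennreal (K * real N powr (1 - koch_codim / 2))"
proof -
  define V where "V = koch_area"
  have V: "V > 0" using koch_area_pos by (simp add: V_def)
  \<comment> \<open>The largest radii at which the neighbourhood estimate is used: 4 l / a for a
    cell and 2 l for the rest, with l at most sqrt V.\<close>
  define \<rho> where "\<rho> = max (4 * sqrt V / a) (2 * sqrt V)"
  obtain K0 where K0: "K0 > 0" "\<And>r. 0 < r \<Longrightarrow> r \<le> \<rho> \<Longrightarrow> emeasure lborel (koch_nbhd r) \<le> ennreal (K0 * r powr koch_codim)"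
    using koch_nbhd_area by blast
  define C1 where "C1 = (b - a) * (b\<^sup>2 * (K0 * (4 / a) powr koch_codim))"
  define C2 where "C2 = (b - a) * (pi * (6 + 6 * b)\<^sup>2)"
  define C3 where "C3 = K0 * 2 powr koch_codim"
  have C: "C1 \<ge> 0" "C2 \<ge> 0" "C3 > 0" using ab K0 by (auto simp: C1_def C2_def C3_def)
  define K where "K = (C1 + C2 * C3 / V) * V powr (koch_codim / 2) + 1"
  show ?thesis
  proof (rule that[of K])
    show "K > 0" using C V by (auto simp: K_def intro!: add_nonneg_pos)
    fix N :: nat assume N: "N > 0"
    define l where "l = sqrt (V / real N)"
    have l: "l > 0" "l\<^sup>2 = V / real N" using V N by (auto simp: l_def)
    have lV: "l \<le> sqrt V" unfolding l_def using V N by (intro real_sqrt_le_mono) (simp add: field_simps)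
    note fin = koch_cells_finite[OF l(1)] and rest = koch_rest_props[OF l(1)]
    define m where "m = card (koch_cells l)"
    have mN: "m \<le> N"
    proof -
      have "real m * (V / real N) \<le> V" using fin(2) by (simp add: m_def l V_def)
      then show ?thesis using V N by (simp add: field_simps)
    qed
    have restE: "emeasure lborel (koch_rest l) = ennreal (real (N - m) * l\<^sup>2)"
    proof -
      have "koch_area = real N * l\<^sup>2" using N by (simp add: l(2) V_def)
      then show ?thesis
        unfolding rest(4) m_def[symmetric] using mN by (simp add: of_nat_diff algebra_simps)
    qed
    then have restV: "measure lborel (koch_rest l) = real (N - m) * l\<^sup>2" by (simp add: measure_def)
    obtain f where f: "bij_betw f {..<m} (koch_cells l)"
      using ex_bij_betw_nat_finite[OF fin(1)] by (auto simp: m_def atLeast0LessThan)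
    \<comment> \<open>All indices from m on share the same set, so its \<open>N - m\<close> points
      need not be separated further; their number is small enough for the trivial variance
      bound.\<close>
    define A where "A j = (if j < m then grid_cell l (f j) else koch_rest l)" for j
    have Am: "A j \<in> sets borel" for j using rest(1) by (simp add: A_def)
    have Asub: "A j \<subseteq> koch_domain" if "j < N" for j
      using f rest(2) by (auto simp: A_def koch_cells_def bij_betw_def)
    have Ameas: "measure lborel (A j) = (if j < m then l\<^sup>2 else real (N - m) * l\<^sup>2)" for j
    proof -
      have "measure lborel (grid_cell l (f j)) = l\<^sup>2" by (simp add: measure_def emeasure_grid_cell[OF l(1)])
      then show ?thesis by (simp add: A_def restV)
    qed
    have Afin: "emeasure lborel (A j) < \<infinity>" if "j < N" for j
      using emeasure_mono[OF Asub[OF that], of lborel] emeasure_koch_domain(2) by (simp add: le_less_trans)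
    have Apos: "measure lborel (A j) > 0" if "j < N" for j using that l(1) by (auto simp: Ameas)
    define p where "p j r = (LINT z|lborel. indicator (A j) z * koch_hit r z) / measure lborel (A j)" for j r
    obtain z where z: "inj_on z {..<N}" "\<forall>j<N. z j \<in> A j"
      "(\<integral>\<^sup>+r. koch_weight a b r * ennreal ((\<Sum>j<N. koch_hit r (z j) - p j r)\<^sup>2) \<partial>lborel) \<le> (\<Sum>j<N. \<integral>\<^sup>+r. koch_weight a b r * ennreal (p j r * (1 - p j r)) \<partial>lborel)"
      using sampling[of "koch_weight a b" N A koch_hit p, OF koch_weight_measurable Am koch_hit_measurable _ Afin Apos p_def]
      unfolding koch_hit_def using koch_shape_01 by blast
    define P where "P = z ` {..<N}"
    have P: "finite P" "card P = N" "P \<subseteq> koch_domain"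
      using z(1,2) Asub by (auto simp: P_def card_image)
    have ih: "integrable lborel (\<lambda>y. indicator B y * koch_hit r y)" if "B \<in> sets borel" "B \<subseteq> koch_domain" for B r
    proof (rule Bochner_Integration.integrable_bound[OF koch_indicator_integrable])
      have [measurable]: "B \<in> sets borel" by fact
      show "(\<lambda>y. indicator B y * koch_hit r y) \<in> borel_measurable lborel" unfolding koch_hit_def by measurable
      show "AE y in lborel. norm (indicator B y * koch_hit r y) \<le> norm (indicator koch_domain y :: real)"
        using that(2) by (intro AE_I2) (auto simp: indicator_def koch_hit_def)
    qed
    \<comment> \<open>Every quotient has the same density 1/l^2: a cell contributes its integral
      divided by l^2, and \<open>N - m\<close> equal means over the rest add up to its integral
      divided by l^2. Together they give the integral over the domain times N/V.\<close>
    have mean: "(\<Sum>j<N. p j r) = real N / V * (LINT y|lborel. indicator koch_domain y * koch_hit r y)" for r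
    proof -
      define I where "I B = (LINT y|lborel. indicator B y * koch_hit r y)" for B
      have cs: "grid_cell l ij \<subseteq> koch_domain" if "ij \<in> koch_cells l" for ij using that by (simp add: koch_cells_def)
      have "I koch_domain = (LINT y|lborel. (\<Sum>ij\<in>koch_cells l. indicator (grid_cell l ij) y * koch_hit r y) + indicator (koch_rest l) y * koch_hit r y)"
        unfolding I_def
      proof (rule Bochner_Integration.integral_cong[OF refl])
        fix y
        show "indicator koch_domain y * koch_hit r y = (\<Sum>ij\<in>koch_cells l. indicator (grid_cell l ij) y * koch_hit r y) + indicator (koch_rest l) y * koch_hit r y"
        proof (cases "y \<in> koch_domain")
          case True
          then show ?thesis unfolding rest(5)[OF True] by (simp add: distrib_right sum_distrib_right)
        next
          case False
          then have "y \<notin> koch_rest l" "\<And>ij. ij \<in> koch_cells l \<Longrightarrow> y \<notin> grid_cell l ij" using rest(2) cs by blast+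
          then show ?thesis using False by simp
        qed
      qed
      also have "\<dots> = (\<Sum>ij\<in>koch_cells l. I (grid_cell l ij)) + I (koch_rest l)"
        unfolding I_def
        by (subst Bochner_Integration.integral_add)
          (auto intro!: Bochner_Integration.integrable_sum ih cs rest simp: Bochner_Integration.integral_sum ih cs)
      finally have Isum: "I koch_domain = (\<Sum>ij\<in>koch_cells l. I (grid_cell l ij)) + I (koch_rest l)" .
      have "(\<Sum>j<N. p j r) = (\<Sum>j<m. p j r) + (\<Sum>j=m..<N. p j r)"
        using mN by (simp add: lessThan_atLeast0 sum.atLeastLessThan_concat)
      also have "(\<Sum>j<m. p j r) = (\<Sum>j<m. I (grid_cell l (f j)) / l\<^sup>2)"
      proof (intro sum.cong refl)
        fix j assume "j \<in> {..<m}"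
        then show "p j r = I (grid_cell l (f j)) / l\<^sup>2" unfolding p_def I_def Ameas by (simp add: A_def)
      qed
      also have "\<dots> = (\<Sum>ij\<in>koch_cells l. I (grid_cell l ij) / l\<^sup>2)"
        using sum.reindex_bij_betw[OF f, of "\<lambda>ij. I (grid_cell l ij) / l\<^sup>2"] .
      also have "(\<Sum>j=m..<N. p j r) = I (koch_rest l) / l\<^sup>2"
      proof (cases "m < N")
        case True
        have "(\<Sum>j=m..<N. p j r) = (\<Sum>j=m..<N. I (koch_rest l) / (real (N - m) * l\<^sup>2))"
        proof (intro sum.cong refl)
          fix j assume "j \<in> {m..<N}"
          then show "p j r = I (koch_rest l) / (real (N - m) * l\<^sup>2)" unfolding p_def I_def Ameas by (simp add: A_def)
        qed
        then show ?thesis using True l by simp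
      next
        case False
        \<comment> \<open>If the full cells already use all N points, no index refers to the rest;
          it is then a null set and its integral vanishes as well.\<close>
        then have e0: "emeasure lborel (koch_rest l) = 0"
          using mN by (simp add: restE)
        have "AE y in lborel. y \<notin> koch_rest l" using rest(1) e0 by (subst AE_iff_measurable) auto
        then have "I (koch_rest l) = (LINT (y::complex)|lborel. 0)"
          unfolding I_def
        proof (intro integral_cong_AE)
          have [measurable]: "koch_rest l \<in> sets borel" by (rule rest(1))
          show "(\<lambda>y. indicator (koch_rest l) y * koch_hit r y) \<in> borel_measurable lborel" unfolding koch_hit_def by measurable
        qed auto
        then show ?thesis using False mN by simp
      qed
      finally have "(\<Sum>j<N. p j r) = I koch_domain / l\<^sup>2" unfolding Isum by (simp add: sum_divide_distrib add_divide_distrib)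
      then show ?thesis unfolding I_def using l(2) V N by simp
    qed
    have "koch_L2sq P a b = (\<integral>\<^sup>+r. koch_weight a b r * ennreal ((\<Sum>j<N. koch_hit r (z j) - p j r)\<^sup>2) \<partial>lborel)"
      unfolding koch_L2sq_eq[OF P(1) ab(1)] P(2)
    proof (rule nn_integral_cong)
      fix r
      have "(\<Sum>p\<in>P. koch_hit r p) = (\<Sum>j<N. koch_hit r (z j))"
        unfolding P_def by (rule sum.reindex_cong[OF z(1)]) auto
      then show "koch_weight a b r * ennreal (((\<Sum>p\<in>P. koch_hit r p) - real N / koch_area * (LINT y|lborel. indicator koch_domain y * koch_hit r y))\<^sup>2)
        = koch_weight a b r * ennreal ((\<Sum>j<N. koch_hit r (z j) - p j r)\<^sup>2)"
        by (simp add: sum_subtractf mean V_def)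
    qed
    also note z(3)
    also have "(\<Sum>j<N. \<integral>\<^sup>+r. koch_weight a b r * ennreal (p j r * (1 - p j r)) \<partial>lborel) \<le> (\<Sum>j<N. ennreal (if j < m then C1 * l powr koch_codim else C2))"
    proof (rule sum_mono)
      fix j assume j: "j \<in> {..<N}"
      show "(\<integral>\<^sup>+r. koch_weight a b r * ennreal (p j r * (1 - p j r)) \<partial>lborel) \<le> ennreal (if j < m then C1 * l powr koch_codim else C2)"
      proof (cases "j < m")
        case True
        have r: "2 * (2 * l) / a \<le> \<rho>" "0 < 2 * (2 * l) / a"
        proof -
          have "2 * (2 * l) / a \<le> 4 * sqrt V / a" using lV ab by (intro divide_right_mono) auto
          then show "2 * (2 * l) / a \<le> \<rho>" by (simp add: \<rho>_def)
          show "0 < 2 * (2 * l) / a" using l ab by simp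
        qed
        have "(\<integral>\<^sup>+r. koch_weight a b r * ennreal (p j r * (1 - p j r)) \<partial>lborel) \<le> ennreal ((b - a) * (b\<^sup>2 * (K0 * (2 * (2 * l) / a) powr koch_codim)))"
        proof (rule cell_variance[where A="A j" and d="2 * l"])
          show "dist u v < 2 * l" if "u \<in> A j" "v \<in> A j" for u v
            using that True grid_cell_dist[OF l(1)] by (simp add: A_def)
        qed (use ab Am Afin Apos j l p_def K0 r in auto)
        also have "(b - a) * (b\<^sup>2 * (K0 * (2 * (2 * l) / a) powr koch_codim)) = C1 * l powr koch_codim"
        proof -
          have "(2 * (2 * l) / a) powr koch_codim = (4 / a * l) powr koch_codim" by simp
          also have "\<dots> = (4 / a) powr koch_codim * l powr koch_codim" by (rule powr_mult)
          finally show ?thesis unfolding C1_def by simp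
        qed
        finally show ?thesis using True by simp
      next
        case False
        have "(\<integral>\<^sup>+r. koch_weight a b r * ennreal (p j r * (1 - p j r)) \<partial>lborel) \<le> ennreal C2"
          unfolding C2_def by (rule subdomain_variance[where A="A j"]) (use ab Am Afin Apos Asub j p_def in auto)
        then show ?thesis using False by simp
      qed
    qed
    also have "\<dots> = ennreal (\<Sum>j<N. if j < m then C1 * l powr koch_codim else C2)"
      using C by (intro sum_ennreal) auto
    also have "\<dots> \<le> ennreal (K * real N powr (1 - koch_codim / 2))"
    proof (rule ennreal_leI)
      have split: "(\<Sum>j<N. if j < m then u else v) = real m * u + real (N - m) * v" for u v :: real
      proof -
        have "(\<Sum>j<N. if j < m then u else v) = (\<Sum>j=0..<m. if j < m then u else v) + (\<Sum>j=m..<N. if j < m then u else v)"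
          unfolding lessThan_atLeast0 by (rule sum.atLeastLessThan_concat[symmetric]) (use mN in auto)
        also have "(\<Sum>j=0..<m. if j < m then u else v) = (\<Sum>j=0..<m. u)" by (rule sum.cong) auto
        also have "(\<Sum>j=m..<N. if j < m then u else v) = (\<Sum>j=m..<N. v)" by (rule sum.cong) auto
        finally show ?thesis by simp
      qed
      \<comment> \<open>The area of the rest bounds the number of its points: \<open>N - m\<close>
        is of order l^(\<open>koch_codim\<close> - 2), the same order as N
        l^\<open>koch_codim\<close> from the full cells.\<close>
      have "real (N - m) * l\<^sup>2 \<le> C3 * l powr koch_codim"
      proof -
        have "ennreal (real (N - m) * l\<^sup>2) = emeasure lborel (koch_rest l)" by (rule restE[symmetric])
        also have "\<dots> \<le> emeasure lborel (koch_nbhd (2 * l))" using rest(3) by (intro emeasure_mono) auto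
        also have "\<dots> \<le> ennreal (K0 * (2 * l) powr koch_codim)" using lV l by (intro K0) (auto simp: \<rho>_def)
        also have "K0 * (2 * l) powr koch_codim = C3 * l powr koch_codim" using l by (simp add: C3_def powr_mult)
        finally show ?thesis using C by (simp add: ennreal_le_iff)
      qed
      then have "real (N - m) * l\<^sup>2 / l\<^sup>2 \<le> C3 * l powr koch_codim / l\<^sup>2" by (rule divide_right_mono) simp
      then have "real (N - m) \<le> C3 * l powr koch_codim * (real N / V)" using l N V by simp
      then have r2: "real (N - m) * C2 \<le> C3 * l powr koch_codim * (real N / V) * C2" using C by (intro mult_right_mono) auto
      have "real m * (C1 * l powr koch_codim) \<le> real N * (C1 * l powr koch_codim)"
        using mN C by (intro mult_right_mono) auto
      then have "real m * (C1 * l powr koch_codim) + real (N - m) * C2 \<le> (C1 + C2 * C3 / V) * (real N * l powr koch_codim)"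
        using r2 by (simp add: algebra_simps)
      \<comment> \<open>As l^2 = V/N, the power of l becomes N to the power
        -\<open>koch_codim\<close>/2, leaving the exponent 1 - \<open>koch_codim\<close>/2 =
        d/2.\<close>
      also have "real N * l powr koch_codim = V powr (koch_codim / 2) * real N powr (1 - koch_codim / 2)"
      proof -
        have "l powr koch_codim = (V / real N) powr (koch_codim / 2)"
          using V N by (simp add: l_def powr_half_sqrt[symmetric] powr_powr)
        also have "\<dots> = V powr (koch_codim / 2) / real N powr (koch_codim / 2)" using V N by (simp add: powr_divide)
        finally show ?thesis using N by (simp add: powr_diff)
      qed
      also have "(C1 + C2 * C3 / V) * (V powr (koch_codim / 2) * real N powr (1 - koch_codim / 2)) \<le> K * real N powr (1 - koch_codim / 2)"
        unfolding K_def mult.assoc[symmetric] by (intro mult_right_mono) auto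
      finally show "(\<Sum>j<N. if j < m then C1 * l powr koch_codim else C2) \<le> K * real N powr (1 - koch_codim / 2)"
        unfolding split .
    qed
    finally have "koch_L2sq P a b \<le> ennreal (K * real N powr (1 - koch_codim / 2))" .
    then show "\<exists>P. finite P \<and> card P = N \<and> P \<subseteq> koch_domain \<and> koch_L2sq P a b \<le> ennreal (K * real N powr (1 - koch_codim / 2))"
      using P by blast
  qed
qed

theorem theorem14:
  shows "(\<exists>a b c::real. 0 < a \<and> a < b \<and> 0 < c \<and>
            (\<forall>N::nat. \<forall>P::complex set. finite P \<and> card P = N \<longrightarrow>
               ennreal ((c * real N powr (log 3 4 / 4))\<^sup>2) \<le> koch_L2sq P a b))
       \<and> (\<forall>a b::real. 0 < a \<and> a < b \<longrightarrow>
            (\<exists>c>0. \<forall>N::nat. \<exists>P::complex set. finite P \<and> card P = N \<and> P \<subseteq> koch_domain \<and>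
               koch_L2sq P a b \<le> ennreal ((c * real N powr (log 3 4 / 4))\<^sup>2)))"
proof
  have sq: "(c * real N powr (log 3 4 / 4))\<^sup>2 = c\<^sup>2 * real N powr (log 3 4 / 2)" for c and N :: nat
    by (simp add: power_mult_distrib power2_eq_square powr_add[symmetric])
  have ex: "1 - koch_codim / 2 = log 3 4 / 2" by (simp add: koch_codim_def field_simps)
  obtain a b c where abc: "0 < a" "a < b" "0 < c"
    "\<And>P N n. finite P \<Longrightarrow> card P = N \<Longrightarrow> 9^n \<le> N \<Longrightarrow> N < 9^Suc n \<Longrightarrow> ennreal (c * 4^n) \<le> koch_L2sq P a b"
    using koch_lower_bound by blast
  \<comment> \<open>The divisor 4 pays for rounding N down to a power of 9: N < 9^(n+1) gives
    N^(d/2) <= 4 * 4^n. For N = 0 the left-hand side is 0, since 0 \<open>powr\<close> any exponent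
    is 0.\<close>
  have "ennreal ((sqrt (c / 4) * real N powr (log 3 4 / 4))\<^sup>2) \<le> koch_L2sq P a b"
    if P: "finite P" "card P = N" for P N
  proof (cases "N = 0")
    case False
    then obtain n where n: "9^n \<le> real N" "real N < 9^Suc n" using power_scale[of "real N" 9] by auto
    have nN: "9^n \<le> N" "N < 9^Suc n"
      using n by (metis of_nat_le_iff of_nat_numeral of_nat_power, metis of_nat_less_iff of_nat_numeral of_nat_power)
    have four: "(9::real) powr (log 3 4 / 2) = 4"
    proof -
      have "(9::real) = 3 powr 2" by simp
      then have "(9::real) powr (log 3 4 / 2) = 3 powr (2 * (log 3 4 / 2))" by (simp only: powr_powr)
      then show ?thesis by simp
    qed
    have pw: "(9^k) powr t = ((9::real) powr t) ^ k" for k t by (induction k) (simp_all add: powr_mult)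
    have "real N powr (log 3 4 / 2) \<le> (9^Suc n) powr (log 3 4 / 2)"
      using n by (intro powr_mono2) auto
    also have "(9^Suc n) powr (log 3 4 / 2) = ((9::real) powr (log 3 4 / 2)) ^ Suc n" by (rule pw)
    also have "\<dots> = 4 ^ Suc n" unfolding four ..
    finally have "(c / 4) * real N powr (log 3 4 / 2) \<le> (c / 4) * 4 ^ Suc n" using abc by (intro mult_left_mono) auto
    then have "ennreal ((sqrt (c / 4) * real N powr (log 3 4 / 4))\<^sup>2) \<le> ennreal (c * 4^n)"
      unfolding sq using abc by (intro ennreal_leI) simp
    also have "\<dots> \<le> koch_L2sq P a b" by (rule abc(4)[OF P nN])
    finally show ?thesis .
  qed simp
  then show "\<exists>a b c::real. 0 < a \<and> a < b \<and> 0 < c \<and>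
            (\<forall>N::nat. \<forall>P::complex set. finite P \<and> card P = N \<longrightarrow>
               ennreal ((c * real N powr (log 3 4 / 4))\<^sup>2) \<le> koch_L2sq P a b)"
    using abc by (intro exI[of _ a] exI[of _ b] exI[of _ "sqrt (c / 4)"]) auto
  show "\<forall>a b::real. 0 < a \<and> a < b \<longrightarrow>
            (\<exists>c>0. \<forall>N::nat. \<exists>P::complex set. finite P \<and> card P = N \<and> P \<subseteq> koch_domain \<and>
               koch_L2sq P a b \<le> ennreal ((c * real N powr (log 3 4 / 4))\<^sup>2))"
  proof (intro allI impI)
    fix a b :: real assume ab: "0 < a \<and> a < b"
    then obtain K where K: "K > 0" "\<And>N. N > 0 \<Longrightarrow> \<exists>P. finite P \<and> card P = N \<and> P \<subseteq> koch_domain \<and>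
      koch_L2sq P a b \<le> ennreal (K * real N powr (1 - koch_codim / 2))"
      using koch_upper_bound by blast
    show "\<exists>c>0. \<forall>N::nat. \<exists>P::complex set. finite P \<and> card P = N \<and> P \<subseteq> koch_domain \<and>
               koch_L2sq P a b \<le> ennreal ((c * real N powr (log 3 4 / 4))\<^sup>2)"
    proof (intro exI[of _ "sqrt K"] conjI allI)
      show "0 < sqrt K" using K by simp
      fix N :: nat
      show "\<exists>P::complex set. finite P \<and> card P = N \<and> P \<subseteq> koch_domain \<and>
               koch_L2sq P a b \<le> ennreal ((sqrt K * real N powr (log 3 4 / 4))\<^sup>2)"
      proof (cases "N = 0")
        case True
        \<comment> \<open>Both terms of the discrepancy of the empty set vanish, so the bound 0 is
          attained.\<close>
        have "koch_L2sq {} a b = 0" unfolding koch_L2sq_def discrepancy_def by simp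
        then show ?thesis using True by (intro exI[of _ "{}"]) simp
      next
        case False
        then show ?thesis using K unfolding sq ex by simp
      qed
    qed
  qed
qed

end
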